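(* Let $N\ge1$, let $m$ be an odd positive integer and let $q=\varepsilon$ be a primitive $m$th root of unity. The De Concini-Kac-Procesi Conjecture holds for the algebra $B_q(N)$ defined in the context (Oh's algebra, up to an inessential change of notation): if $V$ is an irreducible module of $B_\varepsilon(N)$ on which $z_i^m$ and $(z_i^* )^m$ act as the scalars $a_i$ and $a_i^*$ ($i=0,\dots,N-1$), and $\mathcal O$ is the symplectic leaf containing the point $(a_0,\dots,a_{N-1},a_{N-1}^*,\dots,a_0^* )\in\mathbb C^{2N}$, then $$\dim V=m^{\frac12\dim\mathcal O}.$$
   Context: $B_q(N)$ is the associative unital $\mathbb C$-algebra generated by $z_0,\dots,z_{N-1},z_0^*,\dots,z_{N-1}^*$ subject to $z_iz_j=q^{-1}z_jz_i$ for $i<j$; $z_i^*z_j^*=q\,z_j^*z_i^*$ for $i<j$; $z_iz_j^*=q\,z_j^*z_i$ for $i\neq j$; $z_iz_i^*-q^2z_i^*z_i=(q^2-1)\sum_{k>i}z_kz_k^*$. It may be considered for generic $q$ or specialized to $q=\varepsilon$; ordered monomials in the generators form a basis. At $q=\varepsilon$ the $m$th powers of the generators are central. The Poisson structure on $\mathbb C^{2N}$, with coordinate functions $a_i,a_i^*$ corresponding to $z_i^m,(z_i^* )^m$, is defined on coordinate functions $\eta,\eta'$ corresponding to $x^m,y^m$ ($x,y$ generators) by $\{\eta,\eta'\}=\lim_{q\to\varepsilon}\frac{[x^m,y^m]}{m(q^m-1)}$, the commutator being computed for generic $q$, the limit taken coefficientwise in a basis of ordered monomials, and the result expressed as a polynomial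 in the $m$th powers of the generators. A symplectic leaf is a connected submanifold which is a maximal integral manifold of the distribution spanned by the (holomorphic) Hamiltonian vector fields; its dimension is the complex dimension. *)

theory Defs
  imports "HOL-Analysis.Analysis" "HOL-Library.Poly_Mapping"
begin

section \<open>The free algebra and the algebra \<open>B\<^sub>q(N)\<close>\<close>

text \<open>
  The index set \<open>{0,\<dots>,N-1}\<close> is a finite linearly ordered type \<open>'n\<close>, with \<open>N = CARD('n) \<ge> 1\<close>.
  \<open>Inl i\<close> labels the generator \<open>z\<^sub>i\<close> and \<open>Inr i\<close> labels \<open>z\<^sub>i\<^sup>*\<close>.
\<close>

type_synonym 'n gen = "'n + 'n"

text \<open>The free monoid; \<open>'g word \<Rightarrow>\<^sub>0 complex\<close> is then its monoid algebra, i.e. the free algebra.\<close>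

datatype 'g word = Word (letters: "'g list")

instantiation word :: (type) monoid_add
begin
definition zero_word :: "'a word" where "0 = Word []"
definition plus_word :: "'a word \<Rightarrow> 'a word \<Rightarrow> 'a word" where
  "u + v = Word (letters u @ letters v)"
instance by standard (simp_all add: zero_word_def plus_word_def)
end

type_synonym 'n free_alg = "'n gen word \<Rightarrow>\<^sub>0 complex"

definition scalar :: "complex \<Rightarrow> 'n free_alg" where
  "scalar c = Poly_Mapping.single 0 c"

definition gvar :: "'n gen \<Rightarrow> 'n free_alg" where
  "gvar x = Poly_Mapping.single (Word [x]) 1"

abbreviation Z :: "'n \<Rightarrow> 'n free_alg" where "Z i \<equiv> gvar (Inl i)"
abbreviation Zs :: "'n \<Rightarrow> 'n free_alg" where "Zs i \<equiv> gvar (Inr i)"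

text \<open>Differences of the two sides of the defining relations.\<close>

definition B_relations :: "complex \<Rightarrow> ('n::{finite,linorder}) free_alg set" where
  "B_relations q =
     {Z i * Z j - scalar (inverse q) * (Z j * Z i) | i j. i < j}
   \<union> {Zs i * Zs j - scalar q * (Zs j * Zs i) | i j. i < j}
   \<union> {Z i * Zs j - scalar q * (Zs j * Z i) | i j. i \<noteq> j}
   \<union> {Z i * Zs i - scalar (q^2) * (Zs i * Z i)
        - scalar (q^2 - 1) * (\<Sum>k\<in>{i<..}. Z k * Zs k) | i. True}"

text \<open>The two-sided ideal they generate; \<open>B\<^sub>q(N)\<close> is the free algebra modulo this ideal.\<close>

inductive_set B_ideal :: "complex \<Rightarrow> ('n::{finite,linorder}) free_alg set" for q :: complex where
  zero: "0 \<in> B_ideal q"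
| gen: "r \<in> B_relations q \<Longrightarrow> f * r * g \<in> B_ideal q"
| add: "f \<in> B_ideal q \<Longrightarrow> g \<in> B_ideal q \<Longrightarrow> f + g \<in> B_ideal q"

definition eq_in_B :: "complex \<Rightarrow> ('n::{finite,linorder}) free_alg \<Rightarrow> 'n free_alg \<Rightarrow> bool" where
  "eq_in_B q f g \<longleftrightarrow> f - g \<in> B_ideal q"


section \<open>Modules\<close>

text \<open>
  A module over the quotient \<open>B\<^sub>q(N)\<close> is a unital module over the free algebra that is annihilated
  by the ideal. The underlying complex vector space is the type \<open>'v\<close> with scalar
  multiplication \<open>smul\<close>.
\<close>

definition B_module ::
  "complex \<Rightarrow> (complex \<Rightarrow> 'v::ab_group_add \<Rightarrow> 'v) \<Rightarrow> (('n::{finite,linorder}) free_alg \<Rightarrow> 'v \<Rightarrow> 'v) \<Rightarrow> bool"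
where
  "B_module q smul \<rho> \<longleftrightarrow>
     vector_space smul
   \<and> (\<forall>f. Vector_Spaces.linear smul smul (\<rho> f))
   \<and> (\<forall>f g v. \<rho> (f + g) v = \<rho> f v + \<rho> g v)
   \<and> (\<forall>f g v. \<rho> (f * g) v = \<rho> f (\<rho> g v))
   \<and> (\<forall>c v. \<rho> (scalar c) v = smul c v)
   \<and> (\<forall>f\<in>B_ideal q. \<forall>v. \<rho> f v = 0)"

definition irreducible_B_module ::
  "complex \<Rightarrow> (complex \<Rightarrow> 'v::ab_group_add \<Rightarrow> 'v) \<Rightarrow> (('n::{finite,linorder}) free_alg \<Rightarrow> 'v \<Rightarrow> 'v) \<Rightarrow> bool"
where
  "irreducible_B_module q smul \<rho> \<longleftrightarrow>
     B_module q smul \<rho>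
   \<and> (\<exists>v::'v. v \<noteq> 0)
   \<and> (\<forall>W. module.subspace smul W \<and> (\<forall>f. \<rho> f ` W \<subseteq> W) \<longrightarrow> W = {0} \<or> W = UNIV)"


section \<open>The Poisson structure\<close>

text \<open>Monomials in the order \<open>z\<^sub>0, \<dots>, z\<^bsub>N-1\<^esub>, z\<^bsub>N-1\<^esub>\<^sup>*, \<dots>, z\<^sub>0\<^sup>*\<close>.\<close>

definition ordered_monomial :: "('n::{finite,linorder} gen \<Rightarrow> nat) \<Rightarrow> 'n free_alg" where
  "ordered_monomial \<alpha> =
     prod_list (map (\<lambda>i. Z i ^ \<alpha> (Inl i)) (sorted_list_of_set UNIV))
   * prod_list (map (\<lambda>i. Zs i ^ \<alpha> (Inr i)) (rev (sorted_list_of_set UNIV)))"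

text \<open>The coefficients of an element of \<open>B\<^sub>q(N)\<close> in the basis of ordered monomials.\<close>

definition basis_coeffs ::
  "complex \<Rightarrow> ('n::{finite,linorder}) free_alg \<Rightarrow> (('n gen \<Rightarrow> nat) \<Rightarrow>\<^sub>0 complex)" where
  "basis_coeffs q f =
     (THE c. eq_in_B q f (\<Sum>\<alpha>\<in>Poly_Mapping.keys c.
                            scalar (Poly_Mapping.lookup c \<alpha>) * ordered_monomial \<alpha>))"

definition generic :: "complex set" where
  "generic = {q. q \<noteq> 0 \<and> (\<forall>k>0. q ^ k \<noteq> 1)}"

text \<open>
  A polynomial \<open>P\<close> in the coordinate functions is given by its coefficients. Substituting \<open>x\<^sup>m\<close> for the
  coordinate of each generator \<open>x\<close> turns the monomial with exponents \<open>\<beta>\<close> into the ordered monomial with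
  exponents \<open>m\<beta>\<close>; the order of the factors is irrelevant in \<open>B\<^sub>\<epsilon>(N)\<close>, where the \<open>m\<close>th powers are central.
\<close>

definition in_powers :: "nat \<Rightarrow> (('g \<Rightarrow> nat) \<Rightarrow>\<^sub>0 complex) \<Rightarrow> (('g \<Rightarrow> nat) \<Rightarrow>\<^sub>0 complex)" where
  "in_powers m P =
     (\<Sum>\<beta>\<in>Poly_Mapping.keys P. Poly_Mapping.single (\<lambda>x. m * \<beta> x) (Poly_Mapping.lookup P \<beta>))"

definition coord_bracket ::
  "complex \<Rightarrow> nat \<Rightarrow> ('n::{finite,linorder}) gen \<Rightarrow> 'n gen \<Rightarrow> (('n gen \<Rightarrow> nat) \<Rightarrow>\<^sub>0 complex)" where
  "coord_bracket \<epsilon> m x y =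
     (THE P. \<forall>\<alpha>. ((\<lambda>q. Poly_Mapping.lookup
                         (basis_coeffs q (gvar x ^ m * gvar y ^ m - gvar y ^ m * gvar x ^ m)) \<alpha>
                       / (of_nat m * (q ^ m - 1)))
                  \<longlongrightarrow> Poly_Mapping.lookup (in_powers m P) \<alpha>) (at \<epsilon> within generic))"

definition eval_poly :: "(('g::finite \<Rightarrow> nat) \<Rightarrow>\<^sub>0 complex) \<Rightarrow> complex ^ 'g \<Rightarrow> complex" where
  "eval_poly P p =
     (\<Sum>\<beta>\<in>Poly_Mapping.keys P. Poly_Mapping.lookup P \<beta> * (\<Prod>x\<in>UNIV. (p $ x) ^ \<beta> x))"

definition holomorphic_fun :: "(complex ^ 'g::finite) set \<Rightarrow> (complex ^ 'g \<Rightarrow> complex) \<Rightarrow> bool" where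
  "holomorphic_fun W f \<longleftrightarrow>
     (\<forall>p\<in>W. \<exists>D. Vector_Spaces.linear (*s) (*) D \<and> (f has_derivative D) (at p))"

definition holomorphic_map :: "(complex ^ 'g::finite) set \<Rightarrow> (complex ^ 'g \<Rightarrow> complex ^ 'g) \<Rightarrow> bool" where
  "holomorphic_map W F \<longleftrightarrow> (\<forall>x. holomorphic_fun W (\<lambda>p. F p $ x))"

definition partial_deriv :: "'g \<Rightarrow> (complex ^ 'g::finite \<Rightarrow> complex) \<Rightarrow> complex ^ 'g \<Rightarrow> complex" where
  "partial_deriv x f p = deriv (\<lambda>t. f (p + t *s axis x 1)) 0"

text \<open>
  The bracket on coordinate functions extended by the Leibniz rule; the Hamiltonian vector field
  of \<open>f\<close> is \<open>{f, \<sqdot>}\<close>.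
\<close>

definition hamiltonian ::
  "complex \<Rightarrow> nat \<Rightarrow> (complex ^ ('n::{finite,linorder} gen) \<Rightarrow> complex) \<Rightarrow> complex ^ 'n gen \<Rightarrow> complex ^ 'n gen"
where
  "hamiltonian \<epsilon> m f p =
     (\<chi> y. \<Sum>x\<in>UNIV. partial_deriv x f p * eval_poly (coord_bracket \<epsilon> m x y) p)"

definition hamiltonian_distribution ::
  "complex \<Rightarrow> nat \<Rightarrow> complex ^ ('n::{finite,linorder} gen) \<Rightarrow> (complex ^ 'n gen) set" where
  "hamiltonian_distribution \<epsilon> m p = vec.span {hamiltonian \<epsilon> m f p | f. holomorphic_fun UNIV f}"


section \<open>Symplectic leaves\<close>

definition biholomorphic_on ::
  "(complex ^ 'g::finite) set \<Rightarrow> (complex ^ 'g \<Rightarrow> complex ^ 'g) \<Rightarrow> bool" where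
  "biholomorphic_on W F \<longleftrightarrow>
     open W \<and> open (F ` W) \<and> holomorphic_map W F
   \<and> (\<exists>G. holomorphic_map (F ` W) G \<and> (\<forall>p\<in>W. G (F p) = p))"

text \<open>
  An (immersed) submanifold is given by its own topology \<open>X\<close>, with underlying set \<open>topspace X\<close>; this
  may be finer than the subspace topology, since a leaf need not be embedded. Around each of
  its points it must have an \<open>X\<close>-open piece that carries the subspace topology and is mapped by a local
  biholomorphic coordinate change \<open>F\<close> of the ambient space onto an open piece of a \<open>k\<close>-dimensional
  linear subspace \<open>S\<close>.
\<close>

definition slice_chart ::
  "nat \<Rightarrow> (complex ^ 'g::finite) topology \<Rightarrow> complex ^ 'g
   \<Rightarrow> (complex ^ 'g) set \<Rightarrow> (complex ^ 'g \<Rightarrow> complex ^ 'g) \<Rightarrow> (complex ^ 'g) set \<Rightarrow> bool" where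
  "slice_chart k X p W F S \<longleftrightarrow>
     biholomorphic_on W F \<and> vec.subspace S \<and> vec.dim S = k
   \<and> p \<in> W \<and> F p \<in> S
   \<and> openin X {w\<in>W. F w \<in> S}
   \<and> subtopology X {w\<in>W. F w \<in> S} = top_of_set {w\<in>W. F w \<in> S}"

text \<open>
  \<open>X\<close> is a submanifold of complex dimension \<open>k\<close> whose tangent space at each point \<open>p\<close>, which is
  the preimage of \<open>S\<close> under the derivative of \<open>F\<close> at \<open>p\<close>, equals \<open>\<Delta> p\<close>.
\<close>

definition integral_manifold ::
  "nat \<Rightarrow> (complex ^ 'g::finite \<Rightarrow> (complex ^ 'g) set) \<Rightarrow> (complex ^ 'g) topology \<Rightarrow> bool" where
  "integral_manifold k \<Delta> X \<longleftrightarrow>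
     (\<forall>p\<in>topspace X. \<exists>W F S. slice_chart k X p W F S
        \<and> {v. frechet_derivative F (at p) v \<in> S} = \<Delta> p)"

text \<open>\<open>X\<close> is a symplectic leaf of complex dimension \<open>k\<close>.\<close>

definition symplectic_leaf ::
  "complex \<Rightarrow> nat \<Rightarrow> nat \<Rightarrow> (complex ^ ('n::{finite,linorder} gen)) topology \<Rightarrow> bool" where
  "symplectic_leaf \<epsilon> m k X \<longleftrightarrow>
     connected_space X
   \<and> integral_manifold k (hamiltonian_distribution \<epsilon> m) X
   \<and> (\<forall>l Y. connected_space Y \<and> integral_manifold l (hamiltonian_distribution \<epsilon> m) Y
            \<and> topspace X \<subseteq> topspace Y \<longrightarrow> Y = X)"

definition primitive_root_of_unity :: "nat \<Rightarrow> complex \<Rightarrow> bool" where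
  "primitive_root_of_unity m \<epsilon> \<longleftrightarrow> m > 0 \<and> \<epsilon> ^ m = 1 \<and> (\<forall>k. 0 < k \<and> k < m \<longrightarrow> \<epsilon> ^ k \<noteq> 1)"

end

theory Submission
  imports Defs "HOL-Computational_Algebra.Fundamental_Theorem_Algebra"
begin

text \<open>
  The tangent space of a leaf at a point is spanned by the Hamiltonian vectors there, so the dimension of the leaf
  is the rank of the matrix of Poisson brackets of the coordinates. Put \<open>y\<^sub>i = \<Sum>\<^bsub>k\<ge>i\<^esub> z\<^sub>k z\<^sub>k\<^sup>*\<close>. Then
  \<open>z\<^sub>i z\<^sub>i\<^sup>* = y\<^sub>i - y\<^bsub>i+1\<^esub>\<close>, \<open>z\<^sub>i\<^sup>* z\<^sub>i = q\<^sup>-\<^sup>2 y\<^sub>i - y\<^bsub>i+1\<^esub>\<close>, and \<open>y\<^sub>i\<close> commutes with every generator up to a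
  power of \<open>q\<close>. Expanding \<open>z\<^sub>i\<^sup>*\<^sup>m z\<^sub>i\<^sup>m\<close> with Gaussian coefficients gives \<open>{a\<^sub>i, a\<^sub>i\<^sup>*} = 2 Y\<^sub>i\<close> with
  \<open>Y\<^sub>i = \<Sum>\<^bsub>k\<ge>i\<^esub> a\<^sub>k a\<^sub>k\<^sup>*\<close>; all other brackets of coordinates are \<open>\<plusminus>\<close> their product. At \<open>q = \<epsilon>\<close>, \<open>y\<^sub>i\<^sup>m\<close>
  corresponds to \<open>Y\<^sub>i\<close>.

  The dimension of an irreducible module and the rank of the Poisson matrix obey the same recursion, in which the
  smallest index \<open>i\<close> is removed. It involves modules with an additional invertible operator \<open>g\<close> satisfying
  \<open>g z\<^sub>j = q\<^sup>-\<^sup>1 z\<^sub>j g\<close> and \<open>g z\<^sub>j\<^sup>* = q z\<^sub>j\<^sup>* g\<close>; if \<open>Y\<^sub>i \<noteq> 0\<close>, then \<open>y\<^sub>i\<^bsup>(m+1)/2\<^esup>\<close> is such an operator.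
  With \<open>g\<close> present and \<open>z\<^sub>i\<close> or \<open>z\<^sub>i\<^sup>*\<close> invertible, passing to an eigenspace of \<open>g\<close> divides the dimension by \<open>m\<close> and
  lowers the rank by 2. The same happens on passing to the kernel of \<open>z\<^sub>i\<close> if \<open>a\<^sub>i = a\<^sub>i\<^sup>* = 0 \<noteq> Y\<^sub>i\<close>. If
  \<open>a\<^sub>i = a\<^sub>i\<^sup>* = Y\<^sub>i = 0\<close>, then \<open>z\<^sub>i\<close> and \<open>z\<^sub>i\<^sup>*\<close> act as 0; if \<open>Y\<^sub>i = 0\<close> and there is no \<open>g\<close>, an invertible \<open>z\<^sub>i\<close> or
  \<open>z\<^sub>i\<^sup>*\<close> takes the role of \<open>g\<close>. In both cases neither the dimension nor the rank changes.
\<close>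


section \<open>Rank of skew-symmetric matrices\<close>

text \<open>\<open>V\<close> comes without a finiteness hypothesis. Eigenvectors exist because the
  operators in question have a scalar m-th power, and finite bases are assembled from the
  one-dimensional end of the recursion, m translates at a time.

  Oddness of m enters through three facts: q^2 is again a primitive m-th root of unity, so Gaussian
  coefficients in q^-2 vanish at \<epsilon>; (m+1)/2 is an integer inverse of 2 modulo m; and m
  divides m(m-1)/2, so reordering factors in an m-th power leaves no power of q behind.

  The obstacle on the Poisson side is that the bracket is a coefficientwise limit. Coefficients make
  sense only if the ordered monomials are independent at every nonzero q; this is read off from
  leading terms of an action on a quantum torus. The limit can be taken only if the coefficients
  depend continuously on q; therefore all algebras B_q(N) are treated at once, with functions of q
  as scalars.

  An eigenspace of g no longer carries g, while an invertible generator can create a new one. This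
  is why modules and matrices with and without g have to be treated in one induction.\<close>

definition mrank :: "('x::finite \<Rightarrow> 'y::finite \<Rightarrow> complex) \<Rightarrow> nat" where
  "mrank M = vec.dim (range (\<lambda>x. \<chi> y. M x y))"

definition skew :: "('x \<Rightarrow> 'x \<Rightarrow> complex) \<Rightarrow> bool" where
  "skew M \<longleftrightarrow> (\<forall>x y. M y x = - M x y)"

lemma skewD: "skew M \<Longrightarrow> M y x = - M x y"
  unfolding skew_def by blast

lemma skew_diag: "skew M \<Longrightarrow> M x x = 0"
  using skewD[of M x x] by simp

text \<open>In \<open>N = E M E^T\<close> the rows of \<open>N\<close> are combinations of the
  images under \<open>E\<close> of the rows of \<open>M\<close>. The matrix \<open>E\<close> may be
  rectangular or singular.\<close>

lemma mrank_congruence_le: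
  fixes M :: "'x::finite \<Rightarrow> 'x \<Rightarrow> complex" and N :: "'y::finite \<Rightarrow> 'y \<Rightarrow> complex"
  assumes N: "\<And>u v. N u v = (\<Sum>x\<in>UNIV. \<Sum>y\<in>UNIV. E u x * E v y * M x y)"
  shows "mrank N \<le> mrank M"
proof -
  define T :: "complex ^ 'x \<Rightarrow> complex ^ 'y" where "T = (\<lambda>r. \<chi> v. \<Sum>y\<in>UNIV. E v y * r $ y)"
  have lin: "Vector_Spaces.linear (*s) (*s) T"
    by unfold_locales
      (auto simp: T_def vec_eq_iff algebra_simps sum.distrib sum_distrib_left)
  let ?R = "range (\<lambda>x. \<chi> y. M x y)"
  have "(\<chi> v. N u v) \<in> vec.span (T ` ?R)" for u
  proof -
    have "(\<chi> v. N u v) = (\<Sum>x\<in>UNIV. E u x *s T (\<chi> y. M x y))"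
      by (auto simp: vec_eq_iff N T_def sum_distrib_left mult_ac)
    also have "\<dots> \<in> vec.span (T ` ?R)"
      by (intro vec.span_sum vec.span_scale vec.span_base) auto
    finally show ?thesis .
  qed
  then have "range (\<lambda>u. \<chi> v. N u v) \<subseteq> vec.span (T ` ?R)" by auto
  then have "mrank N \<le> vec.dim (T ` ?R)"
    unfolding mrank_def by (rule vec.dim_mono)
  also have "\<dots> \<le> mrank M"
    unfolding mrank_def by (rule vec.dim_image_le[OF lin])
  finally show ?thesis .
qed

lemma mrank_zero:
  fixes M :: "'x::finite \<Rightarrow> 'y::finite \<Rightarrow> complex"
  assumes "\<And>x y. M x y = 0" shows "mrank M = 0"
proof -
  have "range (\<lambda>x. \<chi> y. M x y) \<subseteq> {0}" using assms by (auto simp: vec_eq_iff)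
  then show ?thesis unfolding mrank_def by simp
qed

text \<open>A diagonal congruence. Zero entries of \<open>d\<close> are allowed, so this also covers
  the deletion of a row together with its column.\<close>

lemma mrank_scale_le:
  fixes M :: "'x::finite \<Rightarrow> 'x \<Rightarrow> complex"
  assumes "\<And>x y. N x y = d x * d y * M x y"
  shows "mrank N \<le> mrank M"
  by (rule mrank_congruence_le[where E = "\<lambda>u x. if x = u then d u else 0"])
    (simp add: assms if_distrib[where f = "\<lambda>t. t * _"] if_distrib[where f = "(*) _"] sum.If_cases
      sum_distrib_left[symmetric] mult.assoc cong: if_cong)

lemma mrank_scale:
  fixes M :: "'x::finite \<Rightarrow> 'x \<Rightarrow> complex"
  assumes N: "\<And>x y. N x y = d x * d y * M x y" and nz: "\<And>x. d x \<noteq> 0"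
  shows "mrank N = mrank M"
proof (rule antisym[OF mrank_scale_le[OF N]])
  show "mrank M \<le> mrank N"
    by (rule mrank_scale_le[where d = "\<lambda>x. inverse (d x)"]) (simp add: N nz field_simps)
qed

text \<open>The radical vector \<open>c\<close> expresses row \<open>z\<close> through the other
  rows, and by skewness column \<open>z\<close> through the other columns. Any \<open>z\<close> in
  the support of \<open>c\<close> may be deleted; comparing two choices of \<open>z\<close> allows
  one coordinate to be traded for another.\<close>

lemma mrank_delete_radical:
  fixes M :: "'x::finite \<Rightarrow> 'x \<Rightarrow> complex"
  assumes sk: "skew M" and rad: "\<And>y. (\<Sum>x\<in>UNIV. c x * M x y) = 0" and cz: "c z \<noteq> 0"
    and N: "\<And>x y. N x y = (if x = z \<or> y = z then 0 else M x y)"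
  shows "mrank N = mrank M"
proof (rule antisym)
  show "mrank N \<le> mrank M"
    by (rule mrank_scale_le[where d = "\<lambda>x. if x = z then 0 else 1"]) (simp add: N)
  have row: "M z y = (\<Sum>x\<in>UNIV - {z}. - (c x / c z) * M x y)" for y
  proof -
    have "c z * M z y + (\<Sum>x\<in>UNIV - {z}. c x * M x y) = 0"
      using rad[of y] by (simp add: sum.remove[of UNIV z])
    then have "M z y = - (\<Sum>x\<in>UNIV - {z}. c x * M x y) / c z"
      using cz by (simp add: field_simps eq_neg_iff_add_eq_0)
    then show ?thesis by (simp add: sum_divide_distrib sum_negf)
  qed
  have col: "M y z = (\<Sum>x\<in>UNIV - {z}. - (c x / c z) * M y x)" for y
  proof -
    have "M y z = - M z y" by (rule skewD[OF sk])
    also have "\<dots> = (\<Sum>x\<in>UNIV - {z}. - (c x / c z) * - M x y)" by (simp add: row sum_negf)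
    also have "\<dots> = (\<Sum>x\<in>UNIV - {z}. - (c x / c z) * M y x)"
      by (intro sum.cong refl arg_cong2[where f = "(*)"]) (rule skewD[OF sk, symmetric])
    finally show ?thesis .
  qed
  \<comment> \<open>Row \<open>z\<close> of \<open>E\<close> holds the coefficients that reproduce
    row \<open>z\<close> of \<open>M\<close> from the others. Column \<open>z\<close> of
    \<open>E\<close> vanishes, so \<open>M\<close> and \<open>N\<close> give the same double
    sum.\<close>
  define E where "E = (\<lambda>u x. if x = z then 0 else if u = z then - (c x / c z) else if x = u then 1 else (0::complex))"
  have half: "(\<Sum>x\<in>UNIV. E u x * f x) = (if u = z then (\<Sum>x\<in>UNIV - {z}. - (c x / c z) * f x) else f u)"
    for u and f :: "'x \<Rightarrow> complex"
    by (auto simp: E_def sum.remove[of UNIV z] if_distrib[where f = "\<lambda>t. t * _"] cong: if_cong intro!: sum.cong)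
  show "mrank M \<le> mrank N"
  proof (rule mrank_congruence_le[where E = E])
    fix u v
    have "E u x * E v y * N x y = E u x * (E v y * M x y)" for x y
      by (simp add: E_def N)
    then have "(\<Sum>x\<in>UNIV. \<Sum>y\<in>UNIV. E u x * E v y * N x y)
        = (\<Sum>x\<in>UNIV. E u x * (\<Sum>y\<in>UNIV. E v y * M x y))"
      by (simp only: sum_distrib_left)
    also have "(\<lambda>x. \<Sum>y\<in>UNIV. E v y * M x y) = (\<lambda>x. M x v)"
    proof
      show "(\<Sum>y\<in>UNIV. E v y * M x y) = M x v" for x
        using col[of x] by (cases "v = z") (simp_all add: half)
    qed
    also have "(\<Sum>x\<in>UNIV. E u x * M x v) = M u v"
      using row[of v] by (cases "u = z") (simp_all add: half)
    finally show "M u v = (\<Sum>x\<in>UNIV. \<Sum>y\<in>UNIV. E u x * E v y * N x y)" by simp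
  qed
qed

text \<open>\<open>N\<close> is the Schur complement of the hyperbolic plane spanned by
  \<open>s\<close> and \<open>t\<close>. Its rows vanish in the columns \<open>s\<close> and
  \<open>t\<close>, whereas rows \<open>s\<close> and \<open>t\<close> of \<open>M\<close> have
  invertible entries there, so exactly two dimensions are lost.\<close>

lemma mrank_pivot:
  fixes M :: "'x::finite \<Rightarrow> 'x \<Rightarrow> complex"
  assumes sk: "skew M" and pv: "M s t \<noteq> 0"
    and N: "\<And>x y. N x y = M x y + (M x s * M t y - M x t * M s y) / M s t"
  shows "mrank M = mrank N + 2"
proof -
  define r where "r = (\<lambda>x. (\<chi> y. M x y) :: complex ^ 'x)"
  define n where "n = (\<lambda>x. (\<chi> y. N x y) :: complex ^ 'x)"
  note diag = skew_diag[OF sk]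
  note ts = skewD[OF sk, of t s]
  let ?R = "range r" and ?N = "range n"
  have nx: "n x = r x + (M x s / M s t) *s r t - (M x t / M s t) *s r s" for x
    by (simp add: vec_eq_iff n_def r_def N diff_divide_distrib field_simps)
  have span_eq: "vec.span ?R = vec.span (insert (r s) (insert (r t) ?N))"
  proof (rule antisym; rule vec.span_minimal[OF _ vec.subspace_span]; safe)
    fix x
    have "r x = n x - (M x s / M s t) *s r t + (M x t / M s t) *s r s" by (simp add: nx)
    then show "r x \<in> vec.span (insert (r s) (insert (r t) ?N))"
      by (auto intro!: vec.span_add vec.span_diff vec.span_scale intro: vec.span_base)
  next
    fix x show "n x \<in> vec.span ?R" unfolding nx
      by (auto intro!: vec.span_add vec.span_diff vec.span_scale intro: vec.span_base)
  qed (auto intro: vec.span_base)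
  have Nz: "vec.span ?N \<subseteq> {v. v $ s = 0 \<and> v $ t = 0}"
  proof (rule vec.span_minimal)
    show "?N \<subseteq> {v. v $ s = 0 \<and> v $ t = 0}"
      using pv by (auto simp: n_def N diag ts)
    show "vec.subspace {v :: complex ^ 'x. v $ s = 0 \<and> v $ t = 0}"
      by (auto simp: vec.subspace_def)
  qed
  have t: "r t \<notin> vec.span ?N" using Nz pv by (auto simp: r_def ts)
  have "r s \<notin> vec.span (insert (r t) ?N)"
  proof
    assume "r s \<in> vec.span (insert (r t) ?N)"
    then obtain k where "r s - k *s r t \<in> vec.span ?N" by (auto simp: vec.span_insert)
    then have "(r s - k *s r t) $ t = 0" using Nz by blast
    then show False using pv by (simp add: r_def diag)
  qed
  then have "vec.dim (insert (r s) (insert (r t) ?N)) = vec.dim ?N + 2"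
    using t by (simp add: vec.dim_insert)
  then have "vec.dim ?R = vec.dim ?N + 2"
    by (metis span_eq vec.dim_span)
  then show ?thesis by (simp add: mrank_def r_def n_def)
qed


section \<open>The Poisson matrix\<close>

fun idx :: "'n gen \<Rightarrow> 'n" where
  "idx (Inl i) = i" | "idx (Inr i) = i"

text \<open>The degree of a generator for the grading in which each z_i has degree 1 and each z_i^*
  has degree -1.\<close>

fun tau :: "'n gen \<Rightarrow> complex" where
  "tau (Inl i) = 1" | "tau (Inr i) = - 1"

fun star :: "'n gen \<Rightarrow> 'n gen" where
  "star (Inl i) = Inr i" | "star (Inr i) = Inl i"

lemma idx_star [simp]: "idx (star x) = idx x" by (cases x) auto
lemma star_star [simp]: "star (star x) = x" by (cases x) auto
lemma star_neq [simp]: "star x \<noteq> x" "x \<noteq> star x" by (cases x; simp)+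
lemma tau_star [simp]: "tau (star x) = - tau x" by (cases x) auto
lemma tau_nz [simp]: "tau x \<noteq> 0" by (cases x) auto
text \<open>This is q to the power \<open>- tau x\<close>: the factor that arises when any generator
  of smaller index is moved from the left of \<open>x\<close> to its right. It depends only on the
  generator with the larger index.\<close>

definition qq :: "complex \<Rightarrow> 'n gen \<Rightarrow> complex" where
  "qq q x = (case x of Inl _ \<Rightarrow> inverse q | Inr _ \<Rightarrow> q)"

lemma qq_simps [simp]: "qq q (Inl i) = inverse q" "qq q (Inr i) = q"
  by (simp_all add: qq_def)

lemma qq_nz [simp]: "q \<noteq> 0 \<Longrightarrow> qq q x \<noteq> 0"
  by (cases x) auto

lemma idx_eq_cases: "idx x = idx y \<longleftrightarrow> x = y \<or> x = star y"
  by (cases x; cases y) auto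

definition casimir :: "('n::{finite,linorder}) set \<Rightarrow> ('n gen \<Rightarrow> complex) \<Rightarrow> 'n \<Rightarrow> complex" where
  "casimir S a i = (\<Sum>k | k \<in> S \<and> i \<le> k. a (Inl k) * a (Inr k))"

definition poisson_entry ::
  "('n::{finite,linorder}) set \<Rightarrow> ('n gen \<Rightarrow> complex) \<Rightarrow> 'n gen \<Rightarrow> 'n gen \<Rightarrow> complex" where
  "poisson_entry S a x y =
     (if idx x < idx y then - tau y * a x * a y
      else if idx y < idx x then tau x * a x * a y
      else if x = y then 0 else tau x * 2 * casimir S a (idx x))"

text \<open>
  The row and column \<open>None\<close>, present when \<open>\<gamma>\<close> holds, belong to an additional grading variable \<open>g = 1\<close>
  with \<open>{g, a\<^sub>j} = - g a\<^sub>j\<close> and \<open>{g, a\<^sub>j\<^sup>*} = g a\<^sub>j\<^sup>*\<close>.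
\<close>

fun bmat :: "('n::{finite,linorder}) set \<Rightarrow> bool \<Rightarrow> ('n gen \<Rightarrow> complex) \<Rightarrow> 'n gen option \<Rightarrow> 'n gen option \<Rightarrow> complex"
where
  "bmat S \<gamma> a (Some x) (Some y) = (if idx x \<in> S \<and> idx y \<in> S then poisson_entry S a x y else 0)"
| "bmat S \<gamma> a None (Some y) = (if \<gamma> \<and> idx y \<in> S then - tau y * a y else 0)"
| "bmat S \<gamma> a (Some x) None = (if \<gamma> \<and> idx x \<in> S then tau x * a x else 0)"
| "bmat S \<gamma> a None None = 0"

lemma skew_bmat: "skew (bmat S \<gamma> a)"
proof -
  have pe: "poisson_entry S a y x = - poisson_entry S a x y" for x y
    by (cases x; cases y) (auto simp: poisson_entry_def)
  have "bmat S \<gamma> a v u = - bmat S \<gamma> a u v" for u v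
    by (cases u; cases v) (auto intro: pe)
  then show ?thesis unfolding skew_def by blast
qed

lemma skew_delete: "skew M \<Longrightarrow> skew (\<lambda>x y. if x = z \<or> y = z then 0 else M x y)"
  using skewD[of M] unfolding skew_def by (smt (verit) add.inverse_neutral)

lemma sum_gen:
  fixes f :: "'n::finite gen \<Rightarrow> 'b::comm_monoid_add"
  shows "(\<Sum>x\<in>UNIV. f x) = (\<Sum>k\<in>UNIV. f (Inl k) + f (Inr k))"
  unfolding UNIV_sum by (subst sum.union_disjoint) (auto simp: sum.reindex sum.distrib inj_def)

lemma sum_option_UNIV:
  fixes f :: "'b::finite option \<Rightarrow> 'c::comm_monoid_add"
  shows "(\<Sum>x\<in>UNIV. f x) = f None + (\<Sum>x\<in>UNIV. f (Some x))"
  by (simp add: UNIV_option_conv sum.reindex)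

text \<open>
  With \<open>Y\<^sub>0 = \<Sum> a\<^sub>k a\<^sub>k\<^sup>*\<close>, these are the coordinates of the covector \<open>dY\<^sub>0 - 2 Y\<^sub>0 dg\<close>, which lies in the
  radical.
\<close>

fun radical_vector :: "('n::{finite,linorder}) set \<Rightarrow> ('n gen \<Rightarrow> complex) \<Rightarrow> 'n gen option \<Rightarrow> complex" where
  "radical_vector S a None = - 2 * (\<Sum>k\<in>S. a (Inl k) * a (Inr k))"
| "radical_vector S a (Some x) = (if idx x \<in> S then a (star x) else 0)"

text \<open>In the Hamiltonian vector field of Y_0 the two terms of an index above
  \<open>idx y\<close> cancel, an index below contributes its own product, and the index of
  \<open>y\<close> itself contributes the whole tail sum. Together they complete Y_0, so {Y_0, a_y}
  is a multiple of a_y and can be compensated by a multiple of dg.\<close>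

lemma casimir_hamiltonian:
  assumes y: "idx y \<in> S"
  shows "(\<Sum>x\<in>UNIV. (if idx x \<in> S then a (star x) else 0) * bmat S \<gamma> a (Some x) (Some y))
    = - 2 * tau y * (\<Sum>k\<in>S. a (Inl k) * a (Inr k)) * a y" (is "?L = _")
proof -
  let ?j = "idx y"
  have fin: "finite S" by simp
  have "?L = (\<Sum>k\<in>UNIV. if k \<in> S then
      a (Inr k) * poisson_entry S a (Inl k) y + a (Inl k) * poisson_entry S a (Inr k) y else 0)"
    unfolding sum_gen by (intro sum.cong refl) (use y in auto)
  also have "\<dots> = (\<Sum>k\<in>S.
      a (Inr k) * poisson_entry S a (Inl k) y + a (Inl k) * poisson_entry S a (Inr k) y)"
    by (simp add: sum.If_cases)
  also have "\<dots> = (\<Sum>k\<in>S. - 2 * tau y * a y *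
      ((if k < ?j then a (Inl k) * a (Inr k) else 0) + (if k = ?j then casimir S a ?j else 0)))"
    by (intro sum.cong refl; cases y) (auto simp: poisson_entry_def)
  also have "\<dots> = - 2 * tau y * a y *
      ((\<Sum>k | k \<in> S \<and> k < ?j. a (Inl k) * a (Inr k)) + casimir S a ?j)"
    using y by (simp add: sum_distrib_left[symmetric] sum_negf sum.distrib sum.If_cases Int_def conj_commute)
  also have "(\<Sum>k | k \<in> S \<and> k < ?j. a (Inl k) * a (Inr k)) + casimir S a ?j
      = (\<Sum>k\<in>S. a (Inl k) * a (Inr k))"
    unfolding casimir_def by (subst sum.union_disjoint[symmetric]) (auto intro!: sum.cong)
  finally show ?thesis by (simp add: mult_ac)
qed

lemma radical_vector:
  assumes "\<gamma> \<or> (\<Sum>k\<in>S. a (Inl k) * a (Inr k)) = 0"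
  shows "(\<Sum>x\<in>UNIV. radical_vector S a x * bmat S \<gamma> a x v) = 0"
proof (cases v)
  case None
  then show ?thesis
    by (simp add: sum_option_UNIV sum_gen) (auto intro!: sum.neutral simp: algebra_simps)
next
  case (Some y)
  show ?thesis
  proof (cases "idx y \<in> S")
    case True
    then show ?thesis using assms casimir_hamiltonian[OF True, of a \<gamma>]
      by (auto simp: sum_option_UNIV Some)
  next
    case False
    then show ?thesis by (simp add: sum_option_UNIV Some)
  qed
qed

text \<open>For Y_0 nonzero the radical vector has a nonzero g-coordinate, so the row of g depends
  on the others. On modules this corresponds to the fact that a power of y_0 serves as g.\<close>

lemma mrank_bmat_grade:
  assumes "(\<Sum>k\<in>S. a (Inl k) * a (Inr k)) \<noteq> 0"
  shows "mrank (bmat S True a) = mrank (bmat S False a)"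
proof -
  have N: "bmat S False a x y = (if x = None \<or> y = None then 0 else bmat S True a x y)" for x y
    by (cases x; cases y) auto
  show ?thesis
    by (rule mrank_delete_radical[OF skew_bmat _ _ N, symmetric, where c = "radical_vector S a"])
      (use assms in \<open>auto simp: radical_vector\<close>)
qed

text \<open>All tail sums are multiplied by \<open>d1 * d2\<close>, so the rescaling is a diagonal
  congruence. It is needed because the m-th powers act on an eigenspace of g by rescaled
  scalars.\<close>

lemma mrank_bmat_scale:
  assumes "d1 \<noteq> 0" "d2 \<noteq> 0"
    and b: "\<And>i. b (Inl i) = d1 * a (Inl i)" "\<And>i. b (Inr i) = d2 * a (Inr i)"
  shows "mrank (bmat S False b) = mrank (bmat S False a)"
proof (rule mrank_scale)
  let ?d = "\<lambda>x. case x of None \<Rightarrow> 1 | Some (Inl i) \<Rightarrow> d1 | Some (Inr i) \<Rightarrow> d2"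
  show "?d x \<noteq> 0" for x using assms by (auto split: option.splits sum.splits)
  have "casimir S b i = d1 * d2 * casimir S a i" for i
    unfolding casimir_def sum_distrib_left by (intro sum.cong refl) (simp add: b)
  then show "bmat S False b x y = ?d x * ?d y * bmat S False a x y" for x y
    by (cases x; cases y) (auto simp: poisson_entry_def b split: sum.splits)
qed

lemma casimir_remove: "i < j \<Longrightarrow> casimir (S - {i}) a j = casimir S a j"
  unfolding casimir_def by (rule sum.cong) auto

lemma casimir_bot: "(\<And>k. k \<in> S \<Longrightarrow> i \<le> k) \<Longrightarrow> casimir S a i = (\<Sum>k\<in>S. a (Inl k) * a (Inr k))"
  unfolding casimir_def by (rule sum.cong) auto

section \<open>Effect on the rank of removing the smallest index\<close>

context
  fixes S :: "('n::{finite,linorder}) set" and i :: 'n and a :: "'n gen \<Rightarrow> complex"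
  assumes iS: "i \<in> S" and bot: "\<And>k. k \<in> S \<Longrightarrow> i \<le> k"
begin

lemma above_bot: "k \<in> S \<Longrightarrow> k \<noteq> i \<Longrightarrow> i < k" using bot by force

lemma poisson_entry_remove:
  assumes "idx x \<in> S - {i}" "idx y \<in> S - {i}"
  shows "poisson_entry (S - {i}) a x y = poisson_entry S a x y"
  using assms above_bot by (auto simp: poisson_entry_def casimir_remove)

lemma mrank_bmat_drop:
  assumes "a (Inl i) = 0" "a (Inr i) = 0" "(\<Sum>k\<in>S. a (Inl k) * a (Inr k)) = 0"
  shows "mrank (bmat S \<gamma> a) = mrank (bmat (S - {i}) \<gamma> a)"
proof -
  have az: "a z = 0" if "idx z = i" for z using assms that by (cases z) auto
  have c: "casimir S a i = 0" using assms casimir_bot[OF bot] by simp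
  have "bmat S \<gamma> a x y = bmat (S - {i}) \<gamma> a x y" for x y
  proof (cases x)
    case x: (Some x')
    show ?thesis
    proof (cases y)
      case (Some y')
      have "poisson_entry S a x' y' = 0" if "idx x' = i \<or> idx y' = i"
        using that c az by (auto simp: poisson_entry_def)
      then show ?thesis using x Some poisson_entry_remove by auto
    qed (use x az in auto)
  qed (cases y; use az in auto)
  then have "bmat S \<gamma> a = bmat (S - {i}) \<gamma> a" by blast
  then show ?thesis by simp
qed

text \<open>When both coordinates of index \<open>i\<close> vanish, their rows meet only each other,
  in the entry 2Y_i, so the pivot block splits off without correction terms.\<close>

lemma mrank_bmat_nilpotent:
  assumes "a (Inl i) = 0" "a (Inr i) = 0" "(\<Sum>k\<in>S. a (Inl k) * a (Inr k)) \<noteq> 0"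
  shows "mrank (bmat S \<gamma> a) = mrank (bmat (S - {i}) \<gamma> a) + 2"
proof (rule mrank_pivot[OF skew_bmat, where s = "Some (Inl i)" and t = "Some (Inr i)"])
  have az: "a z = 0" if "idx z = i" for z using assms that by (cases z) auto
  have c: "casimir S a i \<noteq> 0" using assms casimir_bot[OF bot] by simp
  show "bmat S \<gamma> a (Some (Inl i)) (Some (Inr i)) \<noteq> 0"
    using c iS by (simp add: poisson_entry_def)
  have row: "bmat S \<gamma> a (Some z) y = 0" if "idx z = i" "y \<noteq> Some z" "y \<noteq> Some (star z)" for z y
    using that az[of z] by (cases y) (auto simp: poisson_entry_def idx_eq_cases)
  have col: "bmat S \<gamma> a y (Some z) = 0" if "idx z = i" "y \<noteq> Some z" "y \<noteq> Some (star z)" for z y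
    using row[OF that] skewD[OF skew_bmat, of S \<gamma> a y "Some z"] by simp
  show "bmat (S - {i}) \<gamma> a x y = bmat S \<gamma> a x y +
      (bmat S \<gamma> a x (Some (Inl i)) * bmat S \<gamma> a (Some (Inr i)) y
       - bmat S \<gamma> a x (Some (Inr i)) * bmat S \<gamma> a (Some (Inl i)) y)
      / bmat S \<gamma> a (Some (Inl i)) (Some (Inr i))" (is "?l = ?r") for x y
  proof -
    let ?B = "{Some (Inl i), Some (Inr i)}"
    have zl: "bmat (S - {i}) \<gamma> a x y = 0" if "x \<in> ?B \<or> y \<in> ?B"
      using that by (cases x; cases y) auto
    consider "x \<notin> ?B" "y \<notin> ?B" | "x \<in> ?B" "y \<notin> ?B" | "x \<notin> ?B" "y \<in> ?B" | "x \<in> ?B" "y \<in> ?B" by blast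
    then show ?thesis
    proof cases
      case 1
      then have "?r = bmat S \<gamma> a x y" using col[of "Inl i" x] col[of "Inr i" x] by simp
      moreover have "idx z \<noteq> i" if "Some z \<notin> ?B" for z using that by (cases z) auto
      then have "?l = bmat S \<gamma> a x y" using 1 poisson_entry_remove
        by (cases x; cases y) auto
      ultimately show ?thesis by simp
    next
      case 2
      then show ?thesis using zl row[of "Inl i" y] row[of "Inr i" y] by auto
    next
      case 3
      then show ?thesis using zl col[of "Inl i" x] col[of "Inr i" x] by auto
    next
      case 4
      then show ?thesis using zl c iS by (auto simp: poisson_entry_def)
    qed
  qed
qed

text \<open>The radical vector has coordinate \<open>a x0\<close> at \<open>star x0\<close>, which
  removes that row. The pivot (g, x0) removes two more; outside the pivot block the row of
  \<open>x0\<close> is \<open>a x0\<close> times the row of g, so the correction terms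
  cancel.\<close>

lemma mrank_bmat_graded:
  assumes x0: "idx x0 = i" "a x0 \<noteq> 0"
  shows "mrank (bmat S True a) = mrank (bmat (S - {i}) False a) + 2"
proof -
  define M where "M = (\<lambda>x y. if x = Some (star x0) \<or> y = Some (star x0) then 0 else bmat S True a x y)"
  have skM: "skew M" unfolding M_def by (rule skew_delete[OF skew_bmat])
  have "mrank M = mrank (bmat S True a)"
    by (rule mrank_delete_radical[where c = "radical_vector S a" and z = "Some (star x0)", OF skew_bmat radical_vector])
      (use x0 iS in \<open>auto simp: M_def\<close>)
  also have "mrank M = mrank (bmat (S - {i}) False a) + 2"
  proof (rule mrank_pivot[OF skM, where s = None and t = "Some x0"])
    have 1: "M None (Some x0) = - tau x0 * a x0" using x0 iS by (simp add: M_def)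
    then show "M None (Some x0) \<noteq> 0" using x0 by simp
    have 2: "M (Some x) None = tau x * a x" "M (Some x) (Some x0) = tau x * a x * a x0"
        "M None (Some x) = - tau x * a x" "M (Some x0) (Some x) = - tau x * a x0 * a x"
      if "idx x \<in> S" "idx x \<noteq> i" for x
      using that x0 iS above_bot[of "idx x"] by (auto simp: M_def poisson_entry_def)
    have 3: "M None None = 0" "M (Some x0) (Some x0) = 0" "M (Some x0) None = tau x0 * a x0"
      "M (Some (star x0)) y = 0" "M y (Some (star x0)) = 0" for y
      using x0 iS by (auto simp: M_def poisson_entry_def)
    have 4: "M (Some x) y = 0" "M y (Some x) = 0" if "idx x \<notin> S" for x y
      using that by (cases y; auto simp: M_def)+
    have "M None y = 0 \<and> M y None = 0" if "y = None" for y
      using that by (simp add: 3)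
    show "bmat (S - {i}) False a x y
      = M x y + (M x None * M (Some x0) y - M x (Some x0) * M None y) / M None (Some x0)" for x y
    proof -
      have gen: "z = x0 \<or> z = star x0 \<or> idx z \<notin> S \<or> (idx z \<in> S \<and> idx z \<noteq> i)" for z
        using x0 idx_eq_cases[of z x0] by auto
      consider "x = None" | "x = Some x0" | "x = Some (star x0)" | x' where "x = Some x'" "idx x' \<notin> S"
        | x' where "x = Some x'" "idx x' \<in> S" "idx x' \<noteq> i"
        using gen by (cases x) auto
      then show ?thesis
      proof cases
        case 1
        then show ?thesis using 3 \<open>M None (Some x0) \<noteq> 0\<close> by (cases y) (simp_all)
      next
        case 2
        then show ?thesis using 3 x0 \<open>M None (Some x0) = _\<close>
          by (cases y) (simp_all add: field_simps)
      next
        case 3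
        then show ?thesis using \<open>\<And>y. M (Some (star x0)) y = 0\<close> x0 by (cases y) simp_all
      next
        case 4
        then show ?thesis using \<open>\<And>x y. idx x \<notin> S \<Longrightarrow> M (Some x) y = 0\<close> by (cases y) simp_all
      next
        case x: (5 x')
        consider "y = None" | "y = Some x0" | "y = Some (star x0)" | y' where "y = Some y'" "idx y' \<notin> S"
          | y' where "y = Some y'" "idx y' \<in> S" "idx y' \<noteq> i"
          using gen by (cases y) auto
        then show ?thesis
        proof cases
          case 1
          then show ?thesis using x x0 by (simp add: 2 3 \<open>M None (Some x0) = _\<close>)
        next
          case y: 2
          then show ?thesis using x x0 \<open>M None (Some x0) \<noteq> 0\<close>
            by (simp add: 3)
        next
          case y: 3
          then show ?thesis using x x0 by (simp add: 3)
        next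
          case y: (4 y')
          then show ?thesis using x x0 by (simp add: \<open>\<And>x y. idx x \<notin> S \<Longrightarrow> M y (Some x) = 0\<close>)
        next
          case y: (5 y')
          have "x' \<noteq> star x0" "y' \<noteq> star x0" using x y x0 by auto
          then have "M x y = bmat (S - {i}) False a x y"
            using x y poisson_entry_remove[of x' y'] by (simp add: M_def)
          then show ?thesis using x y by (simp add: 2)
        qed
      qed
    qed
  qed
  finally show ?thesis by simp
qed

text \<open>After the deletion of \<open>star x0\<close>, the row of \<open>x0\<close> is
  \<open>a x0\<close> times a row of the kind that belongs to g, so \<open>x0\<close> can take the
  place of g.\<close>

lemma mrank_bmat_ungraded:
  assumes x0: "idx x0 = i" "a x0 \<noteq> 0" and Y: "(\<Sum>k\<in>S. a (Inl k) * a (Inr k)) = 0"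
  shows "mrank (bmat S False a) = mrank (bmat (S - {i}) True a)"
proof -
  define M where "M = (\<lambda>x y. if x = Some (star x0) \<or> y = Some (star x0) then 0 else bmat S False a x y)"
  have M1: "mrank M = mrank (bmat S False a)"
    by (rule mrank_delete_radical[where c = "radical_vector S a" and z = "Some (star x0)", OF skew_bmat radical_vector])
      (use x0 iS Y in \<open>auto simp: M_def\<close>)
  \<comment> \<open>\<open>K\<close> contains both \<open>x0\<close> and g, with the entry between
    them set to 0 so that their rows become proportional. Deleting g gives \<open>M\<close>,
    deleting \<open>x0\<close> gives the matrix of the smaller index set with g.\<close>
  define K where "K = (\<lambda>x y. if x = Some (star x0) \<or> y = Some (star x0) \<or> x = None \<and> y = Some x0
    \<or> y = None \<and> x = Some x0 then 0 else bmat S True a x y)"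
  have "K y x = - K x y" for x y using skewD[OF skew_bmat, of S True a y x] by (auto simp: K_def)
  then have skK: "skew K" unfolding skew_def by blast
  define c where "c = (\<lambda>x. if x = None then - a x0 else if x = Some x0 then 1 else (0::complex))"
  have rad: "(\<Sum>x\<in>UNIV. c x * K x y) = 0" for y
  proof -
    have "(\<Sum>x\<in>UNIV. c x * K x y) = - a x0 * K None y + K (Some x0) y"
      by (simp add: sum_option_UNIV c_def if_distrib[where f = "\<lambda>t. t * _"] cong: if_cong)
    also have "\<dots> = 0"
    proof (cases y)
      case (Some y')
      then show ?thesis
        using x0 iS above_bot[of "idx y'"] idx_eq_cases[of y' x0]
        by (auto simp: K_def poisson_entry_def)
    qed (simp add: K_def)
    finally show ?thesis .
  qed
  have "mrank M = mrank K"
  proof (rule mrank_delete_radical[OF skK rad, where z = None])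
    show "M x y = (if x = None \<or> y = None then 0 else K x y)" for x y
      by (cases x; cases y) (auto simp: M_def K_def)
  qed (use x0 in \<open>simp add: c_def\<close>)
  moreover have "mrank (bmat (S - {i}) True a) = mrank K"
  proof (rule mrank_delete_radical[OF skK rad, where z = "Some x0"])
    have "idx z = i \<longleftrightarrow> z = x0 \<or> z = star x0" for z using x0 idx_eq_cases[of z x0] by auto
    then show "bmat (S - {i}) True a x y = (if x = Some x0 \<or> y = Some x0 then 0 else K x y)" for x y
      using poisson_entry_remove by (cases x; cases y) (auto simp: K_def)
  qed (simp add: c_def)
  ultimately show ?thesis using M1 by simp
qed

end

section \<open>Irreducible families of operators\<close>

locale complex_space = vector_space smul
  for smul :: "complex \<Rightarrow> 'v::ab_group_add \<Rightarrow> 'v" (infixr \<open>\<odot>\<close> 75)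
begin

definition lin :: "('v \<Rightarrow> 'v) \<Rightarrow> bool" where
  "lin T \<longleftrightarrow> (\<forall>u v. T (u + v) = T u + T v) \<and> (\<forall>c v. T (c \<odot> v) = c \<odot> T v)"

lemma lin_add: "lin T \<Longrightarrow> T (u + v) = T u + T v"
  and lin_scale: "lin T \<Longrightarrow> T (c \<odot> v) = c \<odot> T v"
  by (auto simp: lin_def)

lemma lin_0: "lin T \<Longrightarrow> T 0 = 0"
  using lin_scale[of T 0 0] by simp

lemma lin_minus: "lin T \<Longrightarrow> T (- v) = - T v"
  using lin_scale[of T "-1" v] by simp

lemma lin_diff: "lin T \<Longrightarrow> T (u - v) = T u - T v"
  using lin_add[of T u "- v"] lin_minus[of T v] by simp

lemma lin_sum: "lin T \<Longrightarrow> T (\<Sum>i\<in>I. f i) = (\<Sum>i\<in>I. T (f i))"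
  by (induction I rule: infinite_finite_induct) (auto simp: lin_0 lin_add)

lemma lin_comp: "lin A \<Longrightarrow> lin B \<Longrightarrow> lin (\<lambda>v. A (B v))"
  by (simp add: lin_def)

lemma lin_funpow: "lin A \<Longrightarrow> lin (A ^^ n)"
  by (induction n) (auto simp: lin_def)

lemma lin_sum_ops: "(\<And>i. i \<in> I \<Longrightarrow> lin (f i)) \<Longrightarrow> lin (\<lambda>v. \<Sum>i\<in>I. f i v)"
  by (simp add: lin_def sum.distrib scale_sum_right)

lemma subspace_unscale: "subspace U \<Longrightarrow> c \<noteq> 0 \<Longrightarrow> c \<odot> v \<in> U \<Longrightarrow> v \<in> U"
  using subspace_scale[of U "c \<odot> v" "inverse c"] by simp

definition preserves :: "'v set \<Rightarrow> ('v \<Rightarrow> 'v) \<Rightarrow> bool" where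
  "preserves W A \<longleftrightarrow> (\<forall>v\<in>W. A v \<in> W)"

lemma preservesD: "preserves W A \<Longrightarrow> v \<in> W \<Longrightarrow> A v \<in> W"
  by (simp add: preserves_def)

lemma preserves_funpow: "preserves W A \<Longrightarrow> preserves W (A ^^ n)"
  by (induction n) (auto simp: preserves_def)

lemma preserves_comp: "preserves W A \<Longrightarrow> preserves W B \<Longrightarrow> preserves W (\<lambda>v. A (B v))"
  by (simp add: preserves_def)

lemma preserves_sum:
  "subspace W \<Longrightarrow> (\<And>i. i \<in> I \<Longrightarrow> preserves W (f i)) \<Longrightarrow> preserves W (\<lambda>v. \<Sum>i\<in>I. f i v)"
  by (auto simp: preserves_def intro: subspace_sum)

definition qcomm :: "'v set \<Rightarrow> complex \<Rightarrow> ('v \<Rightarrow> 'v) \<Rightarrow> ('v \<Rightarrow> 'v) \<Rightarrow> bool" where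
  "qcomm W c A B \<longleftrightarrow> (\<forall>v\<in>W. A (B v) = c \<odot> B (A v))"

lemma qcommD: "qcomm W c A B \<Longrightarrow> v \<in> W \<Longrightarrow> A (B v) = c \<odot> B (A v)"
  by (simp add: qcomm_def)

lemma qcomm_refl: "qcomm W 1 A A"
  by (simp add: qcomm_def)

lemma qcomm_subset: "qcomm W c A B \<Longrightarrow> W' \<subseteq> W \<Longrightarrow> qcomm W' c A B"
  by (auto simp: qcomm_def)

lemma qcomm_sym: "qcomm W c A B \<Longrightarrow> c \<noteq> 0 \<Longrightarrow> qcomm W (inverse c) B A"
  by (simp add: qcomm_def)

lemma qcomm_comp_right:
  assumes "qcomm W c A B" "qcomm W d A C" "lin B" "preserves W C"
  shows "qcomm W (c * d) A (\<lambda>v. B (C v))"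
  using assms by (simp add: qcomm_def preserves_def lin_scale)

lemma qcomm_comp_left:
  assumes "qcomm W c A C" "qcomm W d B C" "lin A" "preserves W B"
  shows "qcomm W (c * d) (\<lambda>v. A (B v)) C"
  using assms by (simp add: qcomm_def preserves_def lin_scale mult.commute)

lemma qcomm_pow_right:
  assumes "qcomm W c A B" "lin B" "preserves W B"
  shows "qcomm W (c ^ n) A (B ^^ n)"
proof (induction n)
  case 0
  then show ?case by (simp add: qcomm_def)
next
  case (Suc n)
  show ?case
    using qcomm_comp_right[OF assms(1) Suc assms(2) preserves_funpow[OF assms(3)]] by (simp add: comp_def)
qed

lemma qcomm_pow_left:
  assumes "qcomm W c A B" "lin A" "preserves W A"
  shows "qcomm W (c ^ n) (A ^^ n) B"
proof (induction n)
  case 0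
  then show ?case by (simp add: qcomm_def)
next
  case (Suc n)
  show ?case
    using qcomm_comp_left[OF assms(1) Suc assms(2) preserves_funpow[OF assms(3)]] by (simp add: comp_def)
qed

lemma qcomm_sum_right:
  assumes "\<And>k. k \<in> I \<Longrightarrow> qcomm W c A (B k)" "lin A"
  shows "qcomm W c A (\<lambda>v. \<Sum>k\<in>I. B k v)"
  using assms by (auto simp: qcomm_def lin_sum scale_sum_right intro!: sum.cong)

text \<open>One factor \<open>c\<close> arises for each of the n(n-1)/2 pairs in which some
  \<open>B\<close> stands to the left of some \<open>A\<close>.\<close>

lemma qcomm_comp_pow:
  assumes c: "qcomm W c B A" and "lin A" "lin B" "preserves W A" "preserves W B" and v: "v \<in> W"
  shows "((\<lambda>v. A (B v)) ^^ n) v = (c ^ (n * (n - 1) div 2)) \<odot> (A ^^ n) ((B ^^ n) v)"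
proof (induction n)
  case (Suc n)
  have Bv: "(B ^^ n) v \<in> W" using preserves_funpow[OF assms(5)] v by (simp add: preserves_def)
  have "((\<lambda>v. A (B v)) ^^ Suc n) v = A (B (c ^ (n * (n - 1) div 2) \<odot> (A ^^ n) ((B ^^ n) v)))"
    by (simp add: Suc)
  also have "\<dots> = c ^ (n * (n - 1) div 2) \<odot> A (c ^ n \<odot> (A ^^ n) (B ((B ^^ n) v)))"
    using qcommD[OF qcomm_pow_right[OF c assms(2,4), of n] Bv] assms by (simp add: lin_scale)
  also have "\<dots> = c ^ (n * (n - 1) div 2 + n) \<odot> (A ^^ Suc n) ((B ^^ Suc n) v)"
    using assms by (simp add: lin_scale power_add)
  also have "n * (n - 1) div 2 + n = Suc n * (Suc n - 1) div 2"
    by (cases n) auto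
  finally show ?case .
qed simp

text \<open>Modules are subspaces \<open>W\<close> of one fixed type, so the recursion can pass to
  smaller modules without a change of type. Operators are linear everywhere but need to satisfy
  relations only on \<open>W\<close>.\<close>

definition irr :: "'v set \<Rightarrow> ('v \<Rightarrow> 'v) set \<Rightarrow> bool" where
  "irr W Ops \<longleftrightarrow> subspace W \<and> (\<exists>v\<in>W. v \<noteq> 0) \<and> (\<forall>A\<in>Ops. lin A \<and> preserves W A)
     \<and> (\<forall>U. subspace U \<and> U \<subseteq> W \<and> (\<forall>A\<in>Ops. preserves U A) \<longrightarrow> U = {0} \<or> U = W)"

lemma irrD:
  assumes "irr W Ops"
  shows "subspace W" "\<exists>v\<in>W. v \<noteq> 0" "A \<in> Ops \<Longrightarrow> lin A" "A \<in> Ops \<Longrightarrow> preserves W A"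
    "subspace U \<Longrightarrow> U \<subseteq> W \<Longrightarrow> (\<And>A. A \<in> Ops \<Longrightarrow> preserves U A) \<Longrightarrow> U = {0} \<or> U = W"
  using assms by (auto simp: irr_def)

lemma irr_full:
  assumes "irr W Ops" "subspace U" "U \<subseteq> W" "\<And>A. A \<in> Ops \<Longrightarrow> preserves U A" "u \<in> U" "u \<noteq> 0"
  shows "U = W"
  using irrD(5)[OF assms(1-4)] assms(5,6) by auto

lemma irr_change_ops:
  assumes "irr W Ops" "\<And>A. A \<in> Ops' \<Longrightarrow> lin A" "\<And>A. A \<in> Ops' \<Longrightarrow> preserves W A"
    and "\<And>U A. subspace U \<Longrightarrow> U \<subseteq> W \<Longrightarrow> (\<And>A. A \<in> Ops' \<Longrightarrow> preserves U A) \<Longrightarrow> A \<in> Ops \<Longrightarrow> preserves U A"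
  shows "irr W Ops'"
  using assms irrD[OF assms(1)] unfolding irr_def by metis

text \<open>\<open>W\<close> may be infinite-dimensional; the polynomial X^m - c, which annihilates
  \<open>T\<close> on \<open>W\<close>, takes the place of a characteristic polynomial.\<close>

lemma exists_eigenvector:
  assumes "lin T" "preserves W T" "subspace W" and ex: "v \<in> W" "v \<noteq> 0"
    and pow: "\<And>v. v \<in> W \<Longrightarrow> (T ^^ m) v = c \<odot> v" and m: "m > 0"
  obtains \<mu> u where "\<mu> ^ m = c" "u \<in> W" "u \<noteq> 0" "T u = \<mu> \<odot> u"
proof -
  define pe :: "complex poly \<Rightarrow> 'v \<Rightarrow> 'v" where "pe = (\<lambda>p v. \<Sum>i\<le>degree p. coeff p i \<odot> (T ^^ i) v)"
  have "\<exists>\<mu> u. u \<in> W \<and> u \<noteq> 0 \<and> T u = \<mu> \<odot> u"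
  proof -
    text \<open>\<open>X\<^sup>n - c\<close> splits into linear factors; some factor fails to be injective.\<close>
    have key: "\<exists>\<mu> u. u \<in> W \<and> u \<noteq> 0 \<and> T u = \<mu> \<odot> u"
      if "p \<noteq> 0" "u0 \<in> W" "u0 \<noteq> 0" "(\<Sum>i\<le>n. coeff p i \<odot> (T ^^ i) u0) = 0" "degree p \<le> n" for p :: "complex poly" and u0 n
      using that
    proof (induction n arbitrary: p u0)
      case 0
      then have "coeff p 0 \<noteq> 0" using leading_coeff_neq_0 by fastforce
      then show ?case using 0 by simp
    next
      case (Suc n)
      show ?case
      proof (cases "degree p \<le> n")
        case True
        then have "coeff p (Suc n) = 0" by (simp add: coeff_eq_0)
        then show ?thesis using Suc True by simp
      next
        case False
        then have "\<not> constant (poly p)" by (simp add: constant_degree)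
        then obtain \<mu> where "poly p \<mu> = 0" using fundamental_theorem_of_algebra by blast
        then obtain r where r: "p = [:-\<mu>, 1:] * r" by (auto simp: poly_eq_0_iff_dvd dvd_def)
        have "degree p = degree [:-\<mu>, 1:] + degree r" if "r \<noteq> 0"
          unfolding r using that by (intro degree_mult_eq) auto
        then have dr: "degree r \<le> n" using Suc.prems(5) by (cases "r = 0") auto
        \<comment> \<open>Either \<open>u0\<close> is already an eigenvector, or \<open>u1\<close>
          is nonzero and annihilated by the quotient \<open>r\<close>, which has smaller
          degree.\<close>
        define u1 where "u1 = T u0 - \<mu> \<odot> u0"
        have "coeff p i = - \<mu> * coeff r i + (if i = 0 then 0 else coeff r (i - 1))" for i
          by (cases i) (simp_all add: r)
        then have "(\<Sum>i\<le>Suc n. coeff p i \<odot> (T ^^ i) u0)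
            = (\<Sum>i\<le>Suc n. (- \<mu> * coeff r i) \<odot> (T ^^ i) u0)
              + (\<Sum>i\<le>Suc n. (if i = 0 then 0 else coeff r (i - 1)) \<odot> (T ^^ i) u0)"
          by (simp only: scale_left_distrib sum.distrib)
        also have "(\<Sum>i\<le>Suc n. (- \<mu> * coeff r i) \<odot> (T ^^ i) u0) = (\<Sum>i\<le>n. (- \<mu> * coeff r i) \<odot> (T ^^ i) u0)"
          using dr by (simp add: coeff_eq_0)
        also have "(\<Sum>i\<le>Suc n. (if i = 0 then 0 else coeff r (i - 1)) \<odot> (T ^^ i) u0)
            = (\<Sum>i\<le>n. coeff r i \<odot> (T ^^ Suc i) u0)"
          by (subst sum.atMost_Suc_shift) (simp del: funpow.simps)
        also have "(\<Sum>i\<le>n. (- \<mu> * coeff r i) \<odot> (T ^^ i) u0) + (\<Sum>i\<le>n. coeff r i \<odot> (T ^^ Suc i) u0)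
            = (\<Sum>i\<le>n. coeff r i \<odot> (T ^^ i) u1)"
          unfolding u1_def lin_diff[OF lin_funpow[OF assms(1)]] lin_scale[OF lin_funpow[OF assms(1)]]
          by (simp add: sum.distrib[symmetric] scale_right_diff_distrib funpow_swap1 mult.commute)
        finally have *: "(\<Sum>i\<le>n. coeff r i \<odot> (T ^^ i) u1) = 0" using Suc.prems by simp
        show ?thesis
        proof (cases "u1 = 0")
          case True
          then show ?thesis using Suc.prems by (auto simp: u1_def)
        next
          case False
          moreover have "u1 \<in> W" unfolding u1_def
            by (intro subspace_diff subspace_scale preservesD[OF assms(2)] assms(3) Suc.prems(2))
          moreover have "r \<noteq> 0" using r Suc.prems by auto
          ultimately show ?thesis using Suc.IH[OF _ _ _ * dr] by blast
        qed
      qed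
    qed
    define p where "p = monom 1 m - [:c:]"
    have "coeff p m = 1" using m by (simp add: p_def coeff_pCons split: nat.splits)
    then have p: "p \<noteq> 0" by auto
    have "degree p \<le> m"
      unfolding p_def by (rule degree_diff_le) (auto simp: degree_monom_le)
    moreover have "coeff p i = (if i = m then 1 else 0) + (if i = 0 then - c else 0)" for i
      using m by (simp add: p_def coeff_pCons split: nat.splits)
    then have "(\<Sum>i\<le>m. coeff p i \<odot> (T ^^ i) v) = (T ^^ m) v - c \<odot> v"
      by (simp add: scale_left_distrib sum.distrib if_distrib[where f = "\<lambda>t. t \<odot> _"] cong: if_cong)
    ultimately show ?thesis using key[OF p ex] pow[OF ex(1)] by simp
  qed
  then obtain \<mu> u where u: "u \<in> W" "u \<noteq> 0" "T u = \<mu> \<odot> u" by blast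
  have "(T ^^ n) u = \<mu> ^ n \<odot> u" for n
    by (induction n) (auto simp: u lin_scale[OF assms(1)] mult.commute)
  then have "\<mu> ^ m = c" using pow[OF u(1)] u(2) by simp
  then show ?thesis using that u by blast
qed

text \<open>Schur's lemma: the eigenspace of \<open>T\<close> is a submodule. For the eigenvalue 0
  the eigenspace is the kernel, and commuting up to a factor is enough.\<close>

lemma normal_operator_scalar:
  assumes irr: "irr W Ops" and T: "lin T" "preserves W T"
    and comm: "\<And>A. A \<in> Ops \<Longrightarrow> \<exists>d. qcomm W d T A \<and> (\<mu> = 0 \<or> d = 1)"
    and u: "u \<in> W" "u \<noteq> 0" "T u = \<mu> \<odot> u" and v: "v \<in> W"
  shows "T v = \<mu> \<odot> v"
proof -
  let ?U = "{v \<in> W. T v = \<mu> \<odot> v}"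
  have "?U = W"
  proof (rule irr_full[OF irr])
    show "subspace ?U"
      using irrD(1)[OF irr] T(1)
      by (auto simp: subspace_def lin_0 lin_add lin_scale scale_right_distrib mult.commute)
    fix A assume A: "A \<in> Ops"
    then obtain d where d: "qcomm W d T A" "\<mu> = 0 \<or> d = 1" using comm by blast
    show "preserves ?U A"
      unfolding preserves_def
      using irrD(3,4)[OF irr A] d
      by (auto simp: preserves_def qcomm_def lin_scale lin_0)
  qed (use u in auto)
  then show ?thesis using v by blast
qed

lemma normal_nilpotent_zero:
  assumes irr: "irr W Ops" and T: "lin T" "preserves W T"
    and comm: "\<And>A. A \<in> Ops \<Longrightarrow> \<exists>d. qcomm W d T A"
    and pow: "\<And>v. v \<in> W \<Longrightarrow> (T ^^ m) v = 0" and m: "m > 0" and v: "v \<in> W"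
  shows "T v = 0"
proof -
  obtain v0 where "v0 \<in> W" "v0 \<noteq> 0" using irrD(2)[OF irr] by blast
  then obtain \<mu> u where "\<mu> ^ m = 0" "u \<in> W" "u \<noteq> 0" "T u = \<mu> \<odot> u"
    using exists_eigenvector[OF T irrD(1)[OF irr], of v0 m 0] pow m by auto
  then have \<mu>: "\<mu> = 0" "u \<in> W" "u \<noteq> 0" "T u = \<mu> \<odot> u" by auto
  then have "T v = \<mu> \<odot> v"
    using normal_operator_scalar[OF irr T _ \<mu>(2-4) v] comm by blast
  then show ?thesis using \<mu> by simp
qed

lemma eigenvectors_independent:
  assumes "finite I" "lin g" "inj_on l I" "\<And>s. s \<in> I \<Longrightarrow> g (v s) = l s \<odot> v s" "(\<Sum>s\<in>I. v s) = 0" "s \<in> I"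
  shows "v s = 0"
  using assms
proof (induction I arbitrary: v s)
  case (insert j I)
  define v' where "v' = (\<lambda>s. (l s - l j) \<odot> v s)"
  have "(\<Sum>s\<in>I. v' s) = (\<Sum>s\<in>I. l s \<odot> v s) - l j \<odot> (\<Sum>s\<in>I. v s)"
    by (simp add: v'_def scale_left_diff_distrib sum_subtractf scale_sum_right)
  also have "(\<Sum>s\<in>I. l s \<odot> v s) = g (\<Sum>s\<in>I. v s)"
    using insert.prems by (simp add: lin_sum)
  also have "(\<Sum>s\<in>I. v s) = - v j"
    using insert by (simp add: eq_neg_iff_add_eq_0 add.commute)
  also have "g (- v j) - l j \<odot> - v j = 0"
    using insert.prems by (simp add: lin_minus)
  finally have "v' s = 0" if "s \<in> I" for s
    using insert.IH[of v' s] insert.prems that by (auto simp: v'_def lin_scale mult.commute)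
  then have z: "v s = 0" if "s \<in> I" for s
  proof -
    have "l s \<noteq> l j" using insert.prems(2) insert.hyps(2) that by (metis inj_onD insertCI)
    then show ?thesis using \<open>s \<in> I \<Longrightarrow> v' s = 0\<close>[OF that] by (simp add: v'_def)
  qed
  then have "v j = 0" using insert.prems(4) insert.hyps by simp
  then show ?case using z insert.prems(5) by blast
qed simp

text \<open>Stronger than \<open>dim W = n\<close>, because it asserts finite dimension and that
  \<open>W\<close> is a subspace.\<close>

definition has_basis_card :: "'v set \<Rightarrow> nat \<Rightarrow> bool" where
  "has_basis_card W n \<longleftrightarrow> (\<exists>B. finite B \<and> independent B \<and> span B = W \<and> card B = n)"

lemma has_basis_card_dim: "has_basis_card W n \<Longrightarrow> dim W = n"
  unfolding has_basis_card_def using dim_span_eq_card_independent by metis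

lemma independent_family:
  assumes fin: "finite I" and ind: "\<And>c. (\<Sum>i\<in>I. c i \<odot> F i) = 0 \<Longrightarrow> \<forall>i\<in>I. c i = 0"
  shows "inj_on F I" "independent (F ` I)"
proof -
  show inj: "inj_on F I"
  proof (rule inj_onI, rule ccontr)
    fix i j assume ij: "i \<in> I" "j \<in> I" "F i = F j" "i \<noteq> j"
    define c where "c = (\<lambda>k. (if k = i then 1 else 0) - (if k = j then 1 else (0::complex)))"
    have "(\<Sum>k\<in>I. c k \<odot> F k) = F i - F j"
      using ij fin by (simp add: c_def scale_left_diff_distrib sum_subtractf
        if_distrib[where f = "\<lambda>t. t \<odot> _"] cong: if_cong)
    then have "c i = 0" using ind ij by auto
    then show False using ij by (simp add: c_def)
  qed
  show "independent (F ` I)"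
  proof (rule independent_if_scalars_zero)
    fix f x assume *: "(\<Sum>x\<in>F ` I. f x \<odot> x) = 0" and x: "x \<in> F ` I"
    have "(\<Sum>i\<in>I. f (F i) \<odot> F i) = 0" using * by (simp add: sum.reindex[OF inj])
    then show "f x = 0" using ind[of "\<lambda>i. f (F i)"] x by auto
  qed (use fin in simp)
qed

lemma shift_basis:
  assumes w: "lin w" and W0: "has_basis_card W0 n" and sub: "subspace W"
    and incl: "\<And>s u. u \<in> W0 \<Longrightarrow> (w ^^ s) u \<in> W"
    and spanning: "\<And>v. v \<in> W \<Longrightarrow> \<exists>u. (\<forall>s<m. u s \<in> W0) \<and> v = (\<Sum>s<m. (w ^^ s) (u s))"
    and direct: "\<And>u s. (\<forall>s<m. u s \<in> W0) \<Longrightarrow> (\<Sum>s<m. (w ^^ s) (u s)) = 0 \<Longrightarrow> s < m \<Longrightarrow> u s = 0"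
  shows "has_basis_card W (m * n)"
proof -
  obtain B where B: "finite B" "independent B" "span B = W0" "card B = n"
    using W0 by (auto simp: has_basis_card_def)
  let ?F = "\<lambda>(s, b). (w ^^ s) b"
  let ?I = "{..<m} \<times> B"
  have fin: "finite ?I" using B by simp
  have sum_I: "(\<Sum>i\<in>?I. c i \<odot> ?F i) = (\<Sum>s<m. (w ^^ s) (\<Sum>b\<in>B. c (s, b) \<odot> b))" for c
    unfolding lin_sum[OF lin_funpow[OF w]] lin_scale[OF lin_funpow[OF w]] sum.cartesian_product
    by (intro sum.cong refl) auto
  have ind: "\<forall>i\<in>?I. c i = 0" if "(\<Sum>i\<in>?I. c i \<odot> ?F i) = 0" for c
  proof safe
    fix s b assume s: "s < m" and b: "b \<in> B"
    have "\<forall>s<m. (\<Sum>b\<in>B. c (s, b) \<odot> b) \<in> W0"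
      unfolding B(3)[symmetric] by (intro allI impI span_sum span_scale span_base)
    then have "(\<Sum>b\<in>B. c (s, b) \<odot> b) = 0"
      using direct[of "\<lambda>s. \<Sum>b\<in>B. c (s, b) \<odot> b"] that s unfolding sum_I by blast
    then show "c (s, b) = 0" using independentD[OF B(2) B(1) subset_refl, of "\<lambda>b. c (s, b)"] b by blast
  qed
  note fam = independent_family[OF fin ind]
  have "span (?F ` ?I) = W"
  proof (rule span_subspace[OF _ _ sub])
    have "B \<subseteq> W0" using B(3) span_superset by blast
    then show "?F ` ?I \<subseteq> W" using incl by auto
    show "W \<subseteq> span (?F ` ?I)"
    proof
      fix v assume "v \<in> W"
      then obtain u where u: "\<forall>s<m. u s \<in> W0" "v = (\<Sum>s<m. (w ^^ s) (u s))" using spanning by blast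
      have "\<exists>r. u s = (\<Sum>b\<in>B. r b \<odot> b)" if "s < m" for s
        using u(1) that unfolding B(3)[symmetric] span_finite[OF B(1)] by auto
      then obtain r where r: "\<And>s. s < m \<Longrightarrow> u s = (\<Sum>b\<in>B. r s b \<odot> b)" by metis
      have "v = (\<Sum>i\<in>?I. r (fst i) (snd i) \<odot> ?F i)"
        unfolding u(2) sum_I by (intro sum.cong refl) (simp add: r)
      also have "\<dots> \<in> span (?F ` ?I)" by (intro span_sum span_scale span_base) auto
      finally show "v \<in> span (?F ` ?I)" .
    qed
  qed
  moreover have "card (?F ` ?I) = m * n"
    using card_image[OF fam(1)] B by (simp add: card_cartesian_product)
  ultimately show ?thesis unfolding has_basis_card_def using fam(2) fin by blast
qed

definition shifts :: "nat \<Rightarrow> ('v \<Rightarrow> 'v) \<Rightarrow> 'v set \<Rightarrow> 'v set" where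
  "shifts m w U = {v. \<exists>u. (\<forall>s<m. u s \<in> U) \<and> v = (\<Sum>s<m. (w ^^ s) (u s))}"

lemma shifts_base:
  assumes "lin w" "subspace U" "s < m" "u \<in> U"
  shows "(w ^^ s) u \<in> shifts m w U"
proof -
  have "(w ^^ s) u = (\<Sum>t<m. (w ^^ t) (if t = s then u else 0))"
    using assms lin_0[OF lin_funpow[OF assms(1)]] by (simp add: if_distrib cong: if_cong)
  then show ?thesis
    unfolding shifts_def using assms subspace_0
    by (intro CollectI exI[of _ "\<lambda>t. if t = s then u else 0"]) auto
qed

lemma subspace_shifts:
  assumes "lin w" "subspace U"
  shows "subspace (shifts m w U)"
  unfolding subspace_def
proof (intro conjI ballI allI)
  note lw = lin_funpow[OF assms(1)]
  show "0 \<in> shifts m w U" unfolding shifts_def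
    using assms subspace_0 lin_0[OF lw] by (intro CollectI exI[of _ "\<lambda>_. 0"]) simp
  fix x assume "x \<in> shifts m w U"
  then obtain u where u: "\<forall>s<m. u s \<in> U" "x = (\<Sum>s<m. (w ^^ s) (u s))" by (auto simp: shifts_def)
  show "c \<odot> x \<in> shifts m w U" for c unfolding shifts_def
    using u assms(2) by (intro CollectI exI[of _ "\<lambda>s. c \<odot> u s"])
      (auto simp: lin_scale[OF lw] scale_sum_right subspace_scale)
  fix y assume "y \<in> shifts m w U"
  then obtain u' where u': "\<forall>s<m. u' s \<in> U" "y = (\<Sum>s<m. (w ^^ s) (u' s))" by (auto simp: shifts_def)
  show "x + y \<in> shifts m w U" unfolding shifts_def
    using u u' assms(2) by (intro CollectI exI[of _ "\<lambda>s. u s + u' s"])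
      (auto simp: lin_add[OF lw] sum.distrib subspace_add)
qed

text \<open>
  \<open>W\<close> is induced from its subspace \<open>W0\<close>: it is the direct sum of the translates of \<open>W0\<close> under the
  powers of \<open>w\<close>.
\<close>

lemma irr_induced:
  assumes irr: "irr W Ops" and w: "lin w" "preserves W w"
    and W0: "subspace W0" "W0 \<subseteq> W" "x0 \<in> W0" "x0 \<noteq> 0" and m: "m > 0"
    and Ops0: "\<And>A. A \<in> Ops0 \<Longrightarrow> lin A" "\<And>A. A \<in> Ops0 \<Longrightarrow> preserves W0 A"
    and direct: "\<And>u s. (\<forall>s<m. u s \<in> W0) \<Longrightarrow> (\<Sum>s<m. (w ^^ s) (u s)) = 0 \<Longrightarrow> s < m \<Longrightarrow> u s = 0"
    and stable: "\<And>U A s u. subspace U \<Longrightarrow> U \<subseteq> W0 \<Longrightarrow> (\<And>A. A \<in> Ops0 \<Longrightarrow> preserves U A) \<Longrightarrow>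
      A \<in> Ops \<Longrightarrow> s < m \<Longrightarrow> u \<in> U \<Longrightarrow> A ((w ^^ s) u) \<in> shifts m w U"
  shows "irr W0 Ops0 \<and> (\<forall>n. has_basis_card W0 n \<longrightarrow> has_basis_card W (m * n))"
proof (intro conjI allI impI)
  have incl: "(w ^^ s) u \<in> W" if "u \<in> W0" for s u
    using preserves_funpow[OF w(2)] W0(2) that by (auto simp: preserves_def)
  \<comment> \<open>By \<open>stable\<close> the translates of a nonzero \<open>Ops0\<close>-stable
    \<open>U\<close> add up to an \<open>Ops\<close>-stable subspace, which is all of
    \<open>W\<close>. Directness then forces \<open>U = W0\<close>.\<close>
  have full: "shifts m w U = W"
    if U: "subspace U" "U \<subseteq> W0" "\<And>A. A \<in> Ops0 \<Longrightarrow> preserves U A" "u0 \<in> U" "u0 \<noteq> 0" for U u0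
  proof (rule irr_full[OF irr subspace_shifts[OF w(1) U(1)]])
    show "shifts m w U \<subseteq> W"
      using incl U(2) by (auto simp: shifts_def intro!: subspace_sum[OF irrD(1)[OF irr]])
    show "preserves (shifts m w U) A" if "A \<in> Ops" for A
      unfolding preserves_def
    proof
      fix v assume "v \<in> shifts m w U"
      then obtain u where u: "\<forall>s<m. u s \<in> U" "v = (\<Sum>s<m. (w ^^ s) (u s))" by (auto simp: shifts_def)
      then show "A v \<in> shifts m w U"
        using stable[OF U(1-3) that] by (auto simp: lin_sum[OF irrD(3)[OF irr that]]
          intro!: subspace_sum[OF subspace_shifts[OF w(1) U(1)]])
    qed
    show "u0 \<in> shifts m w U" using shifts_base[OF w(1) U(1) m U(4)] by simp
  qed fact
  show "irr W0 Ops0"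
    unfolding irr_def
  proof (intro conjI allI impI ballI)
    fix U assume U: "subspace U \<and> U \<subseteq> W0 \<and> (\<forall>A\<in>Ops0. preserves U A)"
    show "U = {0} \<or> U = W0"
    proof (cases "\<exists>u0\<in>U. u0 \<noteq> 0")
      case True
      then have sW: "shifts m w U = W" using full[of U] U by blast
      have "W0 \<subseteq> U"
      proof
        fix x assume x: "x \<in> W0"
        then obtain u where u: "\<forall>s<m. u s \<in> U" "x = (\<Sum>s<m. (w ^^ s) (u s))"
          using W0(2) sW by (auto simp: shifts_def)
        \<comment> \<open>The difference of two decompositions of \<open>x\<close>: the one with
          components in \<open>U\<close> and the one whose only component is \<open>x\<close> itself
          in degree 0.\<close>
        define u' where "u' = (\<lambda>s. u s - (if s = 0 then x else 0))"
        have "(w ^^ s) (u' s) = (w ^^ s) (u s) - (if s = 0 then x else 0)" for s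
          by (simp add: u'_def lin_diff[OF lin_funpow[OF w(1)]] lin_0[OF lin_funpow[OF w(1)]])
        then have "(\<Sum>s<m. (w ^^ s) (u' s)) = 0"
          using m by (simp add: sum_subtractf u(2)[symmetric])
        moreover have "\<forall>s<m. u' s \<in> W0"
          using u U x W0(1) by (auto simp: u'_def intro!: subspace_diff subspace_0)
        ultimately have "u' 0 = 0" using direct m by blast
        then have "x = u 0" by (simp add: u'_def)
        then show "x \<in> U" using u(1) m by auto
      qed
      then show ?thesis using U by blast
    next
      case False
      then have "U = {0}" using U subspace_0[of U] by auto
      then show ?thesis by blast
    qed
  qed (use W0 Ops0 in auto)
  show "has_basis_card W (m * n)" if n: "has_basis_card W0 n" for n
  proof (rule shift_basis[OF w(1) n irrD(1)[OF irr] incl])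
    show "\<exists>u. (\<forall>s<m. u s \<in> W0) \<and> v = (\<Sum>s<m. (w ^^ s) (u s))" if "v \<in> W" for v
      using full[OF W0(1) subset_refl Ops0(2) W0(3,4)] that by (auto simp: shifts_def)
    show "u s = 0" if "\<forall>s<m. u s \<in> W0" "(\<Sum>s<m. (w ^^ s) (u s)) = 0" "s < m" for u s
      by (rule direct[OF that])
  qed
qed

end

section \<open>Irreducible modules of \<open>B\<^sub>\<epsilon>(N)\<close>\<close>

definition yop :: "('n::{finite,linorder}) set \<Rightarrow> ('n gen \<Rightarrow> 'v::ab_group_add \<Rightarrow> 'v) \<Rightarrow> 'n \<Rightarrow> 'v \<Rightarrow> 'v" where
  "yop S w i v = (\<Sum>k | k \<in> S \<and> i \<le> k. w (Inl k) (w (Inr k) v))"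

text \<open>
  The relations of \<open>B\<^sub>q(N)\<close> on a subspace \<open>W\<close>, with only the indices in \<open>S\<close> present. \<open>R1\<close> combines the
  first three of them; \<open>R2\<close> is the fourth one, rewritten as \<open>[z\<^sub>i, z\<^sub>i\<^sup>*] = (1 - q\<^sup>-\<^sup>2) y\<^sub>i\<close>.
\<close>

locale B_system = complex_space smul
  for smul :: "complex \<Rightarrow> 'v::ab_group_add \<Rightarrow> 'v" (infixr \<open>\<odot>\<close> 75) +
  fixes q :: complex and m :: nat and S :: "('n::{finite,linorder}) set" and W :: "'v set"
    and w :: "'n gen \<Rightarrow> 'v \<Rightarrow> 'v" and Gs :: "('v \<Rightarrow> 'v) set" and a :: "'n gen \<Rightarrow> complex"
  assumes odd_m: "odd m" and prim: "primitive_root_of_unity m q"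
    and lin_w: "\<And>x. lin (w x)"
    and irrW: "irr W (w ` {x. idx x \<in> S} \<union> Gs)"
    and R1: "\<And>x y. idx x \<in> S \<Longrightarrow> idx y \<in> S \<Longrightarrow> idx x < idx y \<Longrightarrow> qcomm W (qq q y) (w x) (w y)"
    and R2: "\<And>i v. i \<in> S \<Longrightarrow> v \<in> W \<Longrightarrow>
      w (Inr i) (w (Inl i) v) = w (Inl i) (w (Inr i) v) - (1 - (inverse q)\<^sup>2) \<odot> yop S w i v"
    and N1: "\<And>i x. i \<in> S \<Longrightarrow> idx x \<in> S \<Longrightarrow> i \<le> idx x \<Longrightarrow> qcomm W ((qq q x)\<^sup>2) (yop S w i) (w x)"
    and N2: "\<And>i x. i \<in> S \<Longrightarrow> idx x \<in> S \<Longrightarrow> idx x < i \<Longrightarrow> qcomm W 1 (yop S w i) (w x)"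
    and pow_w: "\<And>x v. idx x \<in> S \<Longrightarrow> v \<in> W \<Longrightarrow> (w x ^^ m) v = a x \<odot> v"
    and pow_y: "\<And>i v. i \<in> S \<Longrightarrow> v \<in> W \<Longrightarrow> (yop S w i ^^ m) v = casimir S a i \<odot> v"
begin

lemma m_pos: "m > 0" and q_pow: "q ^ m = 1" and q_prim: "\<And>k. 0 < k \<Longrightarrow> k < m \<Longrightarrow> q ^ k \<noteq> 1"
  using prim by (auto simp: primitive_root_of_unity_def)

lemma q_nz [simp]: "q \<noteq> 0"
  using q_pow m_pos by (cases "q = 0") (auto simp: power_0_left)

lemma qq_nonzero [simp]: "qq q x \<noteq> 0"
  by simp

lemma qq_pow: "qq q x ^ m = 1"
  by (cases x) (simp_all add: power_inverse q_pow)

lemma qq_prim: "0 < k \<Longrightarrow> k < m \<Longrightarrow> qq q x ^ k \<noteq> 1"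
  using q_prim[of k] by (cases x) (simp_all add: power_inverse)

text \<open>As m is odd, 2k is never m, and 2k modulo m is again a nonzero residue.\<close>

lemma q2_prim: assumes "0 < k" "k < m" shows "q ^ (2 * k) \<noteq> 1"
proof (cases "2 * k < m")
  case True
  then show ?thesis using q_prim[of "2 * k"] assms by simp
next
  case False
  have "2 * k \<noteq> m" using odd_m by auto
  then have k: "0 < 2 * k - m" "2 * k - m < m" "2 * k = m + (2 * k - m)" using False assms by auto
  then have "q ^ (2 * k) = q ^ (2 * k - m)" using q_pow by (metis mult_1 power_add)
  then show ?thesis using q_prim k by simp
qed

lemma subW: "subspace W" using irrD(1)[OF irrW] .

lemma pres_w: "idx x \<in> S \<Longrightarrow> preserves W (w x)"
  by (rule irrD(4)[OF irrW]) auto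

lemma w_in: "idx x \<in> S \<Longrightarrow> v \<in> W \<Longrightarrow> w x v \<in> W"
  using pres_w by (simp add: preserves_def)

lemma lin_yop: "lin (yop T w i)"
  unfolding yop_def by (rule lin_sum_ops) (rule lin_comp[OF lin_w lin_w])

lemma pres_yop: "T \<subseteq> S \<Longrightarrow> preserves W (yop T w i)"
  unfolding yop_def by (rule preserves_sum[OF subW]) (auto intro!: preserves_comp[OF pres_w pres_w])

lemma yop_remove: "i < j \<Longrightarrow> yop (S - {i}) w j = yop S w j"
  unfolding yop_def by (intro ext sum.cong) auto

text \<open>Since y_j sums only over indices from j upwards, the relations among the larger indices
  never mention the smallest one. Irreducibility is the only property that has to be supplied
  anew.\<close>

lemma restrict:
  assumes bot: "\<And>k. k \<in> S \<Longrightarrow> i \<le> k" and W': "W' \<subseteq> W"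
    and irr': "irr W' (w ` {x. idx x \<in> S - {i}} \<union> Gs')"
  shows "B_system smul q m (S - {i}) W' w Gs' a"
proof unfold_locales
  have gt: "i < k" if "k \<in> S - {i}" for k using bot that by force
  note yr = yop_remove[OF gt]
  show "qcomm W' (qq q y) (w x) (w y)"
    if "idx x \<in> S - {i}" "idx y \<in> S - {i}" "idx x < idx y" for x y
    using qcomm_subset[OF R1 W'] that by simp
  show "w (Inr j) (w (Inl j) v) = w (Inl j) (w (Inr j) v) - (1 - (inverse q)\<^sup>2) \<odot> yop (S - {i}) w j v"
    if "j \<in> S - {i}" "v \<in> W'" for j v
    unfolding yr[OF that(1)] using R2 that W' by blast
  show "qcomm W' ((qq q x)\<^sup>2) (yop (S - {i}) w j) (w x)"
    if "j \<in> S - {i}" "idx x \<in> S - {i}" "j \<le> idx x" for j x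
    unfolding yr[OF that(1)] using qcomm_subset[OF N1 W'] that by simp
  show "qcomm W' 1 (yop (S - {i}) w j) (w x)"
    if "j \<in> S - {i}" "idx x \<in> S - {i}" "idx x < j" for j x
    unfolding yr[OF that(1)] using qcomm_subset[OF N2 W'] that by simp
  show "(w x ^^ m) v = a x \<odot> v" if "idx x \<in> S - {i}" "v \<in> W'" for x v
    using that pow_w W' by blast
  show "(yop (S - {i}) w j ^^ m) v = casimir (S - {i}) a j \<odot> v" if "j \<in> S - {i}" "v \<in> W'" for j v
    unfolding yr[OF that(1)] casimir_remove[OF gt[OF that(1)]] using that pow_y W' by blast
qed (use odd_m prim lin_w irr' in auto)

lemma change_ops:
  assumes "irr W (w ` {x. idx x \<in> S} \<union> Gs')"
  shows "B_system smul q m S W w Gs' a"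
  by unfold_locales (use odd_m prim lin_w assms R1 R2 N1 N2 pow_w pow_y in auto)

text \<open>The nonzero scalar by which g^m acts makes g invertible on \<open>W\<close> and provides
  its eigenvectors.\<close>

definition grading :: "('v \<Rightarrow> 'v) \<Rightarrow> bool" where
  "grading g \<longleftrightarrow> lin g \<and> preserves W g \<and> (\<forall>x. idx x \<in> S \<longrightarrow> qcomm W (qq q x) g (w x))
     \<and> (\<exists>c. c \<noteq> 0 \<and> (\<forall>v\<in>W. (g ^^ m) v = c \<odot> v))"

lemma gradingD:
  assumes "grading g"
  shows "lin g" "preserves W g" "idx x \<in> S \<Longrightarrow> qcomm W (qq q x) g (w x)"
    "\<exists>c. c \<noteq> 0 \<and> (\<forall>v\<in>W. (g ^^ m) v = c \<odot> v)"
  using assms by (auto simp: grading_def)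

lemma qcomm_grading_yop:
  assumes "grading g" "T \<subseteq> S"
  shows "qcomm W 1 g (yop T w i)"
  unfolding yop_def
proof (rule qcomm_sum_right)
  fix k assume "k \<in> {k \<in> T. i \<le> k}"
  then have k: "k \<in> S" using assms by auto
  have "qcomm W (qq q (Inl k) * qq q (Inr k)) g (\<lambda>v. w (Inl k) (w (Inr k) v))"
    by (rule qcomm_comp_right[where B = "w (Inl k)" and C = "w (Inr k)"]) (use gradingD(3)[OF assms(1), of "Inl k"] gradingD(3)[OF assms(1), of "Inr k"] k lin_w pres_w in auto)
  then show "qcomm W 1 g (\<lambda>v. w (Inl k) (w (Inr k) v))" by simp
qed (rule gradingD(1)[OF assms(1)])

section \<open>Reduction steps at the smallest index\<close>

context
  fixes i :: 'n
  assumes iS: "i \<in> S" and bot: "\<And>k. k \<in> S \<Longrightarrow> i \<le> k"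
begin

abbreviation "y \<equiv> yop S w i"
abbreviation "y1 \<equiv> yop (S - {i}) w i"
abbreviation "S1 \<equiv> S - {i}"

lemma y_split: "y v = w (Inl i) (w (Inr i) v) + y1 v"
proof -
  have "{k. k \<in> S \<and> i \<le> k} = insert i {k. k \<in> S - {i} \<and> i \<le> k}" using iS by auto
  then show ?thesis by (simp add: yop_def)
qed

lemma zz': "w (Inl i) (w (Inr i) v) = y v - y1 v"
  by (simp add: y_split)

lemma z'z: assumes "v \<in> W" shows "w (Inr i) (w (Inl i) v) = (inverse q)\<^sup>2 \<odot> y v - y1 v"
  unfolding R2[OF iS assms] zz' by (simp add: scale_left_diff_distrib)

lemma qcomm_y: "idx x \<in> S \<Longrightarrow> qcomm W ((qq q x)\<^sup>2) y (w x)"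
  using N1[OF iS] bot by simp

lemma qcomm_bot: "idx x0 = i \<Longrightarrow> idx x \<in> S1 \<Longrightarrow> qcomm W (qq q x) (w x0) (w x)"
  using R1[of x0 x] iS bot by force

lemma qcomm_bot_y1: assumes "idx x0 = i" shows "qcomm W 1 (w x0) y1"
  unfolding yop_def
proof (rule qcomm_sum_right)
  fix k assume "k \<in> {k \<in> S1. i \<le> k}"
  then have k: "k \<in> S1" "k \<in> S" by auto
  have "qcomm W (qq q (Inl k) * qq q (Inr k)) (w x0) (\<lambda>v. w (Inl k) (w (Inr k) v))"
    by (rule qcomm_comp_right[where B = "w (Inl k)" and C = "w (Inr k)"]) (use k qcomm_bot[OF assms, of "Inl k"] qcomm_bot[OF assms, of "Inr k"] lin_w pres_w in auto)
  then show "qcomm W 1 (w x0) (\<lambda>v. w (Inl k) (w (Inr k) v))" by simp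
qed (rule lin_w)

lemma y1_restrict_pres:
  assumes "subspace U" "\<And>x. idx x \<in> S1 \<Longrightarrow> preserves U (w x)"
  shows "preserves U y1"
  unfolding yop_def by (rule preserves_sum[OF assms(1)]) (auto intro!: preserves_comp[OF assms(2) assms(2)])

lemma pow_y_total: "v \<in> W \<Longrightarrow> (y ^^ m) v = (\<Sum>k\<in>S. a (Inl k) * a (Inr k)) \<odot> v"
  using pow_y[OF iS] casimir_bot[OF bot] by simp

lemma ops_cases:
  assumes "A \<in> w ` {x. idx x \<in> S} \<union> Gs"
  obtains (bot) x0 where "A = w x0" "idx x0 = i" | (above) x where "A = w x" "idx x \<in> S1" | (gr) "A \<in> Gs"
  using assms by auto

lemma y_zero:
  assumes Y: "(\<Sum>k\<in>S. a (Inl k) * a (Inr k)) = 0" and gr: "\<And>g. g \<in> Gs \<Longrightarrow> grading g" and v: "v \<in> W"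
  shows "y v = 0"
proof (rule normal_nilpotent_zero[OF irrW lin_yop pres_yop[OF subset_refl] _ _ m_pos v])
  fix A assume "A \<in> w ` {x. idx x \<in> S} \<union> Gs"
  then consider x where "A = w x" "idx x \<in> S" | "A \<in> Gs" by auto
  then show "\<exists>d. qcomm W d y A"
  proof cases
    case 2
    then show ?thesis using qcomm_sym[OF qcomm_grading_yop[OF gr subset_refl]] by auto
  qed (use qcomm_y in auto)
qed (use pow_y_total Y in simp)

text \<open>Once y_i acts as 0, both products of z_i and z_i^* equal -y_{i+1}. They commute with
  each other and up to a factor with everything else, so the kernel of a nilpotent one is a
  submodule.\<close>

lemma bot_zero:
  assumes y0: "\<And>v. v \<in> W \<Longrightarrow> y v = 0" and gr: "\<And>g. g \<in> Gs \<Longrightarrow> grading g"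
    and x0: "idx x0 = i" "a x0 = 0" and v: "v \<in> W"
  shows "w x0 v = 0"
proof (rule normal_nilpotent_zero[OF irrW lin_w pres_w _ _ m_pos v])
  show "idx x0 \<in> S" using x0 iS by simp
  show "(w x0 ^^ m) v = 0" if "v \<in> W" for v using pow_w[of x0 v] that x0 iS by simp
  fix A assume "A \<in> w ` {x. idx x \<in> S} \<union> Gs"
  then show "\<exists>d. qcomm W d (w x0) A"
  proof (cases rule: ops_cases)
    case (bot x)
    have "qcomm W 1 (w (Inl i)) (w (Inr i))" "qcomm W 1 (w (Inr i)) (w (Inl i))"
      by (auto simp: qcomm_def zz' z'z y0)
    then show ?thesis using bot x0 qcomm_refl by (cases x0; cases x) auto
  next
    case (above x)
    then show ?thesis using qcomm_bot[OF x0(1)] by blast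
  next
    case gr': gr
    then show ?thesis using qcomm_sym[OF gradingD(3)[OF gr[OF gr']], of x0] x0 iS by auto
  qed
qed

lemma drop_step:
  assumes Y: "(\<Sum>k\<in>S. a (Inl k) * a (Inr k)) = 0" and gr: "\<And>g. g \<in> Gs \<Longrightarrow> grading g"
    and "a (Inl i) = 0" "a (Inr i) = 0"
  shows "B_system smul q m S1 W w Gs a"
proof (rule restrict[OF bot subset_refl], assumption, rule irr_change_ops[OF irrW])
  fix U A
  assume U: "subspace U" "U \<subseteq> W" and st: "\<And>A. A \<in> w ` {x. idx x \<in> S1} \<union> Gs \<Longrightarrow> preserves U A"
    and A: "A \<in> w ` {x. idx x \<in> S} \<union> Gs"
  from A show "preserves U A"
  proof (cases rule: ops_cases)
    case (bot x0)
    then have "a x0 = 0" using assms by (cases x0) auto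
    then have "w x0 v = 0" if "v \<in> U" for v
      using bot_zero[OF y_zero[OF Y gr] gr] bot U(2) that by blast
    then show ?thesis using bot subspace_0[OF U(1)] by (simp add: preserves_def)
  qed (use st in auto)
qed (use irrD(3,4)[OF irrW] in auto)

text \<open>With y_i acting as 0, the product of \<open>w x0\<close> and \<open>w (star x0)\<close>
  is -y_{i+1}. As (w x0)^(m-1) is a nonzero multiple of the inverse of \<open>w x0\<close>, the
  operator \<open>w (star x0)\<close> is generated by the remaining ones, and no new submodules
  appear. The operator \<open>w x0\<close> commutes with the larger indices exactly as g
  should.\<close>

lemma ungraded_step:
  assumes Y: "(\<Sum>k\<in>S. a (Inl k) * a (Inr k)) = 0" and Gs: "Gs = {}"
    and x0: "idx x0 = i" "a x0 \<noteq> 0"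
  shows "B_system smul q m S1 W w {w x0} a"
    and "B_system.grading smul q m S1 W w (w x0)"
proof -
  have y0: "y v = 0" if "v \<in> W" for v using y_zero[OF Y _ that] Gs by blast
  interpret sub: B_system smul q m S1 W w "{w x0}" a
  proof (rule restrict[OF bot subset_refl], assumption, rule irr_change_ops[OF irrW])
    fix U A
    assume U: "subspace U" "U \<subseteq> W" and st: "\<And>A. A \<in> w ` {x. idx x \<in> S1} \<union> {w x0} \<Longrightarrow> preserves U A"
      and A: "A \<in> w ` {x. idx x \<in> S} \<union> Gs"
    have pU: "preserves U (w x0)" using st by blast
    have y1U: "preserves U y1" by (rule y1_restrict_pres[OF U(1)]) (use st in blast)
    from A show "preserves U A"
    proof (cases rule: ops_cases)
      case (bot x)
      show ?thesis
      proof (cases "x = x0")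
        case False
        then have x: "x = star x0" using bot x0 idx_eq_cases[of x x0] by auto
        have "A u \<in> U" if u: "u \<in> U" for u
        proof -
          have uW: "u \<in> W" using u U by blast
          have "w x0 (A u) = - y1 u"
            unfolding bot x using x0 z'z[OF uW] zz'[of u] y0[OF uW] by (cases x0) auto
          then have e: "(w x0 ^^ (m - 1)) (w x0 (A u)) \<in> U"
            using preservesD[OF preserves_funpow[OF pU]] preservesD[OF y1U u] subspace_neg[OF U(1)] by metis
          have "A u \<in> W" using bot uW w_in x0 iS by simp
          then have "a x0 \<odot> A u = (w x0 ^^ Suc (m - 1)) (A u)"
            using pow_w[of x0] x0 iS m_pos by simp
          also have "\<dots> = (w x0 ^^ (m - 1)) (w x0 (A u))" by (simp only: funpow_Suc_right comp_apply)
          finally have "inverse (a x0) \<odot> (a x0 \<odot> A u) \<in> U" using e subspace_scale[OF U(1)] by metis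
          then show ?thesis using x0 by simp
        qed
        then show ?thesis by (simp add: preserves_def)
      qed (use pU bot in simp)
    qed (use st Gs in auto)
  qed (use irrD(3,4)[OF irrW] lin_w pres_w x0 iS in auto)
  show "B_system smul q m S1 W w {w x0} a" ..
  show "sub.grading (w x0)"
    unfolding sub.grading_def using x0 iS qcomm_bot lin_w pres_w pow_w by auto
qed

lemma grade_step:
  assumes Y: "(\<Sum>k\<in>S. a (Inl k) * a (Inr k)) \<noteq> 0" and Gs: "Gs = {}"
  obtains g where "B_system smul q m S W w {g} a" "B_system.grading smul q m S W w g"
proof -
  \<comment> \<open>Moving y past \<open>w x\<close> costs the square of \<open>qq q x\<close>.
    Since 2h = m + 1, its h-th power costs \<open>qq q x\<close> itself.\<close>
  define h where "h = (m + 1) div 2"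
  have h2: "2 * h = m + 1" using odd_m by (auto simp: h_def elim: oddE)
  let ?g = "y ^^ h"
  let ?Y = "\<Sum>k\<in>S. a (Inl k) * a (Inr k)"
  interpret g: B_system smul q m S W w "{?g}" a
  proof (rule change_ops, rule irr_change_ops[OF irrW])
    show "lin A" "preserves W A" if "A \<in> w ` {x. idx x \<in> S} \<union> {?g}" for A
      using that lin_w pres_w lin_funpow[OF lin_yop] preserves_funpow[OF pres_yop] by auto
  qed (use Gs in auto)
  have "qcomm W (qq q x) ?g (w x)" if "idx x \<in> S" for x
  proof -
    have "qcomm W (((qq q x)\<^sup>2) ^ h) ?g (w x)"
      by (rule qcomm_pow_left[OF qcomm_y[OF that] lin_yop pres_yop]) simp
    also have "((qq q x)\<^sup>2) ^ h = qq q x"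
      by (simp add: power_mult[symmetric] h2 qq_pow)
    finally show ?thesis .
  qed
  moreover have "(?g ^^ m) v = (?Y ^ h) \<odot> v" if v: "v \<in> W" for v
  proof -
    have "((y ^^ m) ^^ n) v = (?Y ^ n) \<odot> v" for n
    proof (induction n)
      case (Suc n)
      then show ?case using pow_y_total[OF v] by (simp add: lin_scale[OF lin_funpow[OF lin_yop]] mult.commute)
    qed simp
    then show ?thesis by (simp add: funpow_mult mult.commute)
  qed
  ultimately have "g.grading ?g"
    unfolding g.grading_def using Y lin_funpow[OF lin_yop] preserves_funpow[OF pres_yop[OF subset_refl]]
    by (auto intro!: exI[of _ "?Y ^ h"])
  then show ?thesis using that g.B_system_axioms by blast
qed


text \<open>
  If \<open>z\<^sub>i\<close> is nilpotent and \<open>y\<^sub>i\<close> is invertible, then \<open>W\<close> is the direct sum of the translates of \<open>ker z\<^sub>i\<close>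
  under the powers \<open>1, z\<^sub>i\<^sup>*, \<dots>, (z\<^sub>i\<^sup>*)\<^bsup>m-1\<^esup>\<close>.
\<close>

lemma nilpotent_step:
  assumes Y: "(\<Sum>k\<in>S. a (Inl k) * a (Inr k)) \<noteq> 0" and Gs: "Gs = {g}" and gr: "grading g"
    and az: "a (Inl i) = 0" "a (Inr i) = 0"
  obtains W0 where "B_system smul q m S1 W0 w {g} a" "B_system.grading smul q m S1 W0 w g"
    "\<And>n. has_basis_card W0 n \<Longrightarrow> has_basis_card W (m * n)"
proof -
  let ?z = "w (Inl i)" and ?z' = "w (Inr i)"
  define W0 where "W0 = {v \<in> W. ?z v = 0}"
  have iz: "idx (Inl i) \<in> S" "idx (Inr i) \<in> S" using iS by auto
  note gD = gradingD[OF gr]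
  have sub0: "subspace W0"
    using subW by (auto simp: W0_def subspace_def lin_0[OF lin_w] lin_add[OF lin_w] lin_scale[OF lin_w])
  obtain v0 where "v0 \<in> W" "v0 \<noteq> 0" using irrD(2)[OF irrW] by blast
  then obtain \<mu> u0 where "\<mu> ^ m = 0" "u0 \<in> W" "u0 \<noteq> 0" "?z u0 = \<mu> \<odot> u0"
    using exists_eigenvector[OF lin_w pres_w[OF iz(1)] subW _ _ _ m_pos, of v0 "a (Inl i)"] pow_w[OF iz(1)] az
    by auto
  then have u0: "u0 \<in> W0" "u0 \<noteq> 0" by (auto simp: W0_def)
  have pres0: "preserves W0 A" if "qcomm W d ?z A" "lin A" "preserves W A" for A d
    using that by (auto simp: preserves_def W0_def qcomm_def lin_0)
  have pw: "preserves W0 (w x)" if "idx x \<in> S1" for x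
    using pres0[OF qcomm_bot[of "Inl i"]] lin_w pres_w that by simp
  have pg: "preserves W0 g"
    using pres0[OF qcomm_sym[OF gD(3)[OF iz(1)]]] gD by simp
  have yv: "y v = q\<^sup>2 \<odot> y1 v" if "v \<in> W0" for v
  proof -
    have v: "v \<in> W" "?z v = 0" using that by (auto simp: W0_def)
    have "(inverse q)\<^sup>2 \<odot> y v = y1 v" using z'z[OF v(1)] v(2) by (simp add: lin_0[OF lin_w])
    then have "q\<^sup>2 \<odot> (inverse q)\<^sup>2 \<odot> y v = q\<^sup>2 \<odot> y1 v" by simp
    then show ?thesis by (simp add: power_mult_distrib[symmetric])
  qed
  have y1v: "y1 v = (inverse q)\<^sup>2 \<odot> y v" if "v \<in> W0" for v
    using yv[OF that] by (simp add: power_mult_distrib[symmetric])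
  have py1: "preserves U y1" if "subspace U" "\<And>A. A \<in> w ` {x. idx x \<in> S1} \<union> {g} \<Longrightarrow> preserves U A" for U
    by (rule y1_restrict_pres[OF that(1)]) (use that(2) in blast)
  have py: "preserves U y"
    if "subspace U" "U \<subseteq> W0" "\<And>A. A \<in> w ` {x. idx x \<in> S1} \<union> {g} \<Longrightarrow> preserves U A" for U
    using py1[OF that(1,3)] yv that(2) subspace_scale[OF that(1)] by (auto simp: preserves_def)
  have ops0: "lin A" "preserves W0 A" if "A \<in> w ` {x. idx x \<in> S1} \<union> {g}" for A
    using that pw pg lin_w gD(1) by auto
  have pyW0: "preserves W0 y" by (rule py[OF sub0 subset_refl ops0(2)])
  \<comment> \<open>An oscillator: z_i lowers the s+1-st level to the s-th. The factor is a multiple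
    of q^(2(s+1)) - 1 and so vanishes only when s + 1 reaches m.\<close>
  have zz: "?z ((?z' ^^ Suc s) v) = (q ^ (2 * s) - (inverse q)\<^sup>2) \<odot> (?z' ^^ s) (y v)" if v: "v \<in> W0" for s v
  proof -
    have vW: "v \<in> W" using v by (simp add: W0_def)
    have 1: "y ((?z' ^^ s) v) = q ^ (2 * s) \<odot> (?z' ^^ s) (y v)"
      using qcommD[OF qcomm_pow_right[OF qcomm_y[OF iz(2)] lin_w pres_w[OF iz(2)], of s] vW]
      by (simp add: power_mult)
    have 2: "(?z' ^^ s) (y1 v) = y1 ((?z' ^^ s) v)"
      using qcommD[OF qcomm_pow_left[OF qcomm_bot_y1 lin_w pres_w[OF iz(2)], of s] vW] by simp
    have "?z ((?z' ^^ Suc s) v) = y ((?z' ^^ s) v) - y1 ((?z' ^^ s) v)"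
      by (simp add: zz')
    also have "\<dots> = q ^ (2 * s) \<odot> (?z' ^^ s) (y v) - (?z' ^^ s) ((inverse q)\<^sup>2 \<odot> y v)"
      unfolding 1 2[symmetric] y1v[OF v] ..
    finally show ?thesis by (simp add: lin_scale[OF lin_funpow[OF lin_w]] scale_left_diff_distrib)
  qed
  have nz: "q ^ (2 * s) - (inverse q)\<^sup>2 \<noteq> 0" if "Suc s < m" for s
  proof
    assume "q ^ (2 * s) - (inverse q)\<^sup>2 = 0"
    then have "q ^ (2 * s) * q\<^sup>2 = 1" by (simp add: power_mult_distrib[symmetric])
    then have "q ^ (2 * Suc s) = 1" by (simp add: power_add[symmetric])
    then show False using q2_prim[of "Suc s"] that by simp
  qed
  \<comment> \<open>Descending t levels ends at a nonzero multiple of y^t, which is injective; one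
    more application of z_i gives 0 (\<open>low\<close>). This makes the family of levels
    triangular.\<close>
  have top: "\<exists>c. c \<noteq> 0 \<and> (\<forall>v\<in>W0. (?z ^^ t) ((?z' ^^ t) v) = c \<odot> (y ^^ t) v)" if "t < m" for t
    using that
  proof (induction t)
    case 0
    show ?case by (intro exI[of _ 1]) simp
  next
    case (Suc t)
    then obtain c where c: "c \<noteq> 0" "\<forall>v\<in>W0. (?z ^^ t) ((?z' ^^ t) v) = c \<odot> (y ^^ t) v" by auto
    have "(?z ^^ Suc t) ((?z' ^^ Suc t) v)
        = ((q ^ (2 * t) - (inverse q)\<^sup>2) * c) \<odot> (y ^^ Suc t) v" if v: "v \<in> W0" for v
    proof -
      have "(?z ^^ Suc t) ((?z' ^^ Suc t) v) = (?z ^^ t) (?z ((?z' ^^ Suc t) v))"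
        by (simp only: funpow_Suc_right comp_apply)
      also have "\<dots> = (q ^ (2 * t) - (inverse q)\<^sup>2) \<odot> (?z ^^ t) ((?z' ^^ t) (y v))"
        unfolding zz[OF v] by (simp add: lin_scale[OF lin_funpow[OF lin_w]])
      also have "\<dots> = (q ^ (2 * t) - (inverse q)\<^sup>2) \<odot> c \<odot> (y ^^ t) (y v)"
        using c(2) preservesD[OF pyW0 v] by simp
      also have "(y ^^ t) (y v) = (y ^^ Suc t) v" by (simp only: funpow_Suc_right comp_apply)
      finally show ?thesis by simp
    qed
    then show ?case using nz Suc.prems c(1) by (intro exI[of _ "(q ^ (2 * t) - (inverse q)\<^sup>2) * c"]) auto
  qed
  have low: "(?z ^^ t) ((?z' ^^ s) v) = 0" if st: "s < t" and sm: "s < m" and v0: "v \<in> W0" for s t v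
  proof -
    obtain c where c: "(?z ^^ s) ((?z' ^^ s) v) = c \<odot> (y ^^ s) v" using top[OF sm] v0 by blast
    have *: "(y ^^ s) v \<in> W0" using preservesD[OF preserves_funpow[OF pyW0] v0] .
    obtain r where r: "t = Suc r + s" using st less_iff_Suc_add by (metis add.commute add_Suc_right)
    have "(?z ^^ t) ((?z' ^^ s) v) = (?z ^^ r) (?z (c \<odot> (y ^^ s) v))"
      unfolding r funpow_add comp_apply c[symmetric] by (simp add: funpow_swap1)
    also have "?z (c \<odot> (y ^^ s) v) = 0" using * by (simp add: W0_def lin_scale[OF lin_w])
    finally show ?thesis by (simp add: lin_0[OF lin_funpow[OF lin_w]])
  qed
  have y_inj: "v = 0" if "v \<in> W" "(y ^^ t) v = 0" "t < m" for v t
  proof -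
    have "(y ^^ (m - t + t)) v = (y ^^ (m - t)) ((y ^^ t) v)" by (simp only: funpow_add comp_apply)
    then have "(y ^^ m) v = (y ^^ (m - t)) ((y ^^ t) v)" using that(3) by simp
    then have "(\<Sum>k\<in>S. a (Inl k) * a (Inr k)) \<odot> v = 0"
      using pow_y_total[OF that(1)] that(2) by (simp add: lin_0[OF lin_funpow[OF lin_yop]])
    then show ?thesis using Y by simp
  qed
  have direct: "u s = 0" if u: "\<forall>s<m. u s \<in> W0" "(\<Sum>s<m. (?z' ^^ s) (u s)) = 0" and s: "s < m" for u s
  proof (rule ccontr)
    assume "u s \<noteq> 0"
    \<comment> \<open>Applying z_i^t kills all levels below the highest occurring one and leaves a
      multiple of \<open>(y ^^ t) (u t)\<close>.\<close>
    define t where "t = Max {s. s < m \<and> u s \<noteq> 0}"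
    have fin: "finite {s. s < m \<and> u s \<noteq> 0}" by simp
    have "t \<in> {s. s < m \<and> u s \<noteq> 0}"
      unfolding t_def by (rule Max_in[OF fin]) (use s \<open>u s \<noteq> 0\<close> in blast)
    then have t: "t < m" "u t \<noteq> 0" by auto
    have gt: "u r = 0" if "r < m" "t < r" for r
    proof (rule ccontr)
      assume "u r \<noteq> 0"
      then have "r \<le> t" unfolding t_def by (intro Max_ge[OF fin]) (use that in simp)
      then show False using that by simp
    qed
    have "0 = (?z ^^ t) (\<Sum>s<m. (?z' ^^ s) (u s))" using u(2) by (simp add: lin_0[OF lin_funpow[OF lin_w]])
    also have "\<dots> = (\<Sum>s<m. (?z ^^ t) ((?z' ^^ s) (u s)))" by (rule lin_sum[OF lin_funpow[OF lin_w]])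
    also have "\<dots> = (\<Sum>s<m. if s = t then (?z ^^ t) ((?z' ^^ t) (u t)) else 0)"
    proof (intro sum.cong refl)
      fix s assume "s \<in> {..<m}"
      then show "(?z ^^ t) ((?z' ^^ s) (u s)) = (if s = t then (?z ^^ t) ((?z' ^^ t) (u t)) else 0)"
        using low[of s t "u s"] gt[of s] u(1)
        by (cases s t rule: linorder_cases) (auto simp: lin_0[OF lin_funpow[OF lin_w]])
    qed
    also have "\<dots> = (?z ^^ t) ((?z' ^^ t) (u t))" using t by simp
    finally have "(y ^^ t) (u t) = 0" using top[OF t(1)] u(1) t(1) by fastforce
    then have "u t = 0" using y_inj u(1) t(1) by (auto simp: W0_def)
    then show False using t by simp
  qed
  have W0W: "W0 \<subseteq> W" by (auto simp: W0_def)
  have ind: "irr W0 (w ` {x. idx x \<in> S1} \<union> {g})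
    \<and> (\<forall>n. has_basis_card W0 n \<longrightarrow> has_basis_card W (m * n))"
  proof (rule irr_induced[OF irrW lin_w pres_w[OF iz(2)] sub0 W0W u0 m_pos])
    show "lin A" "preserves W0 A" if "A \<in> w ` {x. idx x \<in> S1} \<union> {g}" for A by (fact ops0[OF that])+
    show "u s = 0" if "\<forall>s<m. u s \<in> W0" "(\<Sum>s<m. (?z' ^^ s) (u s)) = 0" "s < m" for u s
      by (fact direct[OF that])
    fix U A s u
    assume U: "subspace U" "U \<subseteq> W0" and st: "\<And>A. A \<in> w ` {x. idx x \<in> S1} \<union> {g} \<Longrightarrow> preserves U A"
      and A: "A \<in> w ` {x. idx x \<in> S} \<union> Gs" and s: "s < m" and u: "u \<in> U"
    note sh = subspace_shifts[OF lin_w U(1)] and base = shifts_base[OF lin_w U(1)]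
    have uW: "u \<in> W" "u \<in> W0" using u U by (auto simp: W0_def)
    from A show "A ((?z' ^^ s) u) \<in> shifts m ?z' U"
    proof (cases rule: ops_cases)
      case (bot x0)
      show ?thesis
      proof (cases x0)
        case (Inl j)
        then have A: "A = ?z" using bot by simp
        show ?thesis
        proof (cases s)
          case 0
          then show ?thesis using A uW subspace_0[OF sh] by (simp add: W0_def)
        next
          case (Suc r)
          then show ?thesis unfolding A Suc zz[OF uW(2)]
            using s Suc by (intro subspace_scale[OF sh] base preservesD[OF py[OF U st] u]) auto
        qed
      next
        case (Inr j)
        then have A: "A = ?z'" using bot by simp
        show ?thesis
        proof (cases "Suc s < m")
          case True
          then show ?thesis using base[OF True u] A by simp
        next
          case False
          \<comment> \<open>Raising beyond the last level gives the m-th power of z_i^*, which is 0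
            here.\<close>
          then have "m = Suc s" using s by simp
          then have "A ((?z' ^^ s) u) = 0" using pow_w[OF iz(2) uW(1)] az A by simp
          then show ?thesis using subspace_0[OF sh] by simp
        qed
      qed
    next
      case (above x)
      have "qcomm W (qq q x ^ s) (?z' ^^ s) (w x)"
        using qcomm_pow_left[OF qcomm_bot[of "Inr i"] lin_w pres_w[OF iz(2)]] above by simp
      then have "A ((?z' ^^ s) u) = inverse (qq q x ^ s) \<odot> (?z' ^^ s) (w x u)"
        using qcommD[OF qcomm_sym uW(1)] above by simp
      moreover have "w x u \<in> U" using st above u by (auto intro: preservesD)
      ultimately show ?thesis using subspace_scale[OF sh base[OF s]] by simp
    next
      case gr
      then have A: "A = g" using Gs by simp
      have "A ((?z' ^^ s) u) = (qq q (Inr i) ^ s) \<odot> (?z' ^^ s) (g u)"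
        using qcommD[OF qcomm_pow_right[OF gD(3)[OF iz(2)] lin_w pres_w[OF iz(2)]] uW(1)] A by simp
      moreover have "g u \<in> U" using st u by (auto intro: preservesD)
      ultimately show ?thesis using subspace_scale[OF sh base[OF s]] by simp
    qed
  qed
  interpret sub: B_system smul q m S1 W0 w "{g}" a
    by (rule restrict[OF bot W0W conjunct1[OF ind]])
  have "sub.grading g"
    unfolding sub.grading_def
  proof (intro conjI allI impI)
    show "lin g" "preserves W0 g" using gD(1) pg .
    show "qcomm W0 (qq q x) g (w x)" if "idx x \<in> S1" for x
      using qcomm_subset[OF gD(3)] that by (auto simp: W0_def)
    show "\<exists>c. c \<noteq> 0 \<and> (\<forall>v\<in>W0. (g ^^ m) v = c \<odot> v)" using gD(4) by (auto simp: W0_def)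
  qed
  then show ?thesis using that[OF sub.B_system_axioms] ind by blast
qed


text \<open>
  If \<open>w x0\<close> is invertible, it permutes the eigenspaces of \<open>g\<close> cyclically. The products \<open>uo x\<close> of \<open>w x\<close> with the
  power \<open>\<plusminus> 1\<close> of \<open>w x0\<close> that commutes with \<open>g\<close> preserve each eigenspace, and again satisfy the relations.
\<close>

lemma torus_step:
  assumes Gs: "Gs = {g}" and gr: "grading g" and x0: "idx x0 = i" "a x0 \<noteq> 0"
  obtains W0 u b d1 d2 where "B_system smul q m S1 W0 u {} b"
    "d1 \<noteq> 0" "d2 \<noteq> 0" "\<And>j. b (Inl j) = d1 * a (Inl j)" "\<And>j. b (Inr j) = d2 * a (Inr j)"
    "\<And>n. has_basis_card W0 n \<Longrightarrow> has_basis_card W (m * n)"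
proof -
  \<comment> \<open>The exponent m - 1 stands for -1, because the m-th power of \<open>w x0\<close>
    is a nonzero scalar. It is used when \<open>x\<close> and \<open>x0\<close> have the same
    degree, so that \<open>uo x\<close> always has degree 0.\<close>
  define ee :: "'n gen \<Rightarrow> nat" where "ee = (\<lambda>x. if isl x = isl x0 then m - 1 else 1)"
  define uo where "uo = (\<lambda>x v. w x ((w x0 ^^ ee x) v))"
  define b where "b = (\<lambda>x. a x * a x0 ^ ee x)"
  define eL eR where "eL = ee (Inl i)" and "eR = ee (Inr i)"
  have eLR: "ee (Inl j) = eL" "ee (Inr j) = eR" for j by (auto simp: eL_def eR_def ee_def)
  have eLR_sum: "eL + eR = m" "eR + eL = m"
    using m_pos by (auto simp: eL_def eR_def ee_def)
  have ee_le: "ee x \<le> m" for x using m_pos by (simp add: ee_def)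
  let ?w = "w x0" and ?a0 = "a x0" and ?zeta = "qq q x0"
  have x0S: "idx x0 \<in> S" using x0 iS by simp
  note gD = gradingD[OF gr]
  note lw = lin_w[of x0] and lwn = lin_funpow[OF lin_w, of _ x0]
  note pw = pres_w[OF x0S]
  have pwn: "(?w ^^ n) v \<in> W" if "v \<in> W" for n v
    using preservesD[OF preserves_funpow[OF pw] that] .
  \<comment> \<open>The powers of q that arise from collecting the powers of \<open>w x0\<close> are
    symmetric in \<open>x\<close> and \<open>y\<close>. Therefore the \<open>uo x\<close> q-commute
    with the same factors as the \<open>w x\<close>.\<close>
  have swap: "qq q y ^ ee x = qq q x ^ ee y" for x y
  proof -
    have "q ^ (m - 1) = inverse q"
      using q_pow m_pos by (metis Suc_diff_1 inverse_unique power_Suc2 mult.commute)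
    then show ?thesis by (cases x; cases y; cases x0) (auto simp: ee_def power_inverse)
  qed
  have grade0: "qq q x * ?zeta ^ ee x = 1" for x
  proof -
    have "q ^ (m - 1) = inverse q"
      using q_pow m_pos by (metis Suc_diff_1 inverse_unique power_Suc2 mult.commute)
    then show ?thesis by (cases x; cases x0) (auto simp: ee_def power_inverse)
  qed
  have wm: "(?w ^^ m) v = ?a0 \<odot> v" if "v \<in> W" for v using pow_w[OF x0S that] .
  have wx: "qcomm W (qq q x ^ n) (?w ^^ n) (w x)" if "idx x \<in> S1" for x n
    using qcomm_pow_left[OF qcomm_bot[OF x0(1) that] lw pw] .
  have uo_eq: "uo x ((w x0 ^^ n) v) = w x ((?w ^^ (ee x + n)) v)" for x n v
    by (simp add: uo_def funpow_add)
  have uu: "uo x (uo y v) = (qq q y ^ ee x) \<odot> w x (w y ((?w ^^ (ee x + ee y)) v))"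
    if "idx x \<in> S1" "idx y \<in> S1" "v \<in> W" for x y v
    unfolding uo_def using qcommD[OF wx[OF that(2)] pwn[OF that(3)], of "ee x" "ee y"]
    by (simp add: lin_scale[OF lin_w] funpow_add)
  define C0 where "C0 = q ^ eL * ?a0"
  have C0: "C0 \<noteq> 0" using x0 by (simp add: C0_def)
  have LR: "uo (Inl k) (uo (Inr k) v) = C0 \<odot> w (Inl k) (w (Inr k) v)"
    and RL: "uo (Inr k) (uo (Inl k) v) = C0 \<odot> w (Inr k) (w (Inl k) v)"
    if "k \<in> S1" "v \<in> W" for k v
  proof -
    show "uo (Inl k) (uo (Inr k) v) = C0 \<odot> w (Inl k) (w (Inr k) v)"
      using uu[of "Inl k" "Inr k" v] that by (simp add: eLR eLR_sum wm lin_scale[OF lin_w] C0_def)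
    have "inverse q ^ eR = q ^ eL"
    proof -
      have "q ^ eL * q ^ eR = 1" using eLR_sum(1) q_pow by (metis power_add)
      then show ?thesis by (simp add: power_inverse inverse_unique mult.commute)
    qed
    then show "uo (Inr k) (uo (Inl k) v) = C0 \<odot> w (Inr k) (w (Inl k) v)"
      using uu[of "Inr k" "Inl k" v] that by (simp add: eLR eLR_sum wm lin_scale[OF lin_w] C0_def)
  qed
  have yuo: "yop S1 uo j v = C0 \<odot> yop S1 w j v" if "v \<in> W" for j v
    unfolding yop_def scale_sum_right by (intro sum.cong refl LR) (use that in auto)
  have pow_uo: "(uo x ^^ m) v = b x \<odot> v" if x: "idx x \<in> S1" and v: "v \<in> W" for x v
  proof -
    have xS: "idx x \<in> S" using x by simp
    \<comment> \<open>The exponent m(m-1)/2 is a multiple of m because m is odd, so the reordering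
      factor is 1.\<close>
    obtain h where h: "m - 1 = 2 * h" using odd_m by (auto elim: oddE)
    have "(uo x ^^ m) v = ((qq q x ^ ee x) ^ (m * (m - 1) div 2)) \<odot> (w x ^^ m) (((?w ^^ ee x) ^^ m) v)"
      unfolding uo_def
      by (rule qcomm_comp_pow[OF wx[OF x] lin_w lwn pres_w[OF xS] preserves_funpow[OF pw] v])
    also have "(qq q x ^ ee x) ^ (m * (m - 1) div 2) = (qq q x ^ m) ^ (ee x * h)"
      unfolding h by (simp add: mult_ac flip: power_mult)
    also have "\<dots> = 1" by (simp add: qq_pow)
    also have "((?w ^^ ee x) ^^ m) v = (?a0 ^ ee x) \<odot> v"
    proof -
      have "((?w ^^ m) ^^ n) v = (?a0 ^ n) \<odot> v" for n
        by (induction n) (auto simp: wm v lin_scale[OF lwn] mult.commute)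
      from this[of "ee x"] show ?thesis by (simp add: funpow_mult mult.commute)
    qed
    also have "(w x ^^ m) (?a0 ^ ee x \<odot> v) = b x \<odot> v"
      by (simp add: lin_scale[OF lin_funpow[OF lin_w]] pow_w[OF xS v] b_def mult.commute)
    finally show ?thesis by simp
  qed
  have lin_uo: "lin (uo x)" for x unfolding uo_def by (rule lin_comp[OF lin_w lwn])
  have pres_uo: "preserves W (uo x)" if "idx x \<in> S" for x
    unfolding uo_def by (rule preserves_comp[OF pres_w[OF that] preserves_funpow[OF pw]])
  obtain c where c: "c \<noteq> 0" "\<And>v. v \<in> W \<Longrightarrow> (g ^^ m) v = c \<odot> v" using gD(4) by blast
  obtain v0 where "v0 \<in> W" "v0 \<noteq> 0" using irrD(2)[OF irrW] by blast
  then obtain \<mu> u0 where \<mu>: "\<mu> ^ m = c" "u0 \<in> W" "u0 \<noteq> 0" "g u0 = \<mu> \<odot> u0"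
    using exists_eigenvector[OF gD(1,2) subW _ _ c(2) m_pos] by blast
  define W0 where "W0 = {v \<in> W. g v = \<mu> \<odot> v}"
  have W0W: "W0 \<subseteq> W" by (auto simp: W0_def)
  have \<mu>0: "\<mu> \<noteq> 0" using \<mu> c m_pos by (auto simp: power_0_left)
  have u0: "u0 \<in> W0" "u0 \<noteq> 0" using \<mu> by (auto simp: W0_def)
  have sub0: "subspace W0"
    using subW by (auto simp: W0_def subspace_def lin_0[OF gD(1)] lin_add[OF gD(1)] lin_scale[OF gD(1)]
      scale_right_distrib mult.commute)
  have pres0: "preserves W0 (uo x)" if "idx x \<in> S1" for x
  proof -
    have "qcomm W (qq q x * ?zeta ^ ee x) g (uo x)" unfolding uo_def
      by (rule qcomm_comp_right[OF gD(3) qcomm_pow_right[OF gD(3)[OF x0S] lw pw] lin_w preserves_funpow[OF pw]])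
        (use that in simp)
    then have "qcomm W 1 g (uo x)" by (simp add: grade0)
    then show ?thesis using pres_uo[of x] that lin_uo
      by (auto simp: preserves_def W0_def qcomm_def lin_scale)
  qed
  have gshift: "g ((?w ^^ s) v) = (?zeta ^ s * \<mu>) \<odot> (?w ^^ s) v" if "v \<in> W0" for s v
    using qcommD[OF qcomm_pow_right[OF gD(3)[OF x0S] lw pw, of s], of v] that
    by (simp add: W0_def lin_scale[OF lwn])
  have y_scalar: "\<exists>k. \<forall>v\<in>W0. y v = k \<odot> v"
  proof -
    \<comment> \<open>The exponent 2m - 2 stands for -2. The operator y g^-2 commutes with all
      generators and with g, so it is a scalar, and on an eigenspace of g so is y.\<close>
    define n where "n = 2 * m - 2"
    define T where "T = (\<lambda>v. y ((g ^^ n) v))"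
    note gn = lin_funpow[OF gD(1), of n] preserves_funpow[OF gD(2), of n]
    have yS: "preserves W y" by (rule pres_yop) simp
    have T: "lin T" "preserves W T"
      unfolding T_def using lin_comp[OF lin_yop gn(1)] preserves_comp[OF yS gn(2)] by blast+
    have Tm: "(T ^^ m) v = ((\<Sum>k\<in>S. a (Inl k) * a (Inr k)) * c ^ n) \<odot> v" if v: "v \<in> W" for v
    proof -
      have "qcomm W (1 ^ n) (g ^^ n) y"
        by (rule qcomm_pow_left[OF qcomm_grading_yop[OF gr subset_refl] gD(1,2)])
      then have "qcomm W 1 (g ^^ n) y" by simp
      then have "(T ^^ m) v = (y ^^ m) (((g ^^ n) ^^ m) v)"
        unfolding T_def using qcomm_comp_pow[OF _ lin_yop gn(1) yS gn(2) v, of 1 m] by simp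
      also have "((g ^^ n) ^^ m) v = (c ^ n) \<odot> v"
      proof -
        have "((g ^^ m) ^^ n) v = (c ^ n) \<odot> v" for n
          by (induction n) (auto simp: c v lin_scale[OF lin_funpow[OF gD(1)]] mult.commute)
        from this[of n] show ?thesis by (simp add: funpow_mult mult.commute)
      qed
      finally show ?thesis
        using pow_y_total[OF v] by (simp add: lin_scale[OF lin_funpow[OF lin_yop]] mult.commute)
    qed
    obtain v0 where "v0 \<in> W" "v0 \<noteq> 0" using irrD(2)[OF irrW] by blast
    then obtain \<kappa> u1 where \<kappa>: "u1 \<in> W" "u1 \<noteq> 0" "T u1 = \<kappa> \<odot> u1"
      using exists_eigenvector[OF T subW _ _ Tm m_pos] by blast
    have comm: "qcomm W 1 T A" if "A \<in> w ` {x. idx x \<in> S} \<union> Gs" for A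
    proof -
      from that consider x where "A = w x" "idx x \<in> S" | "A = g" using Gs by auto
      then show ?thesis
      proof cases
        case 1
        have "qcomm W ((qq q x)\<^sup>2 * qq q x ^ n) T (w x)" unfolding T_def
          by (rule qcomm_comp_left[OF qcomm_y[OF 1(2)] qcomm_pow_left[OF gD(3)[OF 1(2)] gD(1,2)] lin_yop gn(2)])
        also have "(qq q x)\<^sup>2 * qq q x ^ n = (qq q x ^ m)\<^sup>2"
        proof -
          have "2 + n = m * 2" using m_pos by (simp add: n_def)
          then show ?thesis by (metis power_add power_mult)
        qed
        finally show ?thesis using 1 by (simp add: qq_pow)
      next
        case 2
        have "qcomm W (inverse 1 * 1 ^ n) T g" unfolding T_def
          by (rule qcomm_comp_left[OF qcomm_sym[OF qcomm_grading_yop[OF gr subset_refl]]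
              qcomm_pow_left[OF qcomm_refl gD(1,2)] lin_yop gn(2)]) simp
        then show ?thesis using 2 by simp
      qed
    qed
    have "y v = (\<kappa> / \<mu> ^ n) \<odot> v" if v: "v \<in> W0" for v
    proof -
      have vW: "v \<in> W" "g v = \<mu> \<odot> v" using v by (auto simp: W0_def)
      have "(g ^^ n) v = (\<mu> ^ n) \<odot> v" for n
        by (induction n) (auto simp: vW lin_scale[OF gD(1)] mult.commute)
      then have "(\<mu> ^ n) \<odot> y v = T v" by (simp add: T_def lin_scale[OF lin_yop])
      also have "\<dots> = \<kappa> \<odot> v"
        using normal_operator_scalar[OF irrW T _ \<kappa> vW(1)] comm by blast
      finally have "inverse (\<mu> ^ n) \<odot> (\<mu> ^ n) \<odot> y v = inverse (\<mu> ^ n) \<odot> \<kappa> \<odot> v" by simp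
      then show ?thesis using \<mu>0 by (simp add: field_simps)
    qed
    then show ?thesis by blast
  qed
  then obtain \<kappa> where \<kappa>: "\<And>v. v \<in> W0 \<Longrightarrow> y v = \<kappa> \<odot> v" by blast
  have direct: "u s = 0" if u: "\<forall>s<m. u s \<in> W0" "(\<Sum>s<m. (?w ^^ s) (u s)) = 0" and s: "s < m" for u s
  proof -
    \<comment> \<open>The translates of \<open>W0\<close> lie in eigenspaces of g for these m
      distinct eigenvalues.\<close>
    have inj: "inj_on (\<lambda>s. ?zeta ^ s * \<mu>) {..<m}"
    proof (rule linorder_inj_onI)
      fix s t :: nat assume st: "s < t" "t \<in> {..<m}"
      have "?zeta ^ t = ?zeta ^ (t - s) * ?zeta ^ s" using st by (simp flip: power_add)
      then show "?zeta ^ s * \<mu> \<noteq> ?zeta ^ t * \<mu>" using qq_prim[of "t - s" x0] st \<mu>0 by auto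
    qed auto
    have "(?w ^^ s) (u s) = 0"
      by (rule eigenvectors_independent[OF _ gD(1) inj _ u(2)]) (use u s gshift in auto)
    then have "(?w ^^ (m - s)) ((?w ^^ s) (u s)) = 0" by (simp add: lin_0[OF lwn])
    then have "(?w ^^ (m - s + s)) (u s) = 0" by (simp only: funpow_add comp_apply)
    then show ?thesis using wm[of "u s"] u s W0W x0 by auto
  qed
  have ind: "irr W0 (uo ` {x. idx x \<in> S1} \<union> {})
    \<and> (\<forall>n. has_basis_card W0 n \<longrightarrow> has_basis_card W (m * n))"
  proof (rule irr_induced[OF irrW lin_w pw sub0 W0W u0 m_pos])
    show "lin A" "preserves W0 A" if "A \<in> uo ` {x. idx x \<in> S1} \<union> {}" for A
      using that lin_uo pres0 by auto
    show "u s = 0" if "\<forall>s<m. u s \<in> W0" "(\<Sum>s<m. (?w ^^ s) (u s)) = 0" "s < m" for u s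
      by (fact direct[OF that])
    fix U A s u
    assume U: "subspace U" "U \<subseteq> W0" and st: "\<And>A. A \<in> uo ` {x. idx x \<in> S1} \<union> {} \<Longrightarrow> preserves U A"
      and A: "A \<in> w ` {x. idx x \<in> S} \<union> Gs" and s: "s < m" and u: "u \<in> U"
    note sh = subspace_shifts[OF lw U(1)]
    have base: "(?w ^^ n) v \<in> shifts m ?w U" if v: "v \<in> U" for n v
    proof (induction n rule: less_induct)
      case (less n)
      show ?case
      proof (cases "n < m")
        case True
        then show ?thesis using shifts_base[OF lw U(1) True v] by simp
      next
        case False
        have "(?w ^^ (n - m + m)) v = (?w ^^ (n - m)) (?a0 \<odot> v)"
          using v U W0W wm by (auto simp: funpow_add)
        then have "(?w ^^ n) v = ?a0 \<odot> (?w ^^ (n - m)) v"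
          using False by (simp add: lin_scale[OF lwn])
        then show ?thesis using less[of "n - m"] False m_pos subspace_scale[OF sh] by simp
      qed
    qed
    have uW: "u \<in> W" "u \<in> W0" using u U W0W by auto
    have y1u: "y1 u \<in> U"
    proof -
      have "preserves U (yop S1 uo i)" unfolding yop_def
        by (rule preserves_sum[OF U(1)], rule preserves_comp; rule st; auto)
      then have "C0 \<odot> y1 u \<in> U" using yuo[OF uW(1)] u preservesD by metis
      then have "inverse C0 \<odot> C0 \<odot> y1 u \<in> U" by (rule subspace_scale[OF U(1)])
      then show ?thesis using C0 by simp
    qed
    from A show "A ((?w ^^ s) u) \<in> shifts m ?w U"
    proof (cases rule: ops_cases)
      case (bot x)
      show ?thesis
      proof (cases "x = x0")
        case True
        then show ?thesis using base[OF u, of "Suc s"] bot by simp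
      next
        case False
        then have x: "x = star x0" using bot x0 idx_eq_cases[of x x0] by auto
        define v where "v = (?w ^^ s) u"
        have v: "v \<in> W" unfolding v_def using pwn uW by blast
        have yv: "y v = ((?zeta\<^sup>2) ^ s * \<kappa>) \<odot> (?w ^^ s) u"
          unfolding v_def
          using qcommD[OF qcomm_pow_right[OF qcomm_y[OF x0S] lw pw] uW(1)] \<kappa>[OF uW(2)]
          by (simp add: lin_scale[OF lwn])
        have y1v: "y1 v = (?w ^^ s) (y1 u)"
          unfolding v_def
          using qcommD[OF qcomm_pow_left[OF qcomm_bot_y1[OF x0(1)] lw pw, of s] uW(1)] by simp
        \<comment> \<open>The partner of \<open>w x0\<close> is recovered by inverting
          \<open>w x0\<close>: the product is a combination of y and y_{i+1}, the first of which
          acts on a translate of \<open>W0\<close> as a scalar.\<close>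
        have "\<exists>d. ?w (w x v) = d \<odot> y v - y1 v"
        proof (cases x0)
          case (Inl j)
          then show ?thesis using x0 x zz'[of v] by (intro exI[of _ 1]) simp
        next
          case (Inr j)
          then show ?thesis using x0 x z'z[OF v] by (intro exI[of _ "(inverse q)\<^sup>2"]) simp
        qed
        then obtain d where d: "?w (w x v) = d \<odot> (?w ^^ s) u - (?w ^^ s) (y1 u)"
          unfolding yv y1v by auto
        have "w x v \<in> W" using w_in v bot iS by simp
        then have "?a0 \<odot> w x v = (?w ^^ Suc (m - 1)) (w x v)" using wm m_pos by simp
        also have "\<dots> = (?w ^^ (m - 1)) (?w (w x v))" by (simp only: funpow_Suc_right comp_apply)
        also have "\<dots> = d \<odot> (?w ^^ (m - 1 + s)) u - (?w ^^ (m - 1 + s)) (y1 u)"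
          unfolding d funpow_add comp_apply by (simp add: lin_diff[OF lwn] lin_scale[OF lwn])
        finally have "?a0 \<odot> w x v \<in> shifts m ?w U"
          using subspace_diff[OF sh subspace_scale[OF sh base[OF u]] base[OF y1u]] by metis
        then have "inverse ?a0 \<odot> ?a0 \<odot> w x v \<in> shifts m ?w U" by (rule subspace_scale[OF sh])
        then show ?thesis using x0 bot by (simp add: v_def)
      qed
    next
      case (above x)
      have "uo x u \<in> U" using st above u by (auto intro: preservesD)
      have "(?w ^^ (m - ee x)) (uo x u) = (qq q x ^ (m - ee x)) \<odot> w x ((?w ^^ (m - ee x)) ((?w ^^ ee x) u))"
        unfolding uo_def using qcommD[OF wx[OF above(2)] pwn[OF uW(1)]] .
      also have "(?w ^^ (m - ee x)) ((?w ^^ ee x) u) = (?w ^^ (m - ee x + ee x)) u"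
        by (simp only: funpow_add comp_apply)
      also have "\<dots> = ?a0 \<odot> u" using ee_le wm uW by simp
      finally have e: "(?w ^^ (m - ee x)) (uo x u) = (qq q x ^ (m - ee x) * ?a0) \<odot> w x u"
        by (simp add: lin_scale[OF lin_w])
      let ?k = "qq q x ^ s * (qq q x ^ (m - ee x) * ?a0)"
      have "?k \<odot> w x ((?w ^^ s) u) = (qq q x ^ (m - ee x) * ?a0) \<odot> (?w ^^ s) (w x u)"
        using qcommD[OF wx[OF above(2)] uW(1), of s] by (simp add: mult.commute mult.left_commute)
      also have "\<dots> = (?w ^^ (s + (m - ee x))) (uo x u)"
        unfolding funpow_add comp_apply e by (simp add: lin_scale[OF lwn])
      finally have *: "?k \<odot> w x ((?w ^^ s) u) \<in> shifts m ?w U" using base[OF \<open>uo x u \<in> U\<close>] by metis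
      moreover have "?k \<noteq> 0" using x0 by simp
      ultimately show ?thesis unfolding above by (metis sh subspace_unscale)
    next
      case gr
      then show ?thesis using Gs gshift[OF uW(2)] subspace_scale[OF sh base[OF u]] by simp
    qed
  qed
  have yS1: "yop S1 w j v = yop S w j v" if "j \<in> S1" for j v
    using yop_remove[of i j] bot that by force
  have yuo': "qcomm W0 d (yop S1 uo j) (uo x)"
    if "qcomm W d (yop S w j) (w x)" "j \<in> S1" "idx x \<in> S1" for d j x
    unfolding qcomm_def
  proof
    fix v assume "v \<in> W0"
    then have v: "v \<in> W" "uo x v \<in> W" using W0W pres_uo[of x] that(3) by (auto simp: preserves_def)
    have "i < j" using bot[of j] that(2) by force
    then have "qcomm W 1 (yop S w j) ?w" using N2[of j x0] that x0 iS by simp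
    then have "qcomm W (1 ^ ee x) (yop S w j) (?w ^^ ee x)" by (rule qcomm_pow_right[OF _ lw pw])
    then have q1: "qcomm W 1 (yop S w j) (?w ^^ ee x)" by simp
    have "qcomm W (d * 1) (yop S w j) (uo x)"
      unfolding uo_def by (rule qcomm_comp_right[OF that(1) q1 lin_w preserves_funpow[OF pw]])
    then show "yop S1 uo j (uo x v) = d \<odot> uo x (yop S1 uo j v)"
      using qcommD[of W d "yop S w j" "uo x" v] v
      by (simp add: yuo yS1[OF that(2)] lin_scale[OF lin_uo] mult.commute)
  qed
  have sys: "B_system smul q m S1 W0 uo {} b"
  proof unfold_locales
    show "irr W0 (uo ` {x. idx x \<in> S1} \<union> {})" using ind by blast
    show "qcomm W0 (qq q y) (uo x) (uo y)" if "idx x \<in> S1" "idx y \<in> S1" "idx x < idx y" for x y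
      unfolding qcomm_def
    proof
      fix v assume "v \<in> W0"
      then have v: "v \<in> W" using W0W by blast
      define v' where "v' = (?w ^^ (ee x + ee y)) v"
      have "w x (w y v') = qq q y \<odot> w y (w x v')"
        using qcommD[OF R1, of x y v'] that pwn[OF v] unfolding v'_def by simp
      then show "uo x (uo y v) = qq q y \<odot> uo y (uo x v)"
        using uu[OF that(1,2) v] uu[OF that(2,1) v] swap[of y x]
        by (simp add: v'_def add.commute[of "ee y"] mult.commute)
    qed
    show "uo (Inr j) (uo (Inl j) v) = uo (Inl j) (uo (Inr j) v) - (1 - (inverse q)\<^sup>2) \<odot> yop S1 uo j v"
      if j: "j \<in> S1" "v \<in> W0" for j v
    proof -
      have v: "v \<in> W" "j \<in> S" using W0W j by auto
      show ?thesis
        by (simp add: RL[OF j(1) v(1)] LR[OF j(1) v(1)] yuo[OF v(1)] R2[OF v(2,1)] yS1[OF j(1)]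
          scale_right_diff_distrib mult.commute)
    qed
    show "qcomm W0 ((qq q x)\<^sup>2) (yop S1 uo j) (uo x)" if "j \<in> S1" "idx x \<in> S1" "j \<le> idx x" for j x
      by (rule yuo'[OF N1]) (use that in auto)
    show "qcomm W0 1 (yop S1 uo j) (uo x)" if "j \<in> S1" "idx x \<in> S1" "idx x < j" for j x
      by (rule yuo'[OF N2]) (use that in auto)
    show "(uo x ^^ m) v = b x \<odot> v" if "idx x \<in> S1" "v \<in> W0" for x v
      using pow_uo[OF that(1)] that(2) W0W by blast
    show "(yop S1 uo j ^^ m) v = casimir S1 b j \<odot> v" if j: "j \<in> S1" and v0: "v \<in> W0" for j v
    proof -
      have v: "v \<in> W" using v0 W0W by blast
      have ij: "i < j" using bot[of j] j by force
      have "(yop S1 uo j ^^ n) v = (C0 ^ n) \<odot> (yop S w j ^^ n) v" for n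
      proof (induction n)
        case (Suc n)
        have "(yop S w j ^^ n) v \<in> W"
          using preservesD[OF preserves_funpow[OF pres_yop[OF subset_refl]] v] .
        moreover have "lin (yop S1 uo j)" unfolding yop_def
          by (rule lin_sum_ops) (rule lin_comp[OF lin_uo lin_uo])
        ultimately show ?case using Suc by (simp add: lin_scale yuo yS1[OF j] mult.commute)
      qed simp
      then have "(yop S1 uo j ^^ m) v = (C0 ^ m * casimir S a j) \<odot> v"
        using pow_y[of j v] v j by simp
      also have "C0 ^ m = ?a0 ^ m"
        by (simp add: C0_def power_mult_distrib q_pow mult.commute[of eL] power_mult flip: power_mult)
          (simp add: power_mult q_pow)
      also have "?a0 ^ m = ?a0 ^ eL * ?a0 ^ eR" using eLR_sum(1) by (metis power_add)
      also have "?a0 ^ eL * ?a0 ^ eR * casimir S a j = casimir S1 b j"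
        unfolding casimir_def sum_distrib_left
        by (intro sum.cong) (use ij in \<open>auto simp: b_def eLR mult_ac\<close>)
      finally show ?thesis .
    qed
  qed (use odd_m prim lin_uo in auto)
  have "?a0 ^ eL \<noteq> 0" "?a0 ^ eR \<noteq> 0" using x0(2) by auto
  moreover have "b (Inl j) = (?a0 ^ eL) * a (Inl j)" "b (Inr j) = (?a0 ^ eR) * a (Inr j)" for j
    by (simp_all add: b_def eLR)
  moreover have "has_basis_card W (m * n)" if "has_basis_card W0 n" for n using ind that by blast
  ultimately show ?thesis by (rule that[OF sys])
qed

end

lemma base_case:
  assumes S: "S = {}" and Gs: "Gs = {} \<or> (\<exists>g. Gs = {g} \<and> grading g)"
  shows "has_basis_card W 1"
proof -
  have "\<exists>u\<in>W. u \<noteq> 0 \<and> (\<forall>g\<in>Gs. \<exists>\<mu>. g u = \<mu> \<odot> u)"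
  proof -
    obtain v0 where v0: "v0 \<in> W" "v0 \<noteq> 0" using irrD(2)[OF irrW] by blast
    show ?thesis
    proof (cases "Gs = {}")
      case False
      then obtain g where g: "Gs = {g}" "grading g" using Gs by blast
      then obtain c where "\<forall>v\<in>W. (g ^^ m) v = c \<odot> v" using gradingD(4) by blast
      then show ?thesis
        using exists_eigenvector[OF gradingD(1,2)[OF g(2)] subW v0 _ m_pos] g(1) by (metis singletonD)
    qed (use v0 in auto)
  qed
  then obtain u where u: "u \<in> W" "u \<noteq> 0" "\<And>g. g \<in> Gs \<Longrightarrow> \<exists>\<mu>. g u = \<mu> \<odot> u" by blast
  have "span {u} = W"
  proof (rule irr_full[OF irrW])
    show "span {u} \<subseteq> W" by (rule span_minimal) (use u subW in auto)
    show "u \<in> span {u}" by (rule span_base) simp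
    fix A assume "A \<in> w ` {x. idx x \<in> S} \<union> Gs"
    then have A: "A \<in> Gs" using S by simp
    then obtain \<mu> where "A u = \<mu> \<odot> u" using u by blast
    moreover have "lin A" using irrD(3)[OF irrW, of A] A by simp
    ultimately show "preserves (span {u}) A"
      by (auto simp: preserves_def span_singleton lin_scale)
  qed (use u in auto)
  then show ?thesis
    unfolding has_basis_card_def using u by (intro exI[of _ "{u}"]) (auto simp: independent_insert)
qed

end

section \<open>Induction on the number of indices\<close>

context complex_space begin

text \<open>Each factor m of the dimension is matched by 2 in the rank. The steps change the module,
  the operators, the scalars and the presence of g, so all of these vary in the induction.\<close>

lemma B_system_dim:
  assumes "B_system smul q m S W w Gs a"
    and "Gs = {} \<or> (\<exists>g. Gs = {g} \<and> B_system.grading smul q m S W w g)"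
  shows "\<exists>e. has_basis_card W (m ^ e) \<and> mrank (bmat S (Gs \<noteq> {}) a) = 2 * e"
  using assms
proof (induction "card S" arbitrary: S W w Gs a)
  case 0
  then have S: "S = {}" by simp
  interpret B_system smul q m S W w Gs a by fact
  have "mrank (bmat S (Gs \<noteq> {}) a) = 0"
  proof (rule mrank_zero)
    show "bmat S (Gs \<noteq> {}) a x y = 0" for x y by (cases x; cases y) (auto simp: S)
  qed
  then show ?case using base_case[OF S 0(3)] by (intro exI[of _ 0]) simp
next
  case (Suc n)
  then have ne: "S \<noteq> {}" by auto
  define i where "i = Min S"
  have iS: "i \<in> S" and bot: "\<And>k. k \<in> S \<Longrightarrow> i \<le> k" using ne by (auto simp: i_def)
  have card: "n = card (S - {i})" using Suc.hyps(2) iS by simp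
  note IH = Suc.hyps(1)[OF card]
  let ?Y = "\<Sum>k\<in>S. a (Inl k) * a (Inr k)"
  \<comment> \<open>Serves both the modules that come with g and those that receive g from y_i
    without any change of the index set.\<close>
  have graded: "\<exists>e. has_basis_card W (m ^ e) \<and> mrank (bmat S True a) = 2 * e"
    if sys: "B_system smul q m S W w {g} a" and gr: "B_system.grading smul q m S W w g"
      and Y: "?Y \<noteq> 0 \<or> (\<exists>x0. idx x0 = i \<and> a x0 \<noteq> 0)" for g
  proof -
    interpret B_system smul q m S W w "{g}" a by fact
    show ?thesis
    proof (cases "\<exists>x0. idx x0 = i \<and> a x0 \<noteq> 0")
      case True
      then obtain x0 where x0: "idx x0 = i" "a x0 \<noteq> 0" by blast
      obtain W0 u b d1 d2 where *: "B_system smul q m (S - {i}) W0 u {} b"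
        "d1 \<noteq> 0" "d2 \<noteq> 0" "\<And>j. b (Inl j) = d1 * a (Inl j)" "\<And>j. b (Inr j) = d2 * a (Inr j)"
        "\<And>n. has_basis_card W0 n \<Longrightarrow> has_basis_card W (m * n)"
        using torus_step[OF iS bot refl gr x0] by blast
      obtain e where e: "has_basis_card W0 (m ^ e)" "mrank (bmat (S - {i}) False b) = 2 * e"
        using IH[OF *(1)] by auto
      have "mrank (bmat S True a) = 2 * Suc e"
        using mrank_bmat_graded[where a = a, OF iS bot x0] mrank_bmat_scale[OF *(2-5)] e(2) by simp
      moreover have "has_basis_card W (m ^ Suc e)" using *(6)[OF e(1)] by simp
      ultimately show ?thesis by blast
    next
      case False
      then have a: "a (Inl i) = 0" "a (Inr i) = 0" by force+
      have Y': "?Y \<noteq> 0" using Y False by blast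
      obtain W0 where *: "B_system smul q m (S - {i}) W0 w {g} a"
        "B_system.grading smul q m (S - {i}) W0 w g"
        "\<And>n. has_basis_card W0 n \<Longrightarrow> has_basis_card W (m * n)"
        using nilpotent_step[OF iS bot Y' refl gr a] by blast
      obtain e where e: "has_basis_card W0 (m ^ e)" "mrank (bmat (S - {i}) True a) = 2 * e"
        using IH[OF *(1)] *(2) by auto
      have "mrank (bmat S True a) = 2 * Suc e"
        using mrank_bmat_nilpotent[OF iS bot a Y'] e(2) by simp
      moreover have "has_basis_card W (m ^ Suc e)" using *(3)[OF e(1)] by simp
      ultimately show ?thesis by blast
    qed
  qed
  interpret B_system smul q m S W w Gs a by fact
  show ?case
  proof (cases "?Y = 0 \<and> a (Inl i) = 0 \<and> a (Inr i) = 0")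
    case True
    have gr: "grading g" if "g \<in> Gs" for g using Suc.prems(2) that by auto
    interpret sub: B_system smul q m "S - {i}" W w Gs a
      by (rule drop_step[OF iS bot _ gr]) (use True in auto)
    have "sub.grading g" if "g \<in> Gs" for g
      using gr[OF that] unfolding sub.grading_def grading_def by auto
    then obtain e where "has_basis_card W (m ^ e)" "mrank (bmat (S - {i}) (Gs \<noteq> {}) a) = 2 * e"
      using IH[OF sub.B_system_axioms] Suc.prems(2) by auto
    then show ?thesis using mrank_bmat_drop[OF iS bot, of a] True by auto
  next
    case ndrop: False
    have ex: "\<exists>x0. idx x0 = i \<and> a x0 \<noteq> 0" if "?Y = 0"
      using ndrop that by (metis idx.simps)
    show ?thesis
    proof (cases "Gs = {}")
      case False
      then obtain g where "Gs = {g}" "grading g" using Suc.prems(2) by blast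
      then show ?thesis using graded[of g] B_system_axioms ex by auto
    next
      case Gs: True
      show ?thesis
      proof (cases "?Y = 0")
        case True
        then obtain x0 where x0: "idx x0 = i" "a x0 \<noteq> 0" using ex by blast
        obtain e where "has_basis_card W (m ^ e)" "mrank (bmat (S - {i}) True a) = 2 * e"
          using IH[OF ungraded_step(1)[OF iS bot True Gs x0]] ungraded_step(2)[OF iS bot True Gs x0] by auto
        then show ?thesis using mrank_bmat_ungraded[where a = a, OF iS bot x0 True] Gs by auto
      next
        case False
        obtain g where "B_system smul q m S W w {g} a" "B_system.grading smul q m S W w g"
          using grade_step[OF iS bot False Gs] by blast
        then show ?thesis using graded[of g] False mrank_bmat_grade[OF False] Gs by auto
      qed
    qed
  qed
qed

end

section \<open>Gaussian coefficients\<close>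

text \<open>
  Coefficients of the expansions of \<open>y\<^sub>i\<^sup>n\<close> and of \<open>z\<^sub>i\<^sup>*\<^sup>n z\<^sub>i\<^sup>n\<close> in terms of \<open>z\<^sub>i\<^sup>s y\<^bsub>i+1\<^esub>\<^bsup>n-s\<^esup> z\<^sub>i\<^sup>*\<^sup>s\<close>, where \<open>p = q\<^sup>-\<^sup>2\<close>.
\<close>

fun ycoeff :: "complex \<Rightarrow> nat \<Rightarrow> nat \<Rightarrow> complex" where
  "ycoeff p 0 s = (if s = 0 then 1 else 0)"
| "ycoeff p (Suc n) s = p ^ s * ycoeff p n s + (if s = 0 then 0 else p ^ (s - 1) * ycoeff p n (s - 1))"

fun zcoeff :: "complex \<Rightarrow> nat \<Rightarrow> nat \<Rightarrow> complex" where
  "zcoeff p 0 s = (if s = 0 then 1 else 0)"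
| "zcoeff p (Suc n) s =
     p ^ Suc n * (p ^ s * zcoeff p n s + (if s = 0 then 0 else p ^ (s - 1) * zcoeff p n (s - 1)))
     - zcoeff p n s"

lemma ycoeff_0 [simp]: "ycoeff p n 0 = 1"
  by (induction n) auto

lemma ycoeff_above: "n < s \<Longrightarrow> ycoeff p n s = 0"
  by (induction n arbitrary: s) auto

lemma zcoeff_above: "n < s \<Longrightarrow> zcoeff p n s = 0"
  by (induction n arbitrary: s) auto

lemma ycoeff_diag: "ycoeff p n n = p ^ (n * (n - 1) div 2)"
proof (induction n)
  case (Suc n)
  have "Suc n * (Suc n - 1) div 2 = n + n * (n - 1) div 2" by (cases n) auto
  then show ?case by (simp add: Suc ycoeff_above power_add)
qed simp

text \<open>\<open>ycoeff p n s\<close> is p^(s(s-1)/2) times a Gaussian binomial coefficient. These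
  are its two absorption identities, written without division so that they survive at roots of
  unity. The induction steps need each other.\<close>

lemma ycoeff_identities:
  "ycoeff p (Suc n) (Suc s) * (p ^ Suc s - 1) = p ^ s * (p ^ Suc n - 1) * ycoeff p n s \<and>
   (p ^ Suc n - p ^ s) * ycoeff p (Suc n) s = p ^ s * (p ^ Suc n - 1) * ycoeff p n s"
proof (induction n arbitrary: s)
  case 0
  show ?case by (cases s) (auto simp: algebra_simps)
next
  case (Suc n)
  have 1: "ycoeff p (Suc (Suc n)) (Suc s) * (p ^ Suc s - 1)
      = p ^ s * (p ^ Suc (Suc n) - 1) * ycoeff p (Suc n) s" for s
  proof -
    have "ycoeff p (Suc (Suc n)) (Suc s) * (p ^ Suc s - 1)
        = p ^ Suc s * (ycoeff p (Suc n) (Suc s) * (p ^ Suc s - 1))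
          + p ^ s * (p ^ Suc s - 1) * ycoeff p (Suc n) s"
      unfolding ycoeff.simps(2)[of p "Suc n" "Suc s"] by (simp only: if_False nat.distinct diff_Suc_1 ring_distribs mult_ac)
    also have "\<dots> = p ^ Suc s * ((p ^ Suc n - p ^ s) * ycoeff p (Suc n) s)
          + p ^ s * (p ^ Suc s - 1) * ycoeff p (Suc n) s"
      using Suc by simp
    also have "\<dots> = p ^ s * (p ^ Suc (Suc n) - 1) * ycoeff p (Suc n) s"
      by (simp del: ycoeff.simps add: algebra_simps)
    finally show ?thesis .
  qed
  have 2: "(p ^ Suc (Suc n) - p ^ s) * ycoeff p (Suc (Suc n)) s
      = p ^ s * (p ^ Suc (Suc n) - 1) * ycoeff p (Suc n) s"
  proof (cases s)
    case (Suc t)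
    have "(p ^ Suc (Suc n) - p ^ Suc t) * ycoeff p (Suc (Suc n)) (Suc t)
        = (p ^ Suc (Suc n) - 1) * ycoeff p (Suc (Suc n)) (Suc t)
          - ycoeff p (Suc (Suc n)) (Suc t) * (p ^ Suc t - 1)"
      by (simp only: ring_distribs mult_ac) simp
    also have "\<dots> = (p ^ Suc (Suc n) - 1)
        * (ycoeff p (Suc (Suc n)) (Suc t) - p ^ t * ycoeff p (Suc n) t)"
      unfolding 1 by (simp only: ring_distribs mult_ac)
    also have "ycoeff p (Suc (Suc n)) (Suc t) - p ^ t * ycoeff p (Suc n) t
        = p ^ Suc t * ycoeff p (Suc n) (Suc t)"
      by (subst ycoeff.simps(2)) (simp del: ycoeff.simps)
    finally show ?thesis unfolding Suc by (simp only: mult_ac)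
  qed (simp del: ycoeff.simps)
  show ?case using 1 2 by blast
qed

text \<open>At p^m = 1 the first absorption identity says that the coefficient times p^s - 1 is
  0.\<close>

lemma ycoeff_root_of_unity:
  assumes "p ^ m = 1" "0 < s" "s < m" "\<And>k. 0 < k \<Longrightarrow> k < m \<Longrightarrow> p ^ k \<noteq> 1"
  shows "ycoeff p m s = 0"
proof -
  obtain n t where "m = Suc n" "s = Suc t" using assms by (metis gr0_implies_Suc less_trans)
  then have "ycoeff p m s * (p ^ s - 1) = 0"
    using ycoeff_identities[of p n t] assms(1) by simp
  then show ?thesis using assms by simp
qed

text \<open>For s < n the product contains the factor p^n - 1. With n = m it is this factor that is
  divided by q^m - 1 in the Poisson bracket.\<close>

lemma zcoeff_closed:
  "s \<le> n \<Longrightarrow> zcoeff p n s = p ^ (s * (s + 1) div 2) * ycoeff p n s * (\<Prod>k\<in>{s<..n}. p ^ k - 1)"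
proof (induction n arbitrary: s)
  case 0
  then show ?case by simp
next
  case (Suc n)
  show ?case
  proof (cases s)
    case 0
    have "{0<..Suc n} = insert (Suc n) {0<..n}" by auto
    then show ?thesis using Suc.IH[of 0] by (simp add: 0 algebra_simps del: ycoeff.simps)
  next
    case s: (Suc t)
    have T: "s * (s + 1) div 2 = Suc t + t * (t + 1) div 2" by (simp add: s)
    define T0 where "T0 = p ^ (t * (t + 1) div 2)"
    show ?thesis
    proof (cases "s \<le> n")
      case True
      define D where "D = (\<Prod>k\<in>{s<..n}. p ^ k - 1)"
      define c0 c1 where "c0 = ycoeff p n t" and "c1 = ycoeff p n s"
      define u P r where "u = p ^ s" and "P = p ^ Suc n" and "r = p ^ t"
      have "{s<..Suc n} = insert (Suc n) {s<..n}" "{t<..n} = insert s {s<..n}" using True s by auto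
      then have D: "(\<Prod>k\<in>{s<..Suc n}. p ^ k - 1) = (P - 1) * D" "(\<Prod>k\<in>{t<..n}. p ^ k - 1) = (u - 1) * D"
        unfolding D_def P_def u_def by (simp_all del: power_Suc)
      have IH1: "zcoeff p n s = u * T0 * c1 * D"
        unfolding u_def T0_def c1_def D_def using Suc.IH[OF True] unfolding T power_add s[symmetric] .
      have "t \<le> n" using True s by simp
      then have IH2: "zcoeff p n t = T0 * c0 * ((u - 1) * D)"
        using Suc.IH[of t] unfolding D T0_def c0_def by blast
      note IH = IH1 IH2
      have rec: "ycoeff p (Suc n) s = u * c1 + r * c0"
        by (simp add: s c0_def c1_def u_def r_def)
      have I: "(u * c1 + r * c0) * (u - 1) = r * (P - 1) * c0"
        using conjunct1[OF ycoeff_identities[of p n t]] rec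
        by (simp only: s[symmetric] u_def r_def P_def c0_def)
      have "zcoeff p (Suc n) s = P * (u * (u * T0 * c1 * D) + r * (T0 * c0 * ((u - 1) * D))) - u * T0 * c1 * D"
        unfolding zcoeff.simps(2) IH using s by (simp add: P_def u_def r_def IH)
      also have "\<dots> = u * T0 * (u * c1 + r * c0) * ((P - 1) * D)
          + T0 * D * ((u * c1 + r * c0) * (u - 1) - r * (P - 1) * c0)"
        by (simp only: ring_distribs mult_ac) simp
      also have "\<dots> = u * T0 * (u * c1 + r * c0) * ((P - 1) * D)" using I by simp
      finally have fin: "zcoeff p (Suc n) s = u * T0 * (u * c1 + r * c0) * ((P - 1) * D)" .
      have "p ^ (s * (s + 1) div 2) = u * T0"
        unfolding T power_add s[symmetric] T0_def u_def ..
      then show ?thesis unfolding fin rec D by (simp only:)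
    next
      case False
      then have sn: "s = Suc n" "t = n" using Suc.prems s by auto
      have "zcoeff p (Suc n) s = p ^ Suc n * (p ^ n * zcoeff p n n)"
        by (simp add: sn zcoeff_above)
      also have "\<dots> = p ^ Suc n * (p ^ n * (T0 * ycoeff p n n))"
        using Suc.IH[of n] by (simp add: T0_def sn)
      also have "\<dots> = p ^ (s * (s + 1) div 2) * ycoeff p (Suc n) s"
        unfolding T by (simp add: sn T0_def power_add ycoeff_above mult_ac)
      finally show ?thesis by (simp add: sn)
    qed
  qed
qed

lemma zcoeff_diag: "zcoeff p n n = p ^ (n * n)"
proof -
  have "n * (n + 1) div 2 + n * (n - 1) div 2 = n * n"
  proof -
    have "even (n * (n + 1))" "even (n * (n - 1))" by auto
    moreover have "n * (n + 1) + n * (n - 1) = 2 * (n * n)" by (cases n) (auto simp: algebra_simps)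
    ultimately show ?thesis by (metis div_plus_div_distrib_dvd_left nonzero_mult_div_cancel_left zero_neq_numeral)
  qed
  then show ?thesis by (simp add: zcoeff_closed ycoeff_diag flip: power_add)
qed

lemma continuous_on_ycoeff [continuous_intros]:
  "continuous_on A f \<Longrightarrow> continuous_on A (\<lambda>q. ycoeff (f q) n s)"
proof (induction n arbitrary: s)
  case (Suc n)
  then show ?case by (cases s) (auto intro!: continuous_intros)
qed simp

text \<open>The value at 1 of the two sides of \<Prod> (X - \<eta>^k) = 1 + X + ... + X^(m-1). Both
  are monic of degree m - 1 and share m - 1 roots, so their difference has too many roots for its
  degree.\<close>

lemma prod_roots_of_unity:
  fixes \<eta> :: complex
  assumes "\<eta> ^ m = 1" "m > 0" and prim: "\<And>k. 0 < k \<Longrightarrow> k < m \<Longrightarrow> \<eta> ^ k \<noteq> 1"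
  shows "(\<Prod>k\<in>{0<..<m}. 1 - \<eta> ^ k) = of_nat m"
proof -
  define A where "A = (\<Prod>k\<in>{0<..<m}. [:- (\<eta> ^ k), 1:])"
  define B where "B = (\<Sum>j<m. monom (1::complex) j)"
  have \<eta>: "\<eta> \<noteq> 0" using assms by (auto simp: power_0_left)
  have inj: "inj_on (\<lambda>k. \<eta> ^ k) {0<..<m}"
  proof (rule linorder_inj_onI)
    fix s t :: nat assume st: "s < t" "t \<in> {0<..<m}"
    have "\<eta> ^ t = \<eta> ^ (t - s) * \<eta> ^ s" using st by (simp flip: power_add)
    then show "\<eta> ^ s \<noteq> \<eta> ^ t" using prim[of "t - s"] st \<eta> by auto
  qed auto
  have "A = B"
  proof (rule ccontr)
    assume "A \<noteq> B"
    then have nz: "A - B \<noteq> 0" by simp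
    have "degree A = (\<Sum>k\<in>{0<..<m}. degree [:- (\<eta> ^ k), 1:])"
      unfolding A_def by (rule degree_prod_eq_sum_degree) auto
    then have dA: "degree A = m - 1" by simp
    have "lead_coeff A = 1" unfolding A_def by (simp add: lead_coeff_prod)
    then have cA: "coeff A (m - 1) = 1" using dA by simp
    have cB: "coeff B i = (if i < m then 1 else 0)" for i
      unfolding B_def by (simp add: coeff_sum)
    have "degree B \<le> m - 1" by (rule degree_le) (use cB in auto)
    then have d: "degree (A - B) \<le> m - 1" using dA by (intro degree_diff_le) auto
    have "coeff (A - B) (m - 1) = 0" using cA cB assms(2) by simp
    then have d': "degree (A - B) < m - 1"
      using d nz by (metis le_neq_implies_less leading_coeff_0_iff)
    have "poly (A - B) (\<eta> ^ k) = 0" if k: "k \<in> {0<..<m}" for k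
    proof -
      have "poly A (\<eta> ^ k) = 0" unfolding A_def poly_prod
        by (rule prod_zero) (use k in \<open>auto intro!: bexI[of _ k]\<close>)
      moreover have "poly B (\<eta> ^ k) = (\<Sum>j<m. (\<eta> ^ k) ^ j)"
        by (simp add: B_def poly_sum poly_monom)
      moreover have "(\<Sum>j<m. (\<eta> ^ k) ^ j) = 0"
      proof -
        have "(\<eta> ^ k) ^ m = 1" using assms(1) by (metis mult.commute power_mult power_one)
        then show ?thesis using geometric_sum[of "\<eta> ^ k" m] prim[of k] k by simp
      qed
      ultimately show ?thesis by simp
    qed
    then have "(\<lambda>k. \<eta> ^ k) ` {0<..<m} \<subseteq> {x. poly (A - B) x = 0}" by auto
    then have "card ((\<lambda>k. \<eta> ^ k) ` {0<..<m}) \<le> card {x. poly (A - B) x = 0}"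
      by (intro card_mono poly_roots_finite nz)
    also have "\<dots> \<le> degree (A - B)" by (rule card_poly_roots_bound[OF nz])
    finally show False using d' card_image[OF inj] by simp
  qed
  then have "poly A 1 = poly B 1" by simp
  then show ?thesis by (simp add: A_def B_def poly_prod poly_sum poly_monom)
qed

section \<open>Limits at a root of unity\<close>

text \<open>Makes limits along generic parameters unique. The point \<epsilon> is approached
  radially from outside the unit circle, where no number is a root of unity.\<close>

lemma generic_nontrivial:
  assumes "\<epsilon> ^ m = 1" "m > 0"
  shows "at \<epsilon> within generic \<noteq> bot"
proof -
  have "norm \<epsilon> ^ m = 1 ^ m" using assms(1) by (metis norm_one norm_power power_one)
  then have n1: "norm \<epsilon> = 1" by (rule power_eq_imp_eq_base) (use assms(2) in auto)
  define X where "X = (\<lambda>n. \<epsilon> * of_real (1 + inverse (real (Suc n))))"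
  have nX: "norm (X n) = 1 + inverse (real (Suc n))" for n
    unfolding X_def norm_mult n1 norm_of_real by simp
  have gt: "norm (X n) > 1" for n unfolding nX by simp
  have "X n \<in> generic - {\<epsilon>}" for n
  proof -
    have "X n ^ k \<noteq> 1" if "k > 0" for k
    proof
      assume "X n ^ k = 1"
      then have "norm (X n) ^ k = 1" by (metis norm_one norm_power)
      then show False using one_less_power[OF gt that, of n] by simp
    qed
    moreover have "X n \<noteq> 0" "X n \<noteq> \<epsilon>" using gt[of n] n1 by auto
    ultimately show ?thesis by (simp add: generic_def)
  qed
  moreover have "X \<longlonglongrightarrow> \<epsilon> * of_real (1 + 0)"
    unfolding X_def by (intro tendsto_intros LIMSEQ_inverse_real_of_nat)
  ultimately have "\<epsilon> islimpt generic"
    unfolding islimpt_sequential by (intro exI[of _ X]) auto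
  then show ?thesis by (simp add: trivial_limit_within)
qed

context
  fixes \<epsilon> :: complex and m :: nat
  assumes odd_m: "odd m" and prim: "primitive_root_of_unity m \<epsilon>"
begin

lemma root_facts: "m > 0" "\<epsilon> ^ m = 1" "\<epsilon> \<noteq> 0"
  using prim by (auto simp: primitive_root_of_unity_def power_0_left)

lemma tendsto_generic:
  assumes "continuous_on (- {0}) f" shows "(f \<longlongrightarrow> f \<epsilon>) (at \<epsilon> within generic)"
proof -
  have "isCont f \<epsilon>" using assms root_facts by (simp add: continuous_on_eq_continuous_at open_Compl)
  then show ?thesis unfolding isCont_def by (rule tendsto_within_subset[where S = UNIV, simplified])
qed

lemma eventually_generic: "eventually (\<lambda>q. q \<noteq> 0 \<and> q ^ m \<noteq> 1) (at \<epsilon> within generic)"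
  using root_facts by (auto simp: eventually_at_filter generic_def intro!: always_eventually)

lemma tendsto_power_quotient:
  "((\<lambda>q. ((q ^ m) ^ n - 1) / (q ^ m - 1)) \<longlongrightarrow> of_nat n) (at \<epsilon> within generic)"
proof -
  have "continuous_on (- {0}) (\<lambda>q :: complex. \<Sum>j<n. (q ^ m) ^ j)" by (intro continuous_intros)
  from tendsto_generic[OF this]
  have "((\<lambda>q. \<Sum>j<n. (q ^ m) ^ j) \<longlongrightarrow> of_nat n) (at \<epsilon> within generic)"
    using root_facts by simp
  then show ?thesis
    by (rule Lim_transform_eventually)
      (rule eventually_mono[OF eventually_generic], simp add: geometric_sum)
qed

lemma limit_commutator_q:
  "((\<lambda>q. (1 - q ^ (m * m)) / (of_nat m * (q ^ m - 1))) \<longlongrightarrow> - 1) (at \<epsilon> within generic)"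
proof -
  have "((\<lambda>q. - (((q ^ m) ^ m - 1) / (q ^ m - 1)) / of_nat m) \<longlongrightarrow> - of_nat m / of_nat m) (at \<epsilon> within generic)"
    using root_facts by (intro tendsto_intros tendsto_power_quotient) simp
  moreover have "- (((q ^ m) ^ m - 1) / (q ^ m - 1)) / of_nat m = (1 - q ^ (m * m)) / (of_nat m * (q ^ m - 1))"
    for q :: complex
    by (simp add: power_mult minus_divide_left mult.commute)
  ultimately show ?thesis using root_facts by simp
qed

lemma limit_inverse_power:
  "((\<lambda>q. (1 - inverse q ^ (m * n)) / (of_nat m * (q ^ m - 1))) \<longlongrightarrow> of_nat n / of_nat m) (at \<epsilon> within generic)"
proof -
  have "continuous_on (- {0}) (\<lambda>q :: complex. inverse q ^ (m * n))" by (intro continuous_intros) auto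
  from tendsto_generic[OF this]
  have 1: "((\<lambda>q. inverse q ^ (m * n)) \<longlongrightarrow> 1) (at \<epsilon> within generic)"
    using root_facts by (simp add: power_mult power_inverse)
  have "((\<lambda>q. inverse q ^ (m * n) * (((q ^ m) ^ n - 1) / (q ^ m - 1)) / of_nat m)
      \<longlongrightarrow> 1 * of_nat n / of_nat m) (at \<epsilon> within generic)"
    using root_facts by (intro tendsto_intros tendsto_power_quotient 1) simp
  then have "((\<lambda>q. inverse q ^ (m * n) * (((q ^ m) ^ n - 1) / (q ^ m - 1)) / of_nat m)
      \<longlongrightarrow> of_nat n / of_nat m) (at \<epsilon> within generic)" by simp
  then show ?thesis
  proof (rule Lim_transform_eventually)
    show "\<forall>\<^sub>F q in at \<epsilon> within generic. inverse q ^ (m * n) * (((q ^ m) ^ n - 1) / (q ^ m - 1)) / of_nat m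
        = (1 - inverse q ^ (m * n)) / (of_nat m * (q ^ m - 1))"
    proof (rule eventually_mono[OF eventually_generic])
      fix q :: complex assume "q \<noteq> 0 \<and> q ^ m \<noteq> 1"
      then have "inverse q ^ (m * n) * ((q ^ m) ^ n - 1) = 1 - inverse q ^ (m * n)"
        by (simp add: power_mult power_inverse field_simps)
      then show "inverse q ^ (m * n) * (((q ^ m) ^ n - 1) / (q ^ m - 1)) / of_nat m
        = (1 - inverse q ^ (m * n)) / (of_nat m * (q ^ m - 1))"
        by (simp add: times_divide_eq_right mult.commute)
    qed
  qed
qed

lemma eta_facts:
  "((inverse \<epsilon>)\<^sup>2) ^ m = 1" "\<And>k. 0 < k \<Longrightarrow> k < m \<Longrightarrow> ((inverse \<epsilon>)\<^sup>2) ^ k \<noteq> 1"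
proof -
  show "((inverse \<epsilon>)\<^sup>2) ^ m = 1"
    using root_facts by (metis inverse_1 power_inverse power_mult mult.commute power_one)
  fix k assume k: "0 < k" "k < m"
  have "\<epsilon> ^ (2 * k) \<noteq> 1"
  proof (cases "2 * k < m")
    case True
    then show ?thesis using prim k by (simp add: primitive_root_of_unity_def)
  next
    case False
    have "2 * k \<noteq> m" using odd_m by auto
    then have r: "0 < 2 * k - m" "2 * k - m < m" "2 * k = m + (2 * k - m)" using False k by auto
    then have "\<epsilon> ^ (2 * k) = \<epsilon> ^ (2 * k - m)" using root_facts by (metis mult_1 power_add)
    then show ?thesis using prim r by (simp add: primitive_root_of_unity_def)
  qed
  then show "((inverse \<epsilon>)\<^sup>2) ^ k \<noteq> 1" by (simp add: power_inverse flip: power_mult)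
qed

text \<open>For s < m the factor 1 - p^m contributes 2/m. At s = 0 it is multiplied by the product
  of all p^k - 1, which is m because m is odd; for 0 < s < m the Gaussian coefficient kills it. At s
  = m the coefficient is p^(m^2), whose limit is 2m/m.\<close>

lemma limit_zcoeff:
  assumes s: "s \<le> m"
  shows "((\<lambda>q. ((if s = m then 1 else 0) - zcoeff ((inverse q)\<^sup>2) m s) / (of_nat m * (q ^ m - 1)))
    \<longlongrightarrow> (if s = 0 \<or> s = m then 2 else 0)) (at \<epsilon> within generic)"
proof (cases "s = m")
  case True
  have e: "1 - zcoeff ((inverse q)\<^sup>2) m m = 1 - inverse q ^ (m * (2 * m))" for q :: complex
    by (simp add: zcoeff_diag power_mult[symmetric] mult_ac)
  have "complex_of_nat (2 * m) / of_nat m = 2" using root_facts by simp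
  then show ?thesis using limit_inverse_power[of "2 * m"] True e by simp
next
  case False
  then have sm: "s < m" using s by simp
  let ?p = "\<lambda>q::complex. (inverse q)\<^sup>2"
  define h where "h = (\<lambda>q. ?p q ^ (s * (s + 1) div 2) * ycoeff (?p q) m s * (\<Prod>k\<in>{s<..<m}. ?p q ^ k - 1))"
  have "continuous_on (- {0}) h" unfolding h_def by (intro continuous_intros) auto
  then have h: "(h \<longlongrightarrow> h \<epsilon>) (at \<epsilon> within generic)" by (rule tendsto_generic)
  have "((\<lambda>q. h q * ((1 - inverse q ^ (m * 2)) / (of_nat m * (q ^ m - 1)))) \<longlongrightarrow> h \<epsilon> * (of_nat 2 / of_nat m))
      (at \<epsilon> within generic)"
    by (intro tendsto_intros h limit_inverse_power)
  moreover have "h \<epsilon> * (of_nat 2 / of_nat m) = (if s = 0 \<or> s = m then 2 else 0)"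
  proof (cases "s = 0")
    case True
    have P: "(\<Prod>k\<in>{0<..<m}. 1 - ?p \<epsilon> ^ k) = of_nat m"
      by (rule prod_roots_of_unity) (use eta_facts root_facts in auto)
    have "(\<Prod>k\<in>{0<..<m}. ?p \<epsilon> ^ k - 1) = (\<Prod>k\<in>{0<..<m}. - 1 * (1 - ?p \<epsilon> ^ k))" by simp
    also have "\<dots> = (- 1) ^ (m - 1) * of_nat m"
      unfolding prod.distrib P by simp
    finally show ?thesis using True odd_m root_facts by (simp add: h_def)
  next
    case s0: False
    have "ycoeff (?p \<epsilon>) m s = 0"
      using ycoeff_root_of_unity[OF eta_facts(1) _ sm eta_facts(2)] s0 by simp
    then show ?thesis using s0 False by (simp add: h_def)
  qed
  moreover have "h q * ((1 - inverse q ^ (m * 2)) / (of_nat m * (q ^ m - 1)))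
      = ((if s = m then 1 else 0) - zcoeff (?p q) m s) / (of_nat m * (q ^ m - 1))" for q
  proof -
    have "{s<..m} = insert m {s<..<m}" using sm by auto
    then have "zcoeff (?p q) m s = h q * (?p q ^ m - 1)"
      using zcoeff_closed[of s m "?p q"] sm by (simp add: h_def mult_ac)
    also have "?p q ^ m = inverse q ^ (m * 2)" by (simp add: power_mult[symmetric] mult_ac)
    finally have z: "zcoeff (?p q) m s = h q * (inverse q ^ (m * 2) - 1)" .
    have "0 - h q * (inverse q ^ (m * 2) - 1) = h q * (1 - inverse q ^ (m * 2))"
      by (simp add: algebra_simps)
    then show ?thesis unfolding z using False by (simp only: if_False times_divide_eq_right)
  qed
  ultimately show ?thesis by (simp only:)
qed

end

section \<open>The algebra \<open>B\<^sub>q(N)\<close> as a ring\<close>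

lemma poly_mapping_sum_single:
  fixes f :: "'a \<Rightarrow>\<^sub>0 'b::comm_monoid_add"
  shows "f = (\<Sum>k\<in>Poly_Mapping.keys f. Poly_Mapping.single k (Poly_Mapping.lookup f k))"
  by (rule poly_mapping_eqI)
    (auto simp: lookup_sum lookup_single when_def in_keys_iff cong: if_cong)

lemma poly_mapping_single_induct:
  fixes f :: "'a \<Rightarrow>\<^sub>0 'b::comm_monoid_add"
  assumes "P 0" "\<And>k c. P (Poly_Mapping.single k c)" "\<And>f g. P f \<Longrightarrow> P g \<Longrightarrow> P (f + g)"
  shows "P f"
proof -
  have "P (\<Sum>k\<in>A. Poly_Mapping.single k (Poly_Mapping.lookup f k))" for A
    by (induction A rule: infinite_finite_induct) (use assms in auto)
  then show ?thesis using poly_mapping_sum_single[of f] by metis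
qed

lemma scalar_0 [simp]: "scalar 0 = 0"
  and scalar_1 [simp]: "scalar 1 = 1"
  and scalar_add: "scalar (c + d) = scalar c + scalar d"
  and scalar_minus: "scalar (- c) = - scalar c"
  and scalar_diff: "scalar (c - d) = scalar c - scalar d"
  and scalar_mult: "scalar (c * d) = scalar c * scalar d"
  by (simp_all add: scalar_def single_add single_uminus single_diff mult_single)

lemma scalar_commute: "f * scalar c = scalar c * f"
  by (induction f rule: poly_mapping_single_induct)
    (simp_all add: scalar_def mult_single mult.commute distrib_left distrib_right)

lemma B_ideal_mult_left: "f \<in> B_ideal q \<Longrightarrow> h * f \<in> B_ideal q"
proof (induction rule: B_ideal.induct)
  case (gen r f g)
  then show ?case using B_ideal.gen[of r q "h * f" g] by (simp add: mult.assoc)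
qed (auto intro: B_ideal.intros simp: distrib_left)

lemma B_ideal_mult_right: "f \<in> B_ideal q \<Longrightarrow> f * h \<in> B_ideal q"
proof (induction rule: B_ideal.induct)
  case (gen r f g)
  then show ?case using B_ideal.gen[of r q f "g * h"] by (simp add: mult.assoc)
qed (auto intro: B_ideal.intros simp: distrib_right)

lemma B_ideal_minus: "f \<in> B_ideal q \<Longrightarrow> - f \<in> B_ideal q"
  using B_ideal_mult_left[of f q "- 1"] by simp

lemma B_ideal_relation: "r \<in> B_relations q \<Longrightarrow> r \<in> B_ideal q"
  using B_ideal.gen[of r q 1 1] by simp

lemma eq_in_B_refl [simp]: "eq_in_B q f f"
  by (simp add: eq_in_B_def B_ideal.zero)

lemma eq_in_B_sym: "eq_in_B q f g \<Longrightarrow> eq_in_B q g f"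
  unfolding eq_in_B_def using B_ideal_minus by fastforce

lemma eq_in_B_trans: "eq_in_B q f g \<Longrightarrow> eq_in_B q g h \<Longrightarrow> eq_in_B q f h"
  unfolding eq_in_B_def using B_ideal.add[of "f - g" q "g - h"] by simp

lemma eq_in_B_add: "eq_in_B q f f' \<Longrightarrow> eq_in_B q g g' \<Longrightarrow> eq_in_B q (f + g) (f' + g')"
  unfolding eq_in_B_def using B_ideal.add[of "f - f'" q "g - g'"] by (simp add: algebra_simps)

lemma eq_in_B_minus: "eq_in_B q f f' \<Longrightarrow> eq_in_B q (- f) (- f')"
  unfolding eq_in_B_def using B_ideal_minus[of "f - f'"] by simp

lemma eq_in_B_mult:
  assumes "eq_in_B q f f'" "eq_in_B q g g'"
  shows "eq_in_B q (f * g) (f' * g')"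
proof -
  have "f * g - f' * g' = (f - f') * g + f' * (g - g')" by (simp add: algebra_simps)
  then show ?thesis using assms unfolding eq_in_B_def
    by (simp add: B_ideal.add B_ideal_mult_left B_ideal_mult_right)
qed

lifting_forget poly_mapping.lifting

text \<open>
  The algebras \<open>B\<^sub>q(N)\<close> for all \<open>q \<noteq> 0\<close> at once: functions of \<open>q\<close>, modulo pointwise equality in
  \<open>B\<^sub>q(N)\<close>. An identity in this ring is an identity in every \<open>B\<^sub>q(N)\<close>.
\<close>

quotient_type (overloaded) 'n balg = "complex \<Rightarrow> ('n::{finite,linorder}) free_alg"
  / "\<lambda>f g. \<forall>q. q \<noteq> 0 \<longrightarrow> eq_in_B q (f q) (g q)"
  by (rule equivpI; unfold reflp_def symp_def transp_def)
    (auto intro: eq_in_B_sym eq_in_B_trans)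

instantiation balg :: ("{finite,linorder}") "{ring, monoid_mult}"
begin

lift_definition zero_balg :: "'a balg" is "\<lambda>_. 0" .
lift_definition one_balg :: "'a balg" is "\<lambda>_. 1" .
lift_definition plus_balg :: "'a balg \<Rightarrow> 'a balg \<Rightarrow> 'a balg" is "\<lambda>f g q. f q + g q"
  by (simp add: eq_in_B_add)
lift_definition times_balg :: "'a balg \<Rightarrow> 'a balg \<Rightarrow> 'a balg" is "\<lambda>f g q. f q * g q"
  by (simp add: eq_in_B_mult)
lift_definition uminus_balg :: "'a balg \<Rightarrow> 'a balg" is "\<lambda>f q. - f q"
  by (simp add: eq_in_B_minus)
lift_definition minus_balg :: "'a balg \<Rightarrow> 'a balg \<Rightarrow> 'a balg" is "\<lambda>f g q. f q - g q"
  using eq_in_B_add eq_in_B_minus by fastforce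

instance
proof
  fix a b c :: "'a balg"
  show "a + b + c = a + (b + c)" by transfer (simp add: add.assoc)
  show "a + b = b + a" by transfer (simp add: add.commute)
  show "0 + a = a" by transfer simp
  show "- a + a = 0" by transfer simp
  show "a - b = a + - b" by transfer simp
  show "a * b * c = a * (b * c)" by transfer (simp add: mult.assoc)
  show "1 * a = a" by transfer simp
  show "a * 1 = a" by transfer simp
  show "(a + b) * c = a * c + b * c" by transfer (simp add: distrib_right)
  show "a * (b + c) = a * b + a * c" by transfer (simp add: distrib_left)
qed

end

lift_definition sc :: "(complex \<Rightarrow> complex) \<Rightarrow> ('n::{finite,linorder}) balg" is "\<lambda>h q. scalar (h q)" .
lift_definition zb :: "'n gen \<Rightarrow> ('n::{finite,linorder}) balg" is "\<lambda>x q. gvar x" .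
lift_definition cls :: "(complex \<Rightarrow> 'n free_alg) \<Rightarrow> ('n::{finite,linorder}) balg" is "\<lambda>f. f" .

lemma cls_eqD: "cls f = cls g \<Longrightarrow> q \<noteq> 0 \<Longrightarrow> eq_in_B q (f q) (g q)"
  by transfer simp

lemma cls_eqI: "(\<And>q. q \<noteq> 0 \<Longrightarrow> eq_in_B q (f q) (g q)) \<Longrightarrow> cls f = cls g"
  by transfer simp

lemma cls_add: "cls (\<lambda>q. f q + g q) = cls f + cls g" by transfer simp
lemma cls_diff: "cls (\<lambda>q. f q - g q) = cls f - cls g" by transfer simp
lemma cls_mult: "cls (\<lambda>q. f q * g q) = cls f * cls g" by transfer simp
lemma cls_0: "cls (\<lambda>q. 0) = 0" by transfer simp
lemma cls_1: "cls (\<lambda>q. 1) = 1" by transfer simp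
lemma cls_gvar: "cls (\<lambda>q. gvar x) = zb x" by transfer simp
lemma cls_scalar: "cls (\<lambda>q. scalar (h q)) = sc h" by transfer simp

lemma cls_sum: "cls (\<lambda>q. \<Sum>i\<in>I. f i q) = (\<Sum>i\<in>I. cls (f i))"
  by (induction I rule: infinite_finite_induct) (simp_all add: cls_0 cls_add)

lemma cls_power: "cls (\<lambda>q. f q ^ n) = cls f ^ n"
  by (induction n) (simp_all add: cls_1 cls_mult)

lemma cls_prod_list: "cls (\<lambda>q. prod_list (map (\<lambda>i. f i q) L)) = prod_list (map (\<lambda>i. cls (f i)) L)"
  by (induction L) (simp_all add: cls_1 cls_mult)

lemmas cls_simps = cls_add cls_diff cls_mult cls_0 cls_1 cls_gvar cls_scalar cls_sum cls_power cls_prod_list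

lemma sc_cong: "(\<And>q. q \<noteq> 0 \<Longrightarrow> g q = h q) \<Longrightarrow> sc g = sc h" by transfer simp
lemma sc_0 [simp]: "sc (\<lambda>q. 0) = 0" by transfer simp
lemma sc_1 [simp]: "sc (\<lambda>q. 1) = 1" by transfer simp
lemma sc_add: "sc (\<lambda>q. g q + h q) = sc g + sc h" by transfer (simp add: scalar_add)
lemma sc_diff: "sc (\<lambda>q. g q - h q) = sc g - sc h" by transfer (simp add: scalar_diff)
lemma sc_minus: "sc (\<lambda>q. - h q) = - sc h" by transfer (simp add: scalar_minus)
lemma sc_mult: "sc (\<lambda>q. g q * h q) = sc g * sc h" by transfer (simp add: scalar_mult)
lemma sc_commute: "f * sc h = sc h * f" by transfer (simp add: scalar_commute)

lemma sc_left_commute: "f * (sc h * g) = sc h * (f * g)"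
  by (metis mult.assoc sc_commute)

lemma sc_mult_left: "sc g * (sc h * f) = sc (\<lambda>q. g q * h q) * f"
  by (simp add: sc_mult mult.assoc)

lemma power_commuting:
  fixes x y :: "'a::monoid_mult"
  assumes "x * y = y * x" shows "x ^ n * y = y * x ^ n"
  by (rule power_commuting_commutes[OF assms])

lemma sc_commute_power:
  assumes "f * g = sc h * (g * f)"
  shows "f ^ a * g ^ b = sc (\<lambda>q. h q ^ (a * b)) * (g ^ b * f ^ a)"
proof -
  have 1: "f * g ^ b = sc (\<lambda>q. h q ^ b) * (g ^ b * f)" for b
  proof (induction b)
    case (Suc b)
    have "f * g ^ Suc b = sc h * (g * (f * g ^ b))"
      using assms by (metis mult.assoc power_Suc)
    also have "\<dots> = sc h * (sc (\<lambda>q. h q ^ b) * (g * (g ^ b * f)))"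
      by (simp only: Suc sc_left_commute[of g])
    also have "\<dots> = sc (\<lambda>q. h q ^ Suc b) * (g ^ Suc b * f)"
      by (simp add: sc_mult mult.assoc)
    finally show ?case .
  qed simp
  show ?thesis
  proof (induction a)
    case (Suc a)
    have "f ^ Suc a * g ^ b = f * (f ^ a * g ^ b)" by (simp add: mult.assoc)
    also have "\<dots> = sc (\<lambda>q. h q ^ (a * b)) * (f * g ^ b * f ^ a)"
      by (simp only: Suc sc_left_commute[of f] mult.assoc)
    also have "\<dots> = sc (\<lambda>q. h q ^ (a * b)) * (sc (\<lambda>q. h q ^ b) * (g ^ b * f ^ Suc a))"
      unfolding 1 by (simp add: mult.assoc)
    also have "\<dots> = sc (\<lambda>q. h q ^ (Suc a * b)) * (g ^ b * f ^ Suc a)"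
      by (simp add: sc_mult_left power_add mult.commute)
    finally show ?case .
  qed simp
qed

text \<open>Unifies the first three defining relations. For z_i^* z_j with i < j the relation is
  given in the opposite order and is first multiplied by -q^-1.\<close>

lemma zb_commute:
  assumes "idx x < idx y"
  shows "zb x * zb y = sc (\<lambda>q. qq q y) * (zb y * zb x)"
proof -
  have "gvar x * gvar y - scalar (qq q y) * (gvar y * gvar x) \<in> B_ideal q" if "q \<noteq> 0" for q
  proof -
    note rel = B_ideal_relation[of _ q]
    show ?thesis
    proof (cases x)
      case x: (Inl i)
      show ?thesis
        by (rule rel, cases y) (use assms x in \<open>auto simp: B_relations_def\<close>)
    next
      case x: (Inr i)
      show ?thesis
      proof (cases y)
        case (Inl j)
        have "Z j * Zs i - scalar q * (Zs i * Z j) \<in> B_ideal q"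
          by (rule rel) (use assms x Inl in \<open>auto simp: B_relations_def\<close>)
        then have "scalar (- inverse q) * (Z j * Zs i - scalar q * (Zs i * Z j)) \<in> B_ideal q"
          by (rule B_ideal_mult_left)
        also have "scalar (- inverse q) * (Z j * Zs i - scalar q * (Zs i * Z j))
            = Zs i * Z j - scalar (inverse q) * (Z j * Zs i)"
          using that by (simp add: right_diff_distrib scalar_minus flip: mult.assoc scalar_mult)
        finally show ?thesis using x Inl by simp
      qed (rule rel, use assms x in \<open>auto simp: B_relations_def\<close>)
    qed
  qed
  then show ?thesis by transfer (simp add: eq_in_B_def)
qed

text \<open>Indexing by sets lets \<open>yb {i..}\<close> and \<open>yb {i<..}\<close> stand for y_i
  and y_{i+1} without reference to a successor index.\<close>

definition yb :: "('n::{finite,linorder}) set \<Rightarrow> 'n balg" where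
  "yb T = (\<Sum>k\<in>T. zb (Inl k) * zb (Inr k))"

lemma zb_oscillator:
  "zb (Inl i) * zb (Inr i) - sc (\<lambda>q. q\<^sup>2) * (zb (Inr i) * zb (Inl i)) = sc (\<lambda>q. q\<^sup>2 - 1) * yb {i<..}"
proof -
  have "cls (\<lambda>q. Z i * Zs i - scalar (q\<^sup>2) * (Zs i * Z i)) = cls (\<lambda>q. scalar (q\<^sup>2 - 1) * (\<Sum>k\<in>{i<..}. Z k * Zs k))"
  proof (rule cls_eqI)
    fix q :: complex
    have "Z i * Zs i - scalar (q\<^sup>2) * (Zs i * Z i) - scalar (q\<^sup>2 - 1) * (\<Sum>k\<in>{i<..}. Z k * Zs k) \<in> B_ideal q"
      by (rule B_ideal_relation) (unfold B_relations_def, blast)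
    then show "eq_in_B q (Z i * Zs i - scalar (q\<^sup>2) * (Zs i * Z i)) (scalar (q\<^sup>2 - 1) * (\<Sum>k\<in>{i<..}. Z k * Zs k))"
      by (simp add: eq_in_B_def)
  qed
  then show ?thesis by (simp only: cls_simps yb_def)
qed

section \<open>Commutation with y_i and Gaussian expansions\<close>

abbreviation pinv :: "complex \<Rightarrow> complex" where "pinv q \<equiv> (inverse q)\<^sup>2"

lemma yb_split: "yb {i..} = zb (Inl i) * zb (Inr i) + yb {i<..}"
proof -
  have "{i..} = insert i {i<..}" by auto
  then show ?thesis by (simp add: yb_def)
qed

lemma zz': "zb (Inl i) * zb (Inr i) = yb {i..} - yb {i<..}"
  by (simp add: yb_split)

lemma z'z: "zb (Inr i) * zb (Inl i) = sc pinv * yb {i..} - yb {i<..}"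
proof -
  have inv: "sc pinv * (sc (\<lambda>q. q\<^sup>2) * f) = f" for f :: "'a balg"
  proof -
    have "sc pinv * (sc (\<lambda>q. q\<^sup>2) * f) = sc (\<lambda>q. 1) * f"
      unfolding sc_mult_left by (rule arg_cong[where f = "\<lambda>t. t * f"], rule sc_cong)
        (simp flip: power_mult_distrib)
    then show ?thesis by simp
  qed
  have "sc (\<lambda>q. q\<^sup>2) * (zb (Inr i) * zb (Inl i)) = yb {i..} - sc (\<lambda>q. q\<^sup>2) * yb {i<..}"
    using zb_oscillator[of i] unfolding sc_diff by (simp add: zz' algebra_simps)
  then have "sc pinv * (sc (\<lambda>q. q\<^sup>2) * (zb (Inr i) * zb (Inl i)))
      = sc pinv * yb {i..} - sc pinv * (sc (\<lambda>q. q\<^sup>2) * yb {i<..})"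
    by (simp add: right_diff_distrib)
  then show ?thesis unfolding inv .
qed

lemma zb_yb_commute:
  assumes "\<And>k. k \<in> T \<Longrightarrow> idx x < k"
  shows "zb x * yb T = yb T * zb x"
  unfolding yb_def sum_distrib_left sum_distrib_right
proof (intro sum.cong refl)
  fix k assume "k \<in> T"
  then have k: "idx x < k" using assms by blast
  have 1: "zb x * zb (Inl k) = sc (\<lambda>q. inverse q) * (zb (Inl k) * zb x)"
    and 2: "zb x * zb (Inr k) = sc (\<lambda>q. q) * (zb (Inr k) * zb x)"
    using zb_commute[of x "Inl k"] zb_commute[of x "Inr k"] k by simp_all
  have "zb x * (zb (Inl k) * zb (Inr k)) = sc (\<lambda>q. inverse q) * (zb (Inl k) * (zb x * zb (Inr k)))"
    by (simp only: 1 mult.assoc[symmetric])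
  also have "\<dots> = sc (\<lambda>q. inverse q * q) * (zb (Inl k) * zb (Inr k) * zb x)"
    by (simp only: 2 sc_left_commute[of "zb (Inl k)"] sc_mult_left mult.assoc)
  also have "sc (\<lambda>q. inverse q * q) = sc (\<lambda>q. 1)" by (rule sc_cong) simp
  finally show "zb x * (zb (Inl k) * zb (Inr k)) = zb (Inl k) * zb (Inr k) * zb x" by simp
qed

text \<open>Bracketing z_i z_i^* z_i as z_i (z_i^* z_i) introduces the factor q^-2, and the terms
  with y_{i+1} cancel.\<close>

lemma yz: "yb {i..} * zb (Inl i) = sc pinv * (zb (Inl i) * yb {i..})"
proof -
  have c: "yb {i<..} * zb (Inl i) = zb (Inl i) * yb {i<..}"
    using zb_yb_commute[of "{i<..}" "Inl i"] by simp
  have "yb {i..} * zb (Inl i) = zb (Inl i) * (zb (Inr i) * zb (Inl i)) + yb {i<..} * zb (Inl i)"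
    by (simp add: yb_split distrib_right mult.assoc)
  also have "\<dots> = zb (Inl i) * (sc pinv * yb {i..})" unfolding z'z c by (simp add: right_diff_distrib)
  finally show ?thesis by (simp only: sc_left_commute)
qed

lemma z'y: "zb (Inr i) * yb {i..} = sc pinv * (yb {i..} * zb (Inr i))"
proof -
  have c: "zb (Inr i) * yb {i<..} = yb {i<..} * zb (Inr i)"
    using zb_yb_commute[of "{i<..}" "Inr i"] by simp
  have "zb (Inr i) * yb {i..} = (zb (Inr i) * zb (Inl i)) * zb (Inr i) + zb (Inr i) * yb {i<..}"
    by (simp add: yb_split distrib_left mult.assoc)
  also have "\<dots> = sc pinv * yb {i..} * zb (Inr i)" unfolding z'z c by (simp add: left_diff_distrib)
  finally show ?thesis by (simp add: mult.assoc)
qed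

context
  fixes i :: "'n::{finite,linorder}"
begin

abbreviation "z0 \<equiv> zb (Inl i)"
abbreviation "z0' \<equiv> zb (Inr i)"
abbreviation "y0 \<equiv> yb {i..}"
abbreviation "y0' \<equiv> yb {i<..}"

lemma y0'_z0: "y0' ^ k * z0 ^ s = z0 ^ s * y0' ^ k"
  and y0'_z0': "y0' ^ k * z0' ^ s = z0' ^ s * y0' ^ k"
proof -
  have "y0' * z0 = z0 * y0'" "y0' * z0' = z0' * y0'"
    using zb_yb_commute[of "{i<..}" "Inl i"] zb_yb_commute[of "{i<..}" "Inr i"] by simp_all
  then show "y0' ^ k * z0 ^ s = z0 ^ s * y0' ^ k" "y0' ^ k * z0' ^ s = z0' ^ s * y0' ^ k"
    by (metis power_commuting)+
qed

definition osc :: "nat \<Rightarrow> nat \<Rightarrow> 'n balg" where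
  "osc n s = z0 ^ s * y0' ^ (n - s) * z0' ^ s"

lemma y0'_osc: "s \<le> n \<Longrightarrow> y0' * osc n s = osc (Suc n) s"
proof -
  assume "s \<le> n"
  have "y0' * z0 ^ s = z0 ^ s * y0'" using y0'_z0[of 1 s] by simp
  then have "y0' * osc n s = z0 ^ s * y0' * (y0' ^ (n - s) * z0' ^ s)"
    by (simp only: osc_def flip: mult.assoc)
  then show ?thesis using \<open>s \<le> n\<close> by (simp add: osc_def Suc_diff_le mult.assoc)
qed

text \<open>Moving y_i past z_i^s costs p^s; behind it y_i is replaced by z_i z_i^* +
  y_{i+1}.\<close>

lemma y0_osc: assumes "s \<le> n"
  shows "y0 * osc n s = sc (\<lambda>q. pinv q ^ s) * (osc (Suc n) (Suc s) + osc (Suc n) s)"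
proof -
  let ?k = "n - s"
  have c': "y0' ^ k * z0' = z0' * y0' ^ k" for k using y0'_z0'[of k 1] by simp
  have c'': "y0' ^ k * (z0' * X) = z0' * (y0' ^ k * X)" for k X by (metis c' mult.assoc)
  have "osc (Suc n) (Suc s) = z0 ^ s * (z0 * (y0' ^ ?k * (z0' * z0' ^ s)))"
    by (simp only: osc_def power_Suc2[of z0] power_Suc[of z0'] mult.assoc diff_Suc_Suc)
  also have "\<dots> = z0 ^ s * ((z0 * z0') * y0' ^ ?k * z0' ^ s)"
    by (simp only: c'' mult.assoc)
  also have "\<dots> = z0 ^ s * (y0 * (y0' ^ ?k * z0' ^ s)) - z0 ^ s * (y0' * y0' ^ ?k * z0' ^ s)"
    by (simp only: zz' left_diff_distrib right_diff_distrib mult.assoc)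
  also have "z0 ^ s * (y0' * y0' ^ ?k * z0' ^ s) = osc (Suc n) s"
    using assms by (simp add: osc_def Suc_diff_le mult.assoc)
  finally have 1: "z0 ^ s * (y0 * (y0' ^ ?k * z0' ^ s)) = osc (Suc n) (Suc s) + osc (Suc n) s" by simp
  have "y0 * z0 ^ s = sc (\<lambda>q. pinv q ^ s) * (z0 ^ s * y0)"
    using sc_commute_power[OF yz[of i], of 1 s] by simp
  then have "y0 * (z0 ^ s * X) = sc (\<lambda>q. pinv q ^ s) * (z0 ^ s * (y0 * X))" for X
    by (simp only: mult.assoc[symmetric])
  then have "y0 * osc n s = sc (\<lambda>q. pinv q ^ s) * (z0 ^ s * (y0 * (y0' ^ ?k * z0' ^ s)))"
    by (simp only: osc_def mult.assoc)
  then show ?thesis unfolding 1 .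
qed

text \<open>On coefficient sequences, multiplication by y_i is the recursion defining
  \<open>ycoeff\<close>. The vanishing coefficient at \<open>Suc n\<close> lets both sums run up to
  \<open>Suc n\<close>.\<close>

lemma y0_osc_sum:
  assumes "\<And>q. f q (Suc n) = 0"
  shows "y0 * (\<Sum>s\<le>n. sc (\<lambda>q. f q s) * osc n s)
    = (\<Sum>s\<le>Suc n. sc (\<lambda>q. pinv q ^ s * f q s + (if s = 0 then 0 else pinv q ^ (s - 1) * f q (s - 1))) * osc (Suc n) s)"
proof -
  have "y0 * (\<Sum>s\<le>n. sc (\<lambda>q. f q s) * osc n s)
      = (\<Sum>s\<le>n. sc (\<lambda>q. pinv q ^ s * f q s) * osc (Suc n) s)
        + (\<Sum>s\<le>n. sc (\<lambda>q. pinv q ^ s * f q s) * osc (Suc n) (Suc s))"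
    unfolding sum_distrib_left sum.distrib[symmetric]
  proof (intro sum.cong refl)
    fix s assume "s \<in> {..n}"
    then have "s \<le> n" by simp
    then show "y0 * (sc (\<lambda>q. f q s) * osc n s)
        = sc (\<lambda>q. pinv q ^ s * f q s) * osc (Suc n) s + sc (\<lambda>q. pinv q ^ s * f q s) * osc (Suc n) (Suc s)"
      by (simp only: sc_left_commute[of y0] y0_osc sc_mult_left distrib_left mult.commute add.commute)
  qed
  also have "(\<Sum>s\<le>n. sc (\<lambda>q. pinv q ^ s * f q s) * osc (Suc n) s)
      = (\<Sum>s\<le>Suc n. sc (\<lambda>q. pinv q ^ s * f q s) * osc (Suc n) s)"
    by (simp add: assms)
  also have "(\<Sum>s\<le>n. sc (\<lambda>q. pinv q ^ s * f q s) * osc (Suc n) (Suc s))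
      = (\<Sum>s\<le>Suc n. sc (\<lambda>q. if s = 0 then 0 else pinv q ^ (s - 1) * f q (s - 1)) * osc (Suc n) s)"
    by (subst sum.atMost_Suc_shift) simp
  finally show ?thesis
    by (simp only: sum.distrib[symmetric] distrib_right[symmetric] sc_add[symmetric])
qed

lemma y0_power: "y0 ^ n = (\<Sum>s\<le>n. sc (\<lambda>q. ycoeff (pinv q) n s) * osc n s)"
proof (induction n)
  case 0
  then show ?case by (simp add: osc_def)
next
  case (Suc n)
  have "y0 ^ Suc n = y0 * (\<Sum>s\<le>n. sc (\<lambda>q. ycoeff (pinv q) n s) * osc n s)" by (simp add: Suc)
  also have "\<dots> = (\<Sum>s\<le>Suc n. sc (\<lambda>q. ycoeff (pinv q) (Suc n) s) * osc (Suc n) s)"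
    by (subst y0_osc_sum) (simp_all add: ycoeff_above)
  finally show ?case .
qed

text \<open>The innermost pair z_i^* z_i is replaced by p y_i - y_{i+1}. Moving y_i out past n
  factors z_i^* costs a further p^n, which gives the p^(n+1) in \<open>zcoeff\<close>.\<close>

lemma z0'_z0_power: "z0' ^ n * z0 ^ n = (\<Sum>s\<le>n. sc (\<lambda>q. zcoeff (pinv q) n s) * osc n s)"
proof (induction n)
  case 0
  then show ?case by (simp add: osc_def)
next
  case (Suc n)
  let ?F = "z0' ^ n * z0 ^ n"
  have zy: "z0' ^ n * y0 = sc (\<lambda>q. pinv q ^ n) * (y0 * z0' ^ n)"
    using sc_commute_power[OF z'y[of i], of n 1] by simp
  have zy': "z0' ^ n * y0' = y0' * z0' ^ n" using y0'_z0'[of 1 n] by simp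
  have "z0' ^ Suc n * z0 ^ Suc n = z0' ^ n * ((z0' * z0) * z0 ^ n)"
    by (simp only: power_Suc2[of z0'] power_Suc[of z0] mult.assoc)
  also have "\<dots> = sc pinv * (z0' ^ n * y0 * z0 ^ n) - z0' ^ n * y0' * z0 ^ n"
    unfolding z'z left_diff_distrib right_diff_distrib by (simp only: mult.assoc sc_left_commute)
  also have "\<dots> = sc (\<lambda>q. pinv q ^ Suc n) * (y0 * ?F) - y0' * ?F"
    unfolding zy zy' by (simp add: sc_mult mult.assoc)
  also have "\<dots> = (\<Sum>s\<le>Suc n. sc (\<lambda>q. pinv q ^ Suc n * (pinv q ^ s * zcoeff (pinv q) n s
        + (if s = 0 then 0 else pinv q ^ (s - 1) * zcoeff (pinv q) n (s - 1)))) * osc (Suc n) s)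
      - (\<Sum>s\<le>Suc n. sc (\<lambda>q. zcoeff (pinv q) n s) * osc (Suc n) s)"
  proof -
    have "y0' * (\<Sum>s\<le>n. sc (\<lambda>q. zcoeff (pinv q) n s) * osc n s)
        = (\<Sum>s\<le>n. sc (\<lambda>q. zcoeff (pinv q) n s) * osc (Suc n) s)"
      unfolding sum_distrib_left by (intro sum.cong refl) (simp add: sc_left_commute y0'_osc)
    also have "\<dots> = (\<Sum>s\<le>Suc n. sc (\<lambda>q. zcoeff (pinv q) n s) * osc (Suc n) s)"
      by (simp add: zcoeff_above)
    finally have 1: "y0' * ?F = (\<Sum>s\<le>Suc n. sc (\<lambda>q. zcoeff (pinv q) n s) * osc (Suc n) s)"
      unfolding Suc .
    have 2: "sc (\<lambda>q. pinv q ^ Suc n) * (y0 * ?F)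
        = (\<Sum>s\<le>Suc n. sc (\<lambda>q. pinv q ^ Suc n * (pinv q ^ s * zcoeff (pinv q) n s
        + (if s = 0 then 0 else pinv q ^ (s - 1) * zcoeff (pinv q) n (s - 1)))) * osc (Suc n) s)"
      unfolding Suc by (subst y0_osc_sum) (simp_all only: zcoeff_above lessI sum_distrib_left sc_mult_left)
    show ?thesis unfolding 1 2 ..
  qed
  also have "\<dots> = (\<Sum>s\<le>Suc n. sc (\<lambda>q. zcoeff (pinv q) (Suc n) s) * osc (Suc n) s)"
    unfolding sum_subtractf[symmetric] left_diff_distrib[symmetric] sc_diff[symmetric] zcoeff.simps ..
  finally show ?case .
qed

lemma commutator_expansion:
  "z0 ^ n * z0' ^ n - z0' ^ n * z0 ^ n
    = (\<Sum>s\<le>n. sc (\<lambda>q. (if s = n then 1 else 0) - zcoeff (pinv q) n s) * osc n s)"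
proof -
  have "(\<Sum>s\<le>n. sc (\<lambda>q. if s = n then 1 else 0) * osc n s) = (\<Sum>s\<le>n. if s = n then osc n n else 0)"
    by (intro sum.cong refl) simp
  also have "\<dots> = z0 ^ n * z0' ^ n" by (simp add: osc_def)
  finally show ?thesis
    unfolding z0'_z0_power sc_diff left_diff_distrib sum_subtractf by simp
qed

end

section \<open>Linear independence of the ordered monomials\<close>

text \<open>
  \<open>B\<^sub>q(N)\<close> acts on a quantum torus in variables \<open>z\<^sub>i\<close>, \<open>y\<^sub>i\<close>, with \<open>z\<^sub>i\<^sup>* = z\<^sub>i\<^sup>-\<^sup>1 (y\<^sub>i - y\<^bsub>i+1\<^esub>)\<close>. A function on
  the lattice gives the coefficients of a formal sum of the monomials \<open>z\<^sub>0\<^bsup>w(Inl 0)\<^esup> \<dots> y\<^sub>0\<^bsup>w(Inr 0)\<^esup> \<dots>\<close>.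
\<close>

type_synonym 'n torus = "('n gen \<Rightarrow> int) \<Rightarrow> complex"

definition unit :: "'n gen \<Rightarrow> 'n gen \<Rightarrow> int" where
  "unit x y = (if y = x then 1 else 0)"

text \<open>\<open>lo\<close> and \<open>hi\<close> count the powers of q produced on the way to the
  normal position: a new z_i passes the z_j with j < i, a new y_i passes the z_j with i \<le>
  j.\<close>

definition lo :: "'n::{finite,linorder} \<Rightarrow> ('n gen \<Rightarrow> int) \<Rightarrow> int" where
  "lo i w = (\<Sum>j\<in>{..<i}. w (Inl j))"

definition hi :: "'n::{finite,linorder} \<Rightarrow> ('n gen \<Rightarrow> int) \<Rightarrow> int" where
  "hi i w = (\<Sum>j\<in>{i..}. w (Inl j))"

lemma lo_add [simp]: "lo i (\<lambda>x. f x + g x) = lo i f + lo i g"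
  and lo_diff [simp]: "lo i (\<lambda>x. f x - g x) = lo i f - lo i g"
  and hi_add [simp]: "hi i (\<lambda>x. f x + g x) = hi i f + hi i g"
  and hi_diff [simp]: "hi i (\<lambda>x. f x - g x) = hi i f - hi i g"
  by (simp_all add: lo_def hi_def sum.distrib sum_subtractf)

lemma lo_unit [simp]: "lo i (unit (Inl j)) = (if j < i then 1 else 0)" "lo i (unit (Inr j)) = 0"
  and hi_unit [simp]: "hi i (unit (Inl j)) = (if i \<le> j then 1 else 0)" "hi i (unit (Inr j)) = 0"
  by (simp_all add: lo_def hi_def unit_def)

definition ztor :: "complex \<Rightarrow> 'n::{finite,linorder} \<Rightarrow> 'n torus \<Rightarrow> 'n torus" where
  "ztor q i F w = q powi (lo i w) * F (\<lambda>x. w x - unit (Inl i) x)"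

definition zinv :: "complex \<Rightarrow> 'n::{finite,linorder} \<Rightarrow> 'n torus \<Rightarrow> 'n torus" where
  "zinv q i F w = q powi (- lo i w) * F (\<lambda>x. w x + unit (Inl i) x)"

definition ytor :: "complex \<Rightarrow> 'n::{finite,linorder} \<Rightarrow> 'n torus \<Rightarrow> 'n torus" where
  "ytor q i F w = q powi (- 2 * hi i w) * F (\<lambda>x. w x - unit (Inr i) x)"

definition ynext :: "complex \<Rightarrow> 'n::{finite,linorder} \<Rightarrow> 'n torus \<Rightarrow> 'n torus" where
  "ynext q i F w = (if {i<..} = {} then 0 else ytor q (Min {i<..}) F w)"

definition zstor :: "complex \<Rightarrow> 'n::{finite,linorder} \<Rightarrow> 'n torus \<Rightarrow> 'n torus" where
  "zstor q i F = zinv q i (\<lambda>w. ytor q i F w - ynext q i F w)"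

fun act :: "complex \<Rightarrow> ('n::{finite,linorder}) gen \<Rightarrow> 'n torus \<Rightarrow> 'n torus" where
  "act q (Inl i) = ztor q i"
| "act q (Inr i) = zstor q i"

definition linop :: "('n torus \<Rightarrow> 'n torus) \<Rightarrow> bool" where
  "linop T \<longleftrightarrow> (\<forall>F G. T (\<lambda>w. F w + G w) = (\<lambda>w. T F w + T G w)) \<and> (\<forall>c F. T (\<lambda>w. c * F w) = (\<lambda>w. c * T F w))"

lemma linop_torus: "linop (ztor q i)" "linop (zinv q i)" "linop (ytor q i)" "linop (ynext q i)"
  by (auto simp: linop_def ztor_def zinv_def ytor_def ynext_def fun_eq_iff algebra_simps)

lemma linop_add: "linop T \<Longrightarrow> T (\<lambda>w. F w + G w) = (\<lambda>w. T F w + T G w)"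
  and linop_scale: "linop T \<Longrightarrow> T (\<lambda>w. c * F w) = (\<lambda>w. c * T F w)"
  by (auto simp: linop_def)

lemma linop_diff: "linop T \<Longrightarrow> T (\<lambda>w. F w - G w) = (\<lambda>w. T F w - T G w)"
  using linop_add[of T F "\<lambda>w. (- 1) * G w"] linop_scale[of T "- 1" G] by simp

lemma linop_zero: "linop T \<Longrightarrow> T (\<lambda>w. 0) = (\<lambda>w. 0)"
  using linop_scale[of T 0 "\<lambda>w. 0"] by simp

lemma linop_act: "linop (act q x)"
proof (cases x)
  case (Inr i)
  have "linop (zstor q i)"
    unfolding zstor_def linop_def
    by (simp add: linop_add[OF linop_torus(3)] linop_add[OF linop_torus(4)]
        linop_scale[OF linop_torus(3)] linop_scale[OF linop_torus(4)]
        linop_diff[OF linop_torus(2)] linop_add[OF linop_torus(2)] linop_scale[OF linop_torus(2)]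
        add_diff_add flip: right_diff_distrib)
  then show ?thesis using Inr by simp
qed (simp add: linop_torus)

lemma Min_above:
  fixes i :: "'n::{finite,linorder}"
  shows "{i<..} \<noteq> {} \<Longrightarrow> i < Min {i<..}"
  using Min_in[of "{i<..}"] by simp

lemma Min_above_le:
  fixes i :: "'n::{finite,linorder}"
  shows "i < j \<Longrightarrow> Min {i<..} \<le> j"
  by (rule Min_le) auto

context
  fixes q :: complex
  assumes q: "q \<noteq> 0"
begin

lemma powi_collect: "q powi a * (q powi b * c) = q powi (a + b) * c"
  using q by (simp add: power_int_add mult.assoc)

lemma torus_relations:
  "i < j \<Longrightarrow> ztor q i (ztor q j F) = (\<lambda>w. q powi (-1) * ztor q j (ztor q i F) w)"
  "i < j \<Longrightarrow> zinv q i (zinv q j F) = (\<lambda>w. q powi (-1) * zinv q j (zinv q i F) w)"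
  "i < j \<Longrightarrow> ztor q i (zinv q j F) = (\<lambda>w. q powi 1 * zinv q j (ztor q i F) w)"
  "j < i \<Longrightarrow> ztor q i (zinv q j F) = (\<lambda>w. q powi (-1) * zinv q j (ztor q i F) w)"
  "ztor q i (zinv q i F) = F"
  "zinv q i (ztor q i F) = F"
  "k \<le> i \<Longrightarrow> ytor q k (ztor q i F) = (\<lambda>w. q powi (-2) * ztor q i (ytor q k F) w)"
  "i < k \<Longrightarrow> ytor q k (ztor q i F) = ztor q i (ytor q k F)"
  "k \<le> i \<Longrightarrow> ytor q k (zinv q i F) = (\<lambda>w. q powi 2 * zinv q i (ytor q k F) w)"
  "i < k \<Longrightarrow> ytor q k (zinv q i F) = zinv q i (ytor q k F)"
  "ytor q k (ytor q l F) = ytor q l (ytor q k F)"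
  unfolding ztor_def zinv_def ytor_def powi_collect fun_eq_iff
  by (auto simp: algebra_simps powi_collect q dest: order.asym)

lemma ynext_relations:
  fixes F :: "'n::{finite,linorder} torus" and i j k :: 'n
  shows "i < j \<Longrightarrow> ynext q i (ztor q j F) = (\<lambda>w. q powi (-2) * ztor q j (ynext q i F) w)"
  "j \<le> i \<Longrightarrow> ynext q i (ztor q j F) = ztor q j (ynext q i F)"
  "i < j \<Longrightarrow> ynext q i (zinv q j F) = (\<lambda>w. q powi 2 * zinv q j (ynext q i F) w)"
  "j \<le> i \<Longrightarrow> ynext q i (zinv q j F) = zinv q j (ynext q i F)"
  "ytor q k (ynext q i F) = ynext q i (ytor q k F)"
  "ynext q k (ynext q i F) = ynext q i (ynext q k F)"
proof -
  have 0: "ynext q i F = (\<lambda>w. 0)" if "{i<..} = {}" for i :: 'n and F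
    using that by (simp add: ynext_def fun_eq_iff)
  have 1: "ynext q i F = ytor q (Min {i<..}) F" if "{i<..} \<noteq> {}" for i :: 'n and F
    unfolding ynext_def using that by (simp only: if_False)
  note lz = linop_zero[OF linop_torus(1)] linop_zero[OF linop_torus(2)] linop_zero[OF linop_torus(3)]
  show "ynext q i (ztor q j F) = (\<lambda>w. q powi (-2) * ztor q j (ynext q i F) w)"
    "ynext q i (zinv q j F) = (\<lambda>w. q powi 2 * zinv q j (ynext q i F) w)" if "i < j"
  proof -
    have ne: "{i<..} \<noteq> {}" using that by blast
    show "ynext q i (ztor q j F) = (\<lambda>w. q powi (-2) * ztor q j (ynext q i F) w)"
      "ynext q i (zinv q j F) = (\<lambda>w. q powi 2 * zinv q j (ynext q i F) w)"
      unfolding 1[OF ne] by (rule torus_relations(7,9)[OF Min_above_le[OF that]])+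
  qed
  show "ynext q i (ztor q j F) = ztor q j (ynext q i F)"
    "ynext q i (zinv q j F) = zinv q j (ynext q i F)" if "j \<le> i"
  proof -
    have "ynext q i (ztor q j F) = ztor q j (ynext q i F) \<and> ynext q i (zinv q j F) = zinv q j (ynext q i F)"
    proof (cases "{i<..} = {}")
      case False
      have "j < Min {i<..}" using Min_above[OF False] that by simp
      then show ?thesis unfolding 1[OF False] using torus_relations(8,10) by blast
    qed (simp only: 0 lz simp_thms)
    then show "ynext q i (ztor q j F) = ztor q j (ynext q i F)"
      "ynext q i (zinv q j F) = zinv q j (ynext q i F)" by blast+
  qed
  show 2: "ytor q k (ynext q i F) = ynext q i (ytor q k F)" for k i :: 'n and F
  proof (cases "{i<..} = {}")
    case False
    show ?thesis unfolding 1[OF False] by (rule torus_relations(11))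
  qed (simp only: 0 lz)
  show "ynext q k (ynext q i F) = ynext q i (ynext q k F)"
  proof (cases "{k<..} = {}")
    case True
    show ?thesis unfolding 0[OF True] by (rule linop_zero[OF linop_torus(4), symmetric])
  next
    case False
    show ?thesis unfolding 1[OF False] by (rule 2)
  qed
qed

text \<open>Since z_k z_k^* acts as y_k - y_{k+1}, the sum over k > i collapses to y_{i+1}; the term
  after the last is 0.\<close>

lemma ynext_telescope: "(\<lambda>w. \<Sum>k\<in>{i<..}. ytor q k F w - ynext q k F w) = ynext q i F"
proof (induction "card {i<..}" arbitrary: i rule: less_induct)
  case less
  show ?case
  proof (cases "{i<..} = {}")
    case False
    define j where "j = Min {i<..}"
    have j: "i < j" using Min_above False by (simp add: j_def)
    have ins: "{i<..} = insert j {j<..}"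
      using Min_above_le[of i] j unfolding j_def[symmetric] by (auto simp: le_less)
    have "card {j<..} < card {i<..}" unfolding ins by simp
    note IH = fun_cong[OF less[OF this]]
    have "ynext q i F = ytor q j F" unfolding ynext_def j_def using False by (simp only: if_False)
    then show ?thesis unfolding ins by (simp add: IH fun_eq_iff)
  qed (auto simp: ynext_def)
qed

lemma z_zs: "ztor q i (zstor q i F) = (\<lambda>w. ytor q i F w - ynext q i F w)"
  by (simp add: zstor_def torus_relations)

lemma zs_z: "zstor q i (ztor q i F) = (\<lambda>w. q powi (-2) * ytor q i F w - ynext q i F w)"
  by (simp add: zstor_def torus_relations(7) ynext_relations(2) linop_diff[OF linop_torus(2)]
    linop_scale[OF linop_torus(2)] torus_relations(6))

lemma act_zz: "i < j \<Longrightarrow> act q (Inl i) (act q (Inl j) F) = (\<lambda>w. inverse q * act q (Inl j) (act q (Inl i) F) w)"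
  using torus_relations(1)[of i j F] by (simp add: power_int_minus)

lemma act_zzs:
  assumes "i \<noteq> j"
  shows "act q (Inl i) (act q (Inr j) F) = (\<lambda>w. q * act q (Inr j) (act q (Inl i) F) w)"
proof (cases "i < j")
  case True
  have c: "ytor q j (ztor q i F) = ztor q i (ytor q j F)" "ynext q j (ztor q i F) = ztor q i (ynext q j F)"
    using torus_relations(8)[OF True] ynext_relations(2)[of i j] True by auto
  show ?thesis using torus_relations(3)[OF True]
    by (simp add: zstor_def c flip: linop_diff[OF linop_torus(1)])
next
  case False
  then have ji: "j < i" using assms by simp
  have c: "ytor q j (ztor q i F) = (\<lambda>w. q powi (-2) * ztor q i (ytor q j F) w)"
    "ynext q j (ztor q i F) = (\<lambda>w. q powi (-2) * ztor q i (ynext q j F) w)"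
    using torus_relations(7)[of j i] ynext_relations(1)[OF ji] ji by auto
  have "act q (Inr j) (act q (Inl i) F)
      = zinv q j (\<lambda>w. q powi (-2) * ztor q i (\<lambda>w. ytor q j F w - ynext q j F w) w)"
    by (simp add: zstor_def c linop_diff[OF linop_torus(1)] right_diff_distrib)
  also have "\<dots> = (\<lambda>w. q powi (-2) * zinv q j (ztor q i (\<lambda>w. ytor q j F w - ynext q j F w)) w)"
    by (rule linop_scale[OF linop_torus(2)])
  finally have fin: "act q (Inr j) (act q (Inl i) F)
      = (\<lambda>w. q powi (-2) * zinv q j (ztor q i (\<lambda>w. ytor q j F w - ynext q j F w)) w)" .
  have e: "q * (q powi (-2) * c) = q powi (-1) * c" for c using powi_collect[of 1 "-2" c] by simp
  show ?thesis unfolding fin e using torus_relations(4)[OF ji] by (simp only: act.simps zstor_def)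
qed

lemma act_zszs:
  fixes i j :: "'n::{finite,linorder}"
  assumes ij: "i < j"
  shows "act q (Inr i) (act q (Inr j) F) = (\<lambda>w. q * act q (Inr j) (act q (Inr i) F) w)"
proof -
  \<comment> \<open>With z_k^* = z_k^-1 Y_k the factor q splits into q^2, from moving Y_i past
    z_j^-1, and q^-1, from exchanging the two inverses.\<close>
  define Y where "Y = (\<lambda>(k::'n) F w. ytor q k F w - ynext q k F w)"
  have Yi: "Y i (zinv q j F) = (\<lambda>w. q powi 2 * zinv q j (Y i F) w)" for F
    using torus_relations(9)[of i j F] ynext_relations(3)[OF ij, of F] ij
    by (simp add: Y_def linop_diff[OF linop_torus(2)] right_diff_distrib)
  have Yj: "Y j (zinv q i F) = zinv q i (Y j F)" for F
    using torus_relations(10)[OF ij, of F] ynext_relations(4)[of i j F] ij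
    by (simp add: Y_def linop_diff[OF linop_torus(2)])
  have YY: "Y i (Y j F) = Y j (Y i F)" for F
    unfolding Y_def
    by (simp add: linop_diff[OF linop_torus(3)] linop_diff[OF linop_torus(4)]
      torus_relations(11)[of i j] ynext_relations(5) ynext_relations(6)[of i j] algebra_simps)
  have zs: "zstor q k F = zinv q k (Y k F)" for k F by (simp add: zstor_def Y_def)
  have "act q (Inr i) (act q (Inr j) F) = (\<lambda>w. q powi 2 * zinv q i (zinv q j (Y i (Y j F))) w)"
    by (simp only: act.simps zs Yi linop_scale[OF linop_torus(2)])
  also have "\<dots> = (\<lambda>w. q * zinv q j (zinv q i (Y j (Y i F))) w)"
  proof -
    have e: "q powi 2 * (q powi (-1) * c) = q * c" for c using powi_collect[of 2 "-1" c] by simp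
    show ?thesis by (simp only: torus_relations(2)[OF ij] YY e)
  qed
  also have "zinv q j (zinv q i (Y j (Y i F))) = act q (Inr j) (act q (Inr i) F)"
    by (simp only: act.simps zs Yj)
  finally show ?thesis .
qed

lemma act_osc:
  "act q (Inl i) (act q (Inr i) F) w - q\<^sup>2 * act q (Inr i) (act q (Inl i) F) w
    = (q\<^sup>2 - 1) * (\<Sum>k\<in>{i<..}. act q (Inl k) (act q (Inr k) F) w)"
proof -
  have "(\<Sum>k\<in>{i<..}. act q (Inl k) (act q (Inr k) F) w) = ynext q i F w"
    using fun_cong[OF ynext_telescope[where i = i and F = F], of w] by (simp add: z_zs)
  moreover have "q\<^sup>2 * (q powi (-2) * c) = c" for c
    using q by (simp add: power_int_minus power2_eq_square field_simps)
  ultimately show ?thesis by (simp add: z_zs zs_z algebra_simps)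
qed

end

section \<open>The torus representation and leading terms\<close>

definition rep :: "complex \<Rightarrow> ('n::{finite,linorder}) free_alg \<Rightarrow> 'n torus \<Rightarrow> 'n torus" where
  "rep q f F w = (\<Sum>u\<in>Poly_Mapping.keys f. Poly_Mapping.lookup f u * foldr (act q) (letters u) F w)"

lemma rep_superset:
  assumes "finite A" "Poly_Mapping.keys f \<subseteq> A"
  shows "rep q f F w = (\<Sum>u\<in>A. Poly_Mapping.lookup f u * foldr (act q) (letters u) F w)"
  unfolding rep_def by (rule sum.mono_neutral_left) (use assms in \<open>auto simp: in_keys_iff\<close>)

lemma rep_add: "rep q (f + g) F w = rep q f F w + rep q g F w"
proof -
  let ?A = "Poly_Mapping.keys f \<union> Poly_Mapping.keys g"
  have "Poly_Mapping.keys (f + g) \<subseteq> ?A" by (rule keys_add)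
  then show ?thesis
    by (simp add: rep_superset[of ?A] lookup_add distrib_right sum.distrib)
qed

lemma rep_zero: "rep q 0 F w = 0"
  by (simp add: rep_def)

lemma rep_single: "rep q (Poly_Mapping.single u c) F w = c * foldr (act q) (letters u) F w"
  by (simp add: rep_def)

lemma linop_rep: "linop (rep q f)"
proof -
  have l: "linop (foldr (act q) xs)" for xs
    by (induction xs) (auto simp: linop_def comp_def linop_add[OF linop_act] linop_scale[OF linop_act])
  show ?thesis unfolding linop_def rep_def
    by (simp add: linop_add[OF l] linop_scale[OF l] distrib_left sum.distrib sum_distrib_left mult_ac)
qed

lemma rep_uminus: "rep q (- f) F w = - rep q f F w"
  using rep_add[of q f "- f" F w] by (simp add: rep_zero eq_neg_iff_add_eq_0 add.commute)

lemma rep_diff: "rep q (f - g) F w = rep q f F w - rep q g F w"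
  using rep_add[of q f "- g" F w] by (simp add: rep_uminus)

lemma rep_sum: "rep q (\<Sum>k\<in>A. f k) F w = (\<Sum>k\<in>A. rep q (f k) F w)"
  by (induction A rule: infinite_finite_induct) (auto simp: rep_zero rep_add)

lemma rep_mult: "rep q (f * g) F = rep q f (rep q g F)"
proof (induction f rule: poly_mapping_single_induct)
  case 1
  then show ?case by (simp add: rep_zero fun_eq_iff)
next
  case (2 u c)
  show ?case
  proof (induction g rule: poly_mapping_single_induct)
    case 1
    then show ?case using linop_zero[OF linop_rep] by (simp add: rep_zero fun_eq_iff)
  next
    case (2 v d)
    have l: "linop (foldr (act q) (letters u))"
      using linop_rep[of q "Poly_Mapping.single u 1"] by (simp add: rep_single linop_def fun_eq_iff)
    have "rep q (Poly_Mapping.single v d) F = (\<lambda>w. d * foldr (act q) (letters v) F w)"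
      by (simp add: rep_single fun_eq_iff)
    then show ?case
      by (simp add: mult_single rep_single fun_eq_iff plus_word_def linop_scale[OF l] mult.assoc)
  next
    case (3 g h)
    have "rep q (g + h) F = (\<lambda>w. rep q g F w + rep q h F w)" by (simp add: rep_add fun_eq_iff)
    then show ?case using 3
      by (simp add: distrib_left rep_add fun_eq_iff linop_add[OF linop_rep])
  qed
next
  case (3 f g)
  then show ?case by (simp add: distrib_right rep_add fun_eq_iff)
qed

lemma rep_gvar: "rep q (gvar x) F = act q x F"
  by (simp add: gvar_def rep_single fun_eq_iff)

lemma rep_scalar: "rep q (scalar c) F = (\<lambda>w. c * F w)"
  by (simp add: scalar_def rep_single fun_eq_iff zero_word_def)

lemma rep_ideal:
  assumes "q \<noteq> 0" and "f \<in> B_ideal q" shows "rep q f F w = 0"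
  using assms(2)
proof (induction arbitrary: F w rule: B_ideal.induct)
  case (gen r f g)
  have "rep q r F w = 0" for F w
  proof -
    note ev = rep_diff rep_mult rep_gvar rep_scalar rep_sum
    from gen show ?thesis unfolding B_relations_def
    proof (elim UnE CollectE exE conjE)
      fix i j assume r: "r = Z i * Z j - scalar (inverse q) * (Z j * Z i)" and ij: "i < j"
      show ?thesis
        using fun_cong[OF act_zz[OF assms(1) ij, of F], of w] by (simp only: r ev) simp
    next
      fix i j assume r: "r = Zs i * Zs j - scalar q * (Zs j * Zs i)" and ij: "i < j"
      show ?thesis
        using fun_cong[OF act_zszs[OF assms(1) ij, of F], of w] by (simp only: r ev) simp
    next
      fix i j assume r: "r = Z i * Zs j - scalar q * (Zs j * Z i)" and ij: "i \<noteq> j"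
      show ?thesis
        using fun_cong[OF act_zzs[OF assms(1) ij, of F], of w] by (simp only: r ev) simp
    next
      fix i assume r: "r = Z i * Zs i - scalar (q^2) * (Zs i * Z i)
        - scalar (q^2 - 1) * (\<Sum>k\<in>{i<..}. Z k * Zs k)"
      show ?thesis
        using act_osc[OF assms(1), of i F w] by (simp only: r ev) simp
    qed
  qed
  then have "rep q r (rep q g F) = (\<lambda>w. 0)" by blast
  then show ?case using linop_zero[OF linop_rep[of q f]] by (simp add: rep_mult)
qed (simp_all add: rep_zero rep_add)

text \<open>The variable y_k has weight N - k, which strictly decreases in k, and each z_k has
  weight 0.\<close>

definition weight :: "('n::{finite,linorder} gen \<Rightarrow> int) \<Rightarrow> int" where
  "weight w = (\<Sum>k\<in>UNIV. w (Inr k) * int (card {k..}))"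

lemma weight_add [simp]: "weight (\<lambda>x. f x + g x) = weight f + weight g"
  and weight_diff [simp]: "weight (\<lambda>x. f x - g x) = weight f - weight g"
  by (simp_all add: weight_def sum.distrib sum_subtractf algebra_simps)

lemma weight_unit [simp]: "weight (unit (Inl j)) = 0" "weight (unit (Inr j)) = int (card {j..})"
  by (simp_all add: weight_def unit_def if_distrib[where f = "\<lambda>t. t * _"] cong: if_cong)

text \<open>
  Choosing \<open>- y\<^bsub>i+1\<^esub>\<close> instead of \<open>y\<^sub>i\<close> in \<open>z\<^sub>i\<^sup>* = z\<^sub>i\<^sup>-\<^sup>1 (y\<^sub>i - y\<^bsub>i+1\<^esub>)\<close> lowers the weight, so every ordered
  monomial has a unique term of maximal weight.
\<close>

definition leading :: "('n::{finite,linorder}) torus \<Rightarrow> ('n gen \<Rightarrow> int) \<Rightarrow> bool" where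
  "leading F w0 \<longleftrightarrow> F w0 \<noteq> 0
     \<and> (\<forall>w. F w \<noteq> 0 \<longrightarrow> (\<forall>i. w (Inl i) = w0 (Inl i)) \<and> (w = w0 \<or> weight w < weight w0))"

lemma leading_z:
  assumes "q \<noteq> 0" "leading F w0"
  shows "leading (ztor q i F) (\<lambda>x. w0 x + unit (Inl i) x)"
  unfolding leading_def
proof (intro conjI allI impI)
  show "ztor q i F (\<lambda>x. w0 x + unit (Inl i) x) \<noteq> 0" using assms by (simp add: ztor_def leading_def)
  fix w assume "ztor q i F w \<noteq> 0"
  then have "F (\<lambda>x. w x - unit (Inl i) x) \<noteq> 0" by (auto simp: ztor_def)
  then have *: "\<forall>j. w (Inl j) - unit (Inl i) (Inl j) = w0 (Inl j)"
    "(\<lambda>x. w x - unit (Inl i) x) = w0 \<or> weight w < weight w0"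
    using assms(2) unfolding leading_def by force+
  show "w (Inl j) = w0 (Inl j) + unit (Inl i) (Inl j)" for j using *(1)[rule_format, of j] by simp
  show "w = (\<lambda>x. w0 x + unit (Inl i) x) \<or> weight w < weight (\<lambda>x. w0 x + unit (Inl i) x)"
    using *(2) by (auto simp: fun_eq_iff diff_eq_eq)
qed

lemma leading_zs:
  assumes q: "q \<noteq> 0" and lead: "leading F w0"
  shows "leading (zstor q i F) (\<lambda>x. w0 x + (unit (Inr i) x - unit (Inl i) x))"
proof -
  let ?n = "Min {i<..}"
  have eq: "zstor q i F w = q powi (- lo i w) * (q powi (- 2 * (hi i w + 1)) * F (\<lambda>x. w x + unit (Inl i) x - unit (Inr i) x)
      - (if {i<..} = {} then 0 else q powi (- 2 * hi ?n w) * F (\<lambda>x. w x + unit (Inl i) x - unit (Inr ?n) x)))" for w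
  proof (cases "{i<..} = {}")
    case True
    show ?thesis unfolding zstor_def zinv_def ytor_def ynext_def if_P[OF True] by simp
  next
    case False
    have "\<not> ?n \<le> i" using Min_above[OF False] by simp
    then show ?thesis unfolding zstor_def zinv_def ytor_def ynext_def if_not_P[OF False] by simp
  qed
  have less: "card {?n..} < card {i..}" if "{i<..} \<noteq> {}"
    by (rule psubset_card_mono) (use Min_above[OF that] in auto)
  define w1 where "w1 = (\<lambda>x. w0 x + (unit (Inr i) x - unit (Inl i) x))"
  have ww: "weight w1 = weight w0 + int (card {i..})" by (simp add: w1_def)
  show ?thesis
    unfolding leading_def w1_def[symmetric]
  proof (intro conjI allI impI)
    have "(\<lambda>x. w1 x + unit (Inl i) x - unit (Inr i) x) = w0" by (simp add: w1_def)
    \<comment> \<open>This argument is heavier than \<open>w0\<close> because y_{i+1} is lighter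
      than y_i. So the second summand contributes nothing at \<open>w1\<close>.\<close>
    moreover have "F (\<lambda>x. w1 x + unit (Inl i) x - unit (Inr ?n) x) = 0" if "{i<..} \<noteq> {}"
    proof (rule ccontr)
      assume "F (\<lambda>x. w1 x + unit (Inl i) x - unit (Inr ?n) x) \<noteq> 0"
      then have "weight (\<lambda>x. w1 x + unit (Inl i) x - unit (Inr ?n) x) \<le> weight w0"
        using lead unfolding leading_def by force
      then show False using less[OF that] ww by simp
    qed
    ultimately show "zstor q i F w1 \<noteq> 0" unfolding eq using q lead by (auto simp: leading_def)
    fix w assume nz: "zstor q i F w \<noteq> 0"
    have "zstor q i F w = 0" if "F (\<lambda>x. w x + unit (Inl i) x - unit (Inr i) x) = 0"
      "{i<..} = {} \<or> F (\<lambda>x. w x + unit (Inl i) x - unit (Inr ?n) x) = 0"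
      unfolding eq using that
      by (elim disjE) (simp_all only: if_True simp_thms mult_zero_right diff_self if_cancel)
    then consider "F (\<lambda>x. w x + unit (Inl i) x - unit (Inr i) x) \<noteq> 0"
      | "{i<..} \<noteq> {}" "F (\<lambda>x. w x + unit (Inl i) x - unit (Inr ?n) x) \<noteq> 0"
      using nz by blast
    then have "(\<forall>j. w (Inl j) = w1 (Inl j)) \<and> (w = w1 \<or> weight w < weight w1)"
    proof cases
      case 1
      then have c: "\<forall>j. w (Inl j) + unit (Inl i) (Inl j) - unit (Inr i) (Inl j) = w0 (Inl j)"
        "(\<lambda>x. w x + unit (Inl i) x - unit (Inr i) x) = w0 \<or> weight (\<lambda>x. w x + unit (Inl i) x - unit (Inr i) x) < weight w0"
        using lead unfolding leading_def by blast+
      have "w = w1" if "(\<lambda>x. w x + unit (Inl i) x - unit (Inr i) x) = w0"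
      proof
        show "w x = w1 x" for x using fun_cong[OF that, of x] by (simp add: w1_def)
      qed
      moreover have "weight w < weight w1"
        if "weight (\<lambda>x. w x + unit (Inl i) x - unit (Inr i) x) < weight w0"
        using that ww by simp
      moreover have "w (Inl j) = w1 (Inl j)" for j
        using c(1)[rule_format, of j] by (simp add: w1_def)
      ultimately show ?thesis using c(2) by blast
    next
      case 2
      then have a: "\<forall>j. w (Inl j) + unit (Inl i) (Inl j) - unit (Inr ?n) (Inl j) = w0 (Inl j)"
        and "(\<lambda>x. w x + unit (Inl i) x - unit (Inr ?n) x) = w0 \<or> weight (\<lambda>x. w x + unit (Inl i) x - unit (Inr ?n) x) < weight w0"
        using lead unfolding leading_def by blast+
      then have "weight (\<lambda>x. w x + unit (Inl i) x - unit (Inr ?n) x) \<le> weight w0" by auto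
      then have "weight w < weight w1" using less[OF 2(1)] ww by simp
      then show ?thesis using a by (auto simp: w1_def unit_def split: if_splits)
    qed
    then show "w (Inl j) = w1 (Inl j)" "w = w1 \<or> weight w < weight w1" for j by blast+
  qed
qed

lemma leading_power:
  assumes "\<And>F w0. leading F w0 \<Longrightarrow> leading (rep q f F) (\<lambda>x. w0 x + d x)" "leading F w0"
  shows "leading (rep q (f ^ n) F) (\<lambda>x. w0 x + int n * d x)"
proof (induction n)
  case 0
  have "rep q 1 F = F" using rep_scalar[of q 1] by simp
  then show ?case using assms by simp
next
  case (Suc n)
  have "(\<lambda>x. w0 x + int (Suc n) * d x) = (\<lambda>x. (w0 x + int n * d x) + d x)" by (simp add: algebra_simps)
  then show ?case using assms(1)[OF Suc] by (simp add: rep_mult)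
qed

lemma leading_prod_list:
  assumes "\<And>i F w0. leading F w0 \<Longrightarrow> leading (rep q (f i) F) (\<lambda>x. w0 x + d i x)" "leading F w0"
  shows "leading (rep q (prod_list (map f L)) F) (\<lambda>x. w0 x + (\<Sum>i\<leftarrow>L. d i x))"
proof (induction L)
  case Nil
  have "rep q 1 F = F" using rep_scalar[of q 1] by simp
  then show ?case using assms by simp
next
  case (Cons i L)
  have "(\<lambda>x. w0 x + (\<Sum>i\<leftarrow>i # L. d i x)) = (\<lambda>x. (w0 x + (\<Sum>i\<leftarrow>L. d i x)) + d i x)" by (simp add: algebra_simps)
  then show ?case using assms(1)[OF Cons] by (simp add: rep_mult)
qed

text \<open>In leading terms z_i^* is z_i^-1 y_i, so exponents a of z_i and b of z_i^* become a - b
  for z_i and b for y_i. This determines a and b.\<close>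

definition top_exponent :: "('n gen \<Rightarrow> nat) \<Rightarrow> 'n gen \<Rightarrow> int" where
  "top_exponent \<alpha> x = (case x of Inl i \<Rightarrow> int (\<alpha> (Inl i)) - int (\<alpha> (Inr i)) | Inr i \<Rightarrow> int (\<alpha> (Inr i)))"

lemma top_exponent_inj: "top_exponent \<alpha> = top_exponent \<beta> \<longleftrightarrow> \<alpha> = \<beta>"
proof
  assume eq: "top_exponent \<alpha> = top_exponent \<beta>"
  show "\<alpha> = \<beta>"
  proof
    show "\<alpha> x = \<beta> x" for x
      using fun_cong[OF eq, of x] fun_cong[OF eq, of "star x"]
      by (cases x) (auto simp: top_exponent_def)
  qed
qed simp

lemma leading_ordered_monomial:
  assumes q: "q \<noteq> 0"
  shows "leading (rep q (ordered_monomial \<alpha>) (\<lambda>w. if w = (\<lambda>x. 0) then 1 else 0)) (top_exponent \<alpha>)"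
proof -
  let ?vac = "\<lambda>w. if w = (\<lambda>x. 0) then 1 else 0 :: complex"
  let ?L = "sorted_list_of_set (UNIV :: 'a set)"
  have vac: "leading ?vac (\<lambda>x. 0)" by (simp add: leading_def)
  have sum_L: "(\<Sum>i\<leftarrow>?L. g i) = (\<Sum>i\<in>UNIV. g i)" "(\<Sum>i\<leftarrow>rev ?L. g i) = (\<Sum>i\<in>UNIV. g i)" for g :: "'a \<Rightarrow> int"
    by (simp_all add: sum_list_distinct_conv_sum_set)
  have 1: "leading (rep q (Z i ^ n) F) (\<lambda>x. w0 x + int n * unit (Inl i) x)" if "leading F w0" for i n F w0
    by (rule leading_power[OF _ that]) (simp add: rep_gvar leading_z[OF q])
  have 2: "leading (rep q (Zs i ^ n) F) (\<lambda>x. w0 x + int n * (unit (Inr i) x - unit (Inl i) x))"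
    if "leading F w0" for i n F w0
    by (rule leading_power[OF _ that]) (simp add: rep_gvar leading_zs[OF q])
  have "leading (rep q (ordered_monomial \<alpha>) ?vac)
    (\<lambda>x. (0 + (\<Sum>i\<leftarrow>rev ?L. int (\<alpha> (Inr i)) * (unit (Inr i) x - unit (Inl i) x)))
      + (\<Sum>i\<leftarrow>?L. int (\<alpha> (Inl i)) * unit (Inl i) x))"
    unfolding ordered_monomial_def rep_mult
    by (intro leading_prod_list 1 2 vac)
  also have "(\<lambda>x. (0 + (\<Sum>i\<leftarrow>rev ?L. int (\<alpha> (Inr i)) * (unit (Inr i) x - unit (Inl i) x)))
      + (\<Sum>i\<leftarrow>?L. int (\<alpha> (Inl i)) * unit (Inl i) x)) = top_exponent \<alpha>"
  proof
    fix x :: "'a gen"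
    show "(0 + (\<Sum>i\<leftarrow>rev ?L. int (\<alpha> (Inr i)) * (unit (Inr i) x - unit (Inl i) x)))
      + (\<Sum>i\<leftarrow>?L. int (\<alpha> (Inl i)) * unit (Inl i) x) = top_exponent \<alpha> x"
      unfolding sum_L
      by (cases x) (auto simp: unit_def top_exponent_def if_distrib[where f = "(*) _"] sum_negf
        if_distrib[where f = uminus] cong: if_cong)
  qed
  finally show ?thesis .
qed

text \<open>Among the monomials with nonzero coefficient take one of maximal weight. No other one
  reaches its leading lattice point, since there it would have to be either equal or strictly
  heavier.\<close>

theorem ordered_monomials_independent:
  fixes c :: "(('n::{finite,linorder}) gen \<Rightarrow> nat) \<Rightarrow> complex"
  assumes q: "q \<noteq> 0" and A: "finite A"
    and eq: "eq_in_B q (\<Sum>\<alpha>\<in>A. scalar (c \<alpha>) * ordered_monomial \<alpha>) 0"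
    and \<alpha>: "\<alpha> \<in> A"
  shows "c \<alpha> = 0"
proof (rule ccontr)
  assume "c \<alpha> \<noteq> 0"
  define A' where "A' = {\<beta>\<in>A. c \<beta> \<noteq> 0}"
  have A': "finite A'" "A' \<noteq> {}" using A \<alpha> \<open>c \<alpha> \<noteq> 0\<close> by (auto simp: A'_def)
  define M where "M = Max ((\<lambda>\<beta>. weight (top_exponent \<beta>)) ` A')"
  have "M \<in> (\<lambda>\<beta>. weight (top_exponent \<beta>)) ` A'" unfolding M_def by (rule Max_in) (use A' in auto)
  then obtain \<beta> where \<beta>: "\<beta> \<in> A'" "weight (top_exponent \<beta>) = M" by auto
  have max: "weight (top_exponent \<gamma>) \<le> M" if "\<gamma> \<in> A'" for \<gamma>
    unfolding M_def by (rule Max_ge) (use A' that in auto)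
  define vac :: "'n torus" where "vac = (\<lambda>w. if w = (\<lambda>x. 0) then 1 else 0 :: complex)"
  let ?T = "\<lambda>\<gamma>. rep q (ordered_monomial \<gamma>) vac"
  have lead: "leading (?T \<gamma>) (top_exponent \<gamma>)" for \<gamma>
    unfolding vac_def by (rule leading_ordered_monomial[OF q])
  have "0 = rep q (\<Sum>\<alpha>\<in>A. scalar (c \<alpha>) * ordered_monomial \<alpha>) vac (top_exponent \<beta>)"
    using rep_ideal[OF q, of _ vac "top_exponent \<beta>"] eq by (simp add: eq_in_B_def)
  also have "\<dots> = (\<Sum>\<gamma>\<in>A. c \<gamma> * ?T \<gamma> (top_exponent \<beta>))"
    by (simp add: rep_sum rep_mult rep_scalar)
  also have "\<dots> = (\<Sum>\<gamma>\<in>A. if \<gamma> = \<beta> then c \<beta> * ?T \<beta> (top_exponent \<beta>) else 0)"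
  proof (intro sum.cong refl)
    fix \<gamma> assume "\<gamma> \<in> A"
    show "c \<gamma> * ?T \<gamma> (top_exponent \<beta>) = (if \<gamma> = \<beta> then c \<beta> * ?T \<beta> (top_exponent \<beta>) else 0)"
    proof (cases "c \<gamma> * ?T \<gamma> (top_exponent \<beta>) = 0 \<or> \<gamma> = \<beta>")
      case False
      then have "\<gamma> \<in> A'" "?T \<gamma> (top_exponent \<beta>) \<noteq> 0" using \<open>\<gamma> \<in> A\<close> by (auto simp: A'_def)
      then have "top_exponent \<beta> = top_exponent \<gamma> \<or> weight (top_exponent \<beta>) < weight (top_exponent \<gamma>)"
        using conjunct2[OF lead[of \<gamma>, unfolded leading_def], rule_format, of "top_exponent \<beta>"] by blast
      then show ?thesis using max[OF \<open>\<gamma> \<in> A'\<close>] \<beta> False by (auto simp: top_exponent_inj)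
    qed auto
  qed
  also have "\<dots> = c \<beta> * ?T \<beta> (top_exponent \<beta>)" using \<beta> A by (simp add: A'_def)
  finally show False using \<beta> lead[of \<beta>] by (auto simp: A'_def leading_def)
qed

section \<open>Expansions in ordered monomials\<close>

definition omon :: "'n list \<Rightarrow> ('n gen \<Rightarrow> nat) \<Rightarrow> ('n::{finite,linorder}) balg" where
  "omon L \<alpha> = prod_list (map (\<lambda>i. zb (Inl i) ^ \<alpha> (Inl i)) L)
     * prod_list (map (\<lambda>i. zb (Inr i) ^ \<alpha> (Inr i)) (rev L))"

abbreviation idxs :: "('n::{finite,linorder}) list" where
  "idxs \<equiv> sorted_list_of_set UNIV"

lemma cls_ordered_monomial: "cls (\<lambda>q. ordered_monomial \<alpha>) = omon idxs \<alpha>"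
  unfolding ordered_monomial_def omon_def by (simp only: cls_simps)

lemma omon_Cons: "omon (i # L) \<alpha> = zb (Inl i) ^ \<alpha> (Inl i) * omon L \<alpha> * zb (Inr i) ^ \<alpha> (Inr i)"
  by (simp add: omon_def mult.assoc)

lemma omon_update: "i \<notin> set L \<Longrightarrow> omon L (\<alpha>(Inl i := s, Inr i := t)) = omon L \<alpha>"
  unfolding omon_def
  by (intro arg_cong2[where f = "(*)"] arg_cong[where f = prod_list] map_cong refl) auto

text \<open>Continuity of the coefficients away from 0 is what allows them to be evaluated at
  \<epsilon> in the limit.\<close>

definition expandable :: "'n list \<Rightarrow> ('n::{finite,linorder}) balg \<Rightarrow> bool" where
  "expandable L f \<longleftrightarrow> (\<exists>A K. finite A \<and> (\<forall>\<alpha>\<in>A. continuous_on (- {0}) (K \<alpha>)) \<and> f = (\<Sum>\<alpha>\<in>A. sc (K \<alpha>) * omon L \<alpha>))"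

lemma expandable_omon: "expandable L (omon L \<alpha>)"
  unfolding expandable_def by (intro exI[of _ "{\<alpha>}"] exI[of _ "\<lambda>_ _. 1"]) simp

lemma expandable_zero: "expandable L 0"
  unfolding expandable_def by (intro exI[of _ "{}"]) simp

lemma expandable_scale:
  assumes "expandable L f" "continuous_on (- {0}) h" shows "expandable L (sc h * f)"
proof -
  obtain A K where "finite A" "\<forall>\<alpha>\<in>A. continuous_on (- {0}) (K \<alpha>)" "f = (\<Sum>\<alpha>\<in>A. sc (K \<alpha>) * omon L \<alpha>)"
    using assms by (auto simp: expandable_def)
  then show ?thesis unfolding expandable_def using assms(2)
    by (intro exI[of _ A] exI[of _ "\<lambda>\<alpha> q. h q * K \<alpha> q"])
      (auto simp: sum_distrib_left sc_mult mult.assoc intro!: continuous_intros)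
qed

lemma expandable_add:
  assumes "expandable L f" "expandable L g" shows "expandable L (f + g)"
proof -
  obtain A K where f: "finite A" "\<forall>\<alpha>\<in>A. continuous_on (- {0}) (K \<alpha>)" "f = (\<Sum>\<alpha>\<in>A. sc (K \<alpha>) * omon L \<alpha>)"
    using assms by (auto simp: expandable_def)
  obtain B M where g: "finite B" "\<forall>\<alpha>\<in>B. continuous_on (- {0}) (M \<alpha>)" "g = (\<Sum>\<alpha>\<in>B. sc (M \<alpha>) * omon L \<alpha>)"
    using assms by (auto simp: expandable_def)
  define K' where "K' = (\<lambda>\<alpha> q. if \<alpha> \<in> A then K \<alpha> q else 0)"
  define M' where "M' = (\<lambda>\<alpha> q. if \<alpha> \<in> B then M \<alpha> q else 0)"
  have "continuous_on (- {0}) (K' \<alpha>)" for \<alpha> using f(2) by (cases "\<alpha> \<in> A") (simp_all add: K'_def)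
  moreover have "continuous_on (- {0}) (M' \<alpha>)" for \<alpha> using g(2) by (cases "\<alpha> \<in> B") (simp_all add: M'_def)
  ultimately have c: "continuous_on (- {0}) (K' \<alpha>)" "continuous_on (- {0}) (M' \<alpha>)" for \<alpha> by blast+
  have "f = (\<Sum>\<alpha>\<in>A \<union> B. sc (K' \<alpha>) * omon L \<alpha>)"
    unfolding f(3) by (rule sum.mono_neutral_cong_left) (use f g in \<open>auto simp: K'_def\<close>)
  moreover have "g = (\<Sum>\<alpha>\<in>A \<union> B. sc (M' \<alpha>) * omon L \<alpha>)"
    unfolding g(3) by (rule sum.mono_neutral_cong_left) (use f g in \<open>auto simp: M'_def\<close>)
  ultimately have "f + g = (\<Sum>\<alpha>\<in>A \<union> B. sc (\<lambda>q. K' \<alpha> q + M' \<alpha> q) * omon L \<alpha>)"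
    by (simp add: sc_add distrib_right sum.distrib)
  then show ?thesis unfolding expandable_def using f(1) g(1) c
    by (intro exI[of _ "A \<union> B"] exI[of _ "\<lambda>\<alpha> q. K' \<alpha> q + M' \<alpha> q"]) (auto intro!: continuous_intros)
qed

lemma expandable_sum: "(\<And>k. k \<in> I \<Longrightarrow> expandable L (f k)) \<Longrightarrow> expandable L (\<Sum>k\<in>I. f k)"
  by (induction I rule: infinite_finite_induct) (auto intro: expandable_zero expandable_add)

lemma expandable_Cons:
  assumes "expandable L f" "i \<notin> set L"
  shows "expandable (i # L) (zb (Inl i) ^ s * f * zb (Inr i) ^ t)"
proof -
  obtain A K where f: "finite A" "\<forall>\<alpha>\<in>A. continuous_on (- {0}) (K \<alpha>)" "f = (\<Sum>\<alpha>\<in>A. sc (K \<alpha>) * omon L \<alpha>)"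
    using assms by (auto simp: expandable_def)
  have "zb (Inl i) ^ s * f * zb (Inr i) ^ t
      = (\<Sum>\<alpha>\<in>A. sc (K \<alpha>) * (zb (Inl i) ^ s * omon L \<alpha> * zb (Inr i) ^ t))"
    unfolding f(3) sum_distrib_left sum_distrib_right
    by (intro sum.cong refl) (simp only: sc_left_commute[of "zb (Inl i) ^ s"] mult.assoc)
  also have "\<dots> = (\<Sum>\<alpha>\<in>A. sc (K \<alpha>) * omon (i # L) (\<alpha>(Inl i := s, Inr i := t)))"
    by (simp add: omon_Cons omon_update[OF assms(2)])
  finally show ?thesis using f(2) by (auto intro: expandable_sum expandable_scale expandable_omon)
qed

lemma expandable_prefix:
  "expandable L f \<Longrightarrow> distinct (pre @ L) \<Longrightarrow> expandable (pre @ L) f"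
proof (induction pre)
  case (Cons i pre)
  then show ?case using expandable_Cons[of "pre @ L" f i 0 0] by simp
qed simp

text \<open>These lists are the tails of \<open>idxs\<close>.\<close>

definition final_segment :: "('n::{finite,linorder}) list \<Rightarrow> bool" where
  "final_segment L \<longleftrightarrow> sorted_wrt (<) L \<and> (\<forall>i\<in>set L. {i..} \<subseteq> set L)"

lemma final_segment_Cons:
  assumes "final_segment (i # L)"
  shows "final_segment L" "set L = {i<..}" "set (i # L) = {i..}" "i \<notin> set L"
proof -
  have gt: "\<forall>j\<in>set L. i < j" and s: "sorted_wrt (<) L" and up: "\<forall>j\<in>set (i # L). {j..} \<subseteq> set (i # L)"
    using assms by (auto simp: final_segment_def)
  show "i \<notin> set L" using gt by auto
  show 1: "set (i # L) = {i..}" using gt up by (auto simp: less_imp_le)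
  show 2: "set L = {i<..}" using gt 1 by force
  show "final_segment L" using s gt unfolding final_segment_def 2 by auto
qed

lemma idxs_split:
  obtains pre L where "idxs = pre @ i # L" "final_segment (i # L)"
proof -
  have "i \<in> set idxs" by simp
  then obtain pre L where L: "idxs = pre @ i # L" using split_list by fast
  have s: "sorted_wrt (<) (pre @ i # L)" using L strict_sorted_list_of_set[of UNIV] by metis
  have "set (pre @ i # L) = UNIV" using L by (metis finite set_sorted_list_of_set)
  then have "j \<in> set pre \<or> j \<in> set (i # L)" for j by auto
  moreover have "j < i" if "j \<in> set pre" for j using s that by (auto simp: sorted_wrt_append)
  ultimately have mem: "j \<in> set (i # L)" if "i \<le> j" for j using that by (meson leD)
  have ge: "i \<le> j" if "j \<in> set (i # L)" for j using s that by (auto simp: sorted_wrt_append)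
  have "sorted_wrt (<) (i # L)" using s by (simp add: sorted_wrt_append)
  moreover have "{j..} \<subseteq> set (i # L)" if "j \<in> set (i # L)" for j
    using mem ge[OF that] order_trans by (metis atLeast_iff subsetI)
  ultimately have "final_segment (i # L)" unfolding final_segment_def by blast
  then show ?thesis using that L by blast
qed

lemma continuous_ycoeff_pinv: "continuous_on (- {0}) (\<lambda>q. ycoeff (pinv q) n s)"
  by (intro continuous_intros) auto

text \<open>The expansion of y_i^n sandwiches powers of y_{i+1} between z_i^s on the left and z_i^*
  powers on the right, which is exactly the nested shape of ordered monomials.\<close>

lemma expandable_yb_power: "final_segment L \<Longrightarrow> expandable L (yb (set L) ^ n)"
proof (induction L arbitrary: n)
  case Nil
  have "omon [] (\<lambda>x. 0) = 1" by (simp add: omon_def)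
  then have "expandable [] 1" using expandable_omon by metis
  then show ?case using expandable_zero by (cases n) (auto simp: yb_def)
next
  case (Cons i L)
  note fs = final_segment_Cons[OF Cons.prems]
  have "yb (set (i # L)) ^ n = (\<Sum>s\<le>n. sc (\<lambda>q. ycoeff (pinv q) n s) * osc i n s)"
    unfolding fs(3) by (rule y0_power)
  moreover have "expandable (i # L) (osc i n s)" for s
    unfolding osc_def fs(2)[symmetric] by (rule expandable_Cons[OF Cons.IH[OF fs(1)] fs(4)])
  ultimately show ?case by (simp only:) (intro expandable_sum expandable_scale continuous_ycoeff_pinv)
qed

lemma expandable_osc: "expandable idxs (osc i n s)"
proof -
  obtain pre L where L: "idxs = pre @ i # L" "final_segment (i # L)" by (rule idxs_split)
  note fs = final_segment_Cons[OF L(2)]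
  have "expandable (i # L) (osc i n s)"
    unfolding osc_def fs(2)[symmetric] by (rule expandable_Cons[OF expandable_yb_power[OF fs(1)] fs(4)])
  moreover have "distinct (pre @ i # L)" using L(1) by (metis distinct_sorted_list_of_set)
  ultimately show ?thesis unfolding L(1) by (rule expandable_prefix)
qed

section \<open>Specialization\<close>

text \<open>Equality in the single algebra at \<open>e\<close>. The quotient forgets the value of a
  family at 0, so the relation has to be trivial there.\<close>

lift_definition eq_at :: "complex \<Rightarrow> ('n::{finite,linorder}) balg \<Rightarrow> 'n balg \<Rightarrow> bool"
  is "\<lambda>e f g. e = 0 \<or> eq_in_B e (f e) (g e)"
  by (blast intro: eq_in_B_trans eq_in_B_sym)

lemma eq_at_cls: "e \<noteq> 0 \<Longrightarrow> eq_at e (cls f) (cls g) \<longleftrightarrow> eq_in_B e (f e) (g e)"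
  by transfer simp

lemma eq_at_refl [simp]: "eq_at e f f"
  by transfer simp

lemma eq_at_sym: "eq_at e f g \<Longrightarrow> eq_at e g f"
  by transfer (blast intro: eq_in_B_sym)

lemma eq_at_trans [trans]: "eq_at e f g \<Longrightarrow> eq_at e g h \<Longrightarrow> eq_at e f h"
  by transfer (blast intro: eq_in_B_trans)

lemma eq_at_add: "eq_at e f f' \<Longrightarrow> eq_at e g g' \<Longrightarrow> eq_at e (f + g) (f' + g')"
  by transfer (blast intro: eq_in_B_add)

lemma eq_at_mult: "eq_at e f f' \<Longrightarrow> eq_at e g g' \<Longrightarrow> eq_at e (f * g) (f' * g')"
  by transfer (blast intro: eq_in_B_mult)

lemma eq_at_sum: "(\<And>k. k \<in> I \<Longrightarrow> eq_at e (f k) (g k)) \<Longrightarrow> eq_at e (\<Sum>k\<in>I. f k) (\<Sum>k\<in>I. g k)"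
  by (induction I rule: infinite_finite_induct) (auto intro: eq_at_add)

lemma eq_at_sc: "h e = k e \<Longrightarrow> eq_at e (sc h) (sc k)"
  by transfer simp

context
  fixes \<epsilon> :: complex and m :: nat
  assumes odd_m: "odd m" and prim: "primitive_root_of_unity m \<epsilon>"
begin

text \<open>At \<epsilon> all middle Gaussian coefficients vanish. The last one is p^(m(m-1)/2),
  which is 1 because m is odd.\<close>

lemma yb_power_step: "eq_at \<epsilon> (yb {i..} ^ m) (yb {i<..} ^ m + zb (Inl i) ^ m * zb (Inr i) ^ m)"
proof -
  note root = root_facts[OF odd_m prim]
  have c: "ycoeff (pinv \<epsilon>) m s = (if s = 0 \<or> s = m then 1 else 0)" if "s \<le> m" for s
  proof -
    obtain h where h: "m - 1 = 2 * h" using odd_m by (auto elim: oddE)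
    have "ycoeff (pinv \<epsilon>) m m = (pinv \<epsilon> ^ m) ^ h"
      unfolding ycoeff_diag h by (simp add: power_mult[symmetric] mult.assoc)
    then have "ycoeff (pinv \<epsilon>) m m = 1" using eta_facts(1)[OF odd_m prim] by simp
    moreover have "ycoeff (pinv \<epsilon>) m s = 0" if "0 < s" "s < m"
      by (rule ycoeff_root_of_unity) (use eta_facts[OF odd_m prim] that in auto)
    ultimately show ?thesis using that by auto
  qed
  have "eq_at \<epsilon> (\<Sum>s\<le>m. sc (\<lambda>q. ycoeff (pinv q) m s) * osc i m s)
      (\<Sum>s\<le>m. sc (\<lambda>q. if s = 0 \<or> s = m then 1 else 0) * osc i m s)"
    by (intro eq_at_sum eq_at_mult eq_at_sc eq_at_refl) (simp add: c)
  moreover have "(\<Sum>s\<le>m. sc (\<lambda>q. if s = 0 \<or> s = m then 1 else 0) * osc i m s)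
      = (\<Sum>s\<in>{0, m}. osc i m s)"
    by (rule sum.mono_neutral_cong_right) auto
  moreover have "(\<Sum>s\<in>{0, m}. osc i m s) = yb {i<..} ^ m + zb (Inl i) ^ m * zb (Inr i) ^ m"
    using root by (simp add: osc_def)
  ultimately show ?thesis unfolding y0_power by simp
qed

lemma yb_power_aux:
  "final_segment L \<Longrightarrow> eq_at \<epsilon> (yb (set L) ^ m) (\<Sum>k\<in>set L. zb (Inl k) ^ m * zb (Inr k) ^ m)"
proof (induction L)
  case Nil
  then show ?case using root_facts[OF odd_m prim] by (cases m) (simp_all add: yb_def)
next
  case (Cons i L)
  note fs = final_segment_Cons[OF Cons.prems]
  have "eq_at \<epsilon> (yb {i..} ^ m) (yb {i<..} ^ m + zb (Inl i) ^ m * zb (Inr i) ^ m)"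
    by (rule yb_power_step)
  also have "eq_at \<epsilon> \<dots> ((\<Sum>k\<in>set L. zb (Inl k) ^ m * zb (Inr k) ^ m) + zb (Inl i) ^ m * zb (Inr i) ^ m)"
    unfolding fs(2)[symmetric] by (intro eq_at_add Cons.IH fs(1) eq_at_refl)
  also have "(\<Sum>k\<in>set L. zb (Inl k) ^ m * zb (Inr k) ^ m) + zb (Inl i) ^ m * zb (Inr i) ^ m
      = (\<Sum>k\<in>set (i # L). zb (Inl k) ^ m * zb (Inr k) ^ m)"
    using fs(4) by simp
  finally show ?case unfolding fs(3) .
qed

lemma yb_power: "eq_at \<epsilon> (yb {i..} ^ m) (\<Sum>k\<in>{i..}. zb (Inl k) ^ m * zb (Inr k) ^ m)"
proof -
  obtain pre L where L: "idxs = pre @ i # L" "final_segment (i # L)" by (rule idxs_split)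
  show ?thesis using yb_power_aux[OF L(2)] unfolding final_segment_Cons(3)[OF L(2)] .
qed

end

section \<open>The Poisson brackets of the coordinates\<close>

text \<open>Independence of the ordered monomials makes the description in
  \<open>basis_coeffs\<close> unique, so any known expansion may be read off.\<close>

lemma basis_coeffs_eq:
  assumes q: "q \<noteq> 0" and A: "finite A"
    and eq: "eq_in_B q f (\<Sum>\<alpha>\<in>A. scalar (c \<alpha>) * ordered_monomial \<alpha>)"
  shows "Poly_Mapping.lookup (basis_coeffs q f) \<alpha> = (if \<alpha> \<in> A then c \<alpha> else 0)"
proof -
  define c0 where "c0 = (\<Sum>\<alpha>\<in>A. Poly_Mapping.single \<alpha> (c \<alpha>))"
  have lk: "Poly_Mapping.lookup c0 \<beta> = (if \<beta> \<in> A then c \<beta> else 0)" for \<beta>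
    using A by (simp add: c0_def lookup_sum lookup_single when_def)
  let ?S = "\<lambda>c. \<Sum>\<alpha>\<in>Poly_Mapping.keys c. scalar (Poly_Mapping.lookup c \<alpha>) * ordered_monomial \<alpha>"
  have sup: "?S c = (\<Sum>\<alpha>\<in>D. scalar (Poly_Mapping.lookup c \<alpha>) * ordered_monomial \<alpha>)"
    if "finite D" "Poly_Mapping.keys c \<subseteq> D" for c :: "('a gen \<Rightarrow> nat) \<Rightarrow>\<^sub>0 complex" and D
    by (rule sum.mono_neutral_left) (use that in \<open>auto simp: in_keys_iff\<close>)
  have "Poly_Mapping.keys c0 \<subseteq> A" by (auto simp: in_keys_iff lk split: if_splits)
  then have "?S c0 = (\<Sum>\<alpha>\<in>A. scalar (c \<alpha>) * ordered_monomial \<alpha>)"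
    by (subst sup[OF A]) (auto simp: lk)
  then have c0: "eq_in_B q f (?S c0)" using eq by simp
  have "basis_coeffs q f = c0"
    unfolding basis_coeffs_def
  proof (rule the_equality)
    show "eq_in_B q f (?S c0)" by (rule c0)
    fix c' assume c': "eq_in_B q f (?S c')"
    let ?D = "Poly_Mapping.keys c0 \<union> Poly_Mapping.keys c'"
    let ?d = "\<lambda>\<alpha>. Poly_Mapping.lookup c0 \<alpha> - Poly_Mapping.lookup c' \<alpha>"
    have "eq_in_B q (?S c0) (?S c')" using c0 c' eq_in_B_sym eq_in_B_trans by blast
    then have "eq_in_B q (?S c0 - ?S c') 0" by (simp add: eq_in_B_def)
    also have "?S c0 - ?S c' = (\<Sum>\<alpha>\<in>?D. scalar (?d \<alpha>) * ordered_monomial \<alpha>)"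
      by (simp add: sup[of ?D] scalar_diff left_diff_distrib sum_subtractf)
    finally have d0: "?d \<alpha> = 0" if "\<alpha> \<in> ?D" for \<alpha>
      using ordered_monomials_independent[OF q, of ?D ?d \<alpha>] that by simp
    have "Poly_Mapping.lookup c' \<alpha> = Poly_Mapping.lookup c0 \<alpha>" for \<alpha>
    proof (cases "\<alpha> \<in> ?D")
      case True
      then show ?thesis using d0[OF True] by simp
    qed (simp add: in_keys_iff)
    then show "c' = c0" by (rule poly_mapping_eqI)
  qed
  then show ?thesis using lk by simp
qed

lemma lookup_in_powers:
  "Poly_Mapping.lookup (in_powers m P) \<alpha> = (\<Sum>\<beta>\<in>Poly_Mapping.keys P. if (\<lambda>x. m * \<beta> x) = \<alpha> then Poly_Mapping.lookup P \<beta> else 0)"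
  by (simp add: in_powers_def lookup_sum lookup_single when_def)

lemma lookup_in_powers_multiple:
  assumes "m > 0"
  shows "Poly_Mapping.lookup (in_powers m P) (\<lambda>x. m * \<beta> x) = Poly_Mapping.lookup P \<beta>"
proof -
  have "(\<lambda>x. m * \<gamma> x) = (\<lambda>x. m * \<beta> x) \<longleftrightarrow> \<gamma> = \<beta>" for \<gamma> using assms by (auto simp: fun_eq_iff)
  then show ?thesis unfolding lookup_in_powers by (auto simp: in_keys_iff)
qed

definition poly_of :: "('g \<Rightarrow> nat) set \<Rightarrow> (('g \<Rightarrow> nat) \<Rightarrow> complex) \<Rightarrow> (('g \<Rightarrow> nat) \<Rightarrow>\<^sub>0 complex)" where
  "poly_of B c = (\<Sum>\<beta>\<in>B. Poly_Mapping.single \<beta> (c \<beta>))"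

lemma lookup_poly_of: "finite B \<Longrightarrow> Poly_Mapping.lookup (poly_of B c) \<beta> = (if \<beta> \<in> B then c \<beta> else 0)"
  by (simp add: poly_of_def lookup_sum lookup_single when_def)

lemma lookup_in_powers_poly_of:
  assumes "finite B" "m > 0"
  shows "Poly_Mapping.lookup (in_powers m (poly_of B c)) \<alpha> = (\<Sum>\<beta>\<in>B. if (\<lambda>x. m * \<beta> x) = \<alpha> then c \<beta> else 0)"
  unfolding lookup_in_powers
  by (rule sum.mono_neutral_cong_left)
    (use assms in \<open>auto simp: in_keys_iff lookup_poly_of split: if_splits\<close>)

lemma eval_poly_of:
  assumes "finite B"
  shows "eval_poly (poly_of B c) p = (\<Sum>\<beta>\<in>B. c \<beta> * (\<Prod>x\<in>UNIV. (p $ x) ^ \<beta> x))"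
  unfolding eval_poly_def
  by (rule sum.mono_neutral_cong_left)
    (use assms in \<open>auto simp: in_keys_iff lookup_poly_of split: if_splits\<close>)

context
  fixes \<epsilon> :: complex and m :: nat
  assumes odd_m: "odd m" and prim: "primitive_root_of_unity m \<epsilon>"
begin

lemma coord_bracket_eqI:
  assumes lim: "\<And>\<alpha>. ((\<lambda>q. Poly_Mapping.lookup
      (basis_coeffs q (gvar x ^ m * gvar y ^ m - gvar y ^ m * gvar x ^ m)) \<alpha> / (of_nat m * (q ^ m - 1)))
        \<longlongrightarrow> Poly_Mapping.lookup (in_powers m P) \<alpha>) (at \<epsilon> within generic)"
  shows "coord_bracket \<epsilon> m x y = P"
  unfolding coord_bracket_def
proof (rule the_equality)
  note root = root_facts[OF odd_m prim]
  note nt = generic_nontrivial[OF root(2,1)]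
  fix P' assume P': "\<forall>\<alpha>. ((\<lambda>q. Poly_Mapping.lookup
      (basis_coeffs q (gvar x ^ m * gvar y ^ m - gvar y ^ m * gvar x ^ m)) \<alpha> / (of_nat m * (q ^ m - 1)))
        \<longlongrightarrow> Poly_Mapping.lookup (in_powers m P') \<alpha>) (at \<epsilon> within generic)"
  show "P' = P"
  proof (rule poly_mapping_eqI)
    fix \<beta>
    have "Poly_Mapping.lookup (in_powers m P') (\<lambda>x. m * \<beta> x) = Poly_Mapping.lookup (in_powers m P) (\<lambda>x. m * \<beta> x)"
      by (rule tendsto_unique[OF nt P'[rule_format] lim])
    then show "Poly_Mapping.lookup P' \<beta> = Poly_Mapping.lookup P \<beta>"
      using lookup_in_powers_multiple[OF root(1)] by metis
  qed
qed (intro allI lim)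

text \<open>The expansions of the \<open>Q r\<close> in ordered monomials need not be known
  explicitly, only to exist with continuous coefficients. It suffices to find the limits of the
  scalars \<open>d r\<close> and to identify the resulting combination at \<epsilon> with a
  polynomial in m-th powers.\<close>

lemma coord_bracket_limit:
  fixes Q :: "'r \<Rightarrow> ('n::{finite,linorder}) balg"
  assumes R: "finite R" and B: "finite B"
    and comm: "zb x ^ m * zb y ^ m - zb y ^ m * zb x ^ m = (\<Sum>r\<in>R. sc (d r) * Q r)"
    and Q: "\<And>r. r \<in> R \<Longrightarrow> expandable idxs (Q r)"
    and d: "\<And>r. r \<in> R \<Longrightarrow> ((\<lambda>q. d r q / (of_nat m * (q ^ m - 1))) \<longlongrightarrow> l r) (at \<epsilon> within generic)"
    and special: "eq_at \<epsilon> (\<Sum>r\<in>R. sc (\<lambda>q. l r) * Q r) (\<Sum>\<beta>\<in>B. sc (\<lambda>q. c \<beta>) * omon idxs (\<lambda>x. m * \<beta> x))"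
  shows "coord_bracket \<epsilon> m x y = poly_of B c"
proof (rule coord_bracket_eqI)
  note root = root_facts[OF odd_m prim]
  let ?comm = "gvar x ^ m * gvar y ^ m - gvar y ^ m * gvar x ^ m :: 'n free_alg"
  have "\<forall>r\<in>R. \<exists>A K. finite A \<and> (\<forall>\<alpha>\<in>A. continuous_on (- {0}) (K \<alpha>)) \<and> Q r = (\<Sum>\<alpha>\<in>A. sc (K \<alpha>) * omon idxs \<alpha>)"
    using Q unfolding expandable_def by blast
  from bchoice[OF this] obtain A0 where "\<forall>r\<in>R. \<exists>K. finite (A0 r)
      \<and> (\<forall>\<alpha>\<in>A0 r. continuous_on (- {0}) (K \<alpha>)) \<and> Q r = (\<Sum>\<alpha>\<in>A0 r. sc (K \<alpha>) * omon idxs \<alpha>)"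
    by blast
  from bchoice[OF this] obtain K0 where AK: "\<And>r. r \<in> R \<Longrightarrow> finite (A0 r)"
    "\<And>r \<alpha>. r \<in> R \<Longrightarrow> \<alpha> \<in> A0 r \<Longrightarrow> continuous_on (- {0}) (K0 r \<alpha>)"
    "\<And>r. r \<in> R \<Longrightarrow> Q r = (\<Sum>\<alpha>\<in>A0 r. sc (K0 r \<alpha>) * omon idxs \<alpha>)"
    by blast
  define mB where "mB = (\<lambda>\<beta> x. m * \<beta> x) ` B"
  \<comment> \<open>Including the monomials of the target polynomial lets both sides at \<epsilon>
    be compared over one index set.\<close>
  define A where "A = (\<Union>r\<in>R. A0 r) \<union> mB"
  define K where "K = (\<lambda>r \<alpha> q. if \<alpha> \<in> A0 r then K0 r \<alpha> q else 0)"
  have A: "finite A" using R B AK(1) by (auto simp: A_def mB_def)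
  have Kc: "continuous_on (- {0}) (K r \<alpha>)" if "r \<in> R" for r \<alpha>
    using AK(2)[OF that, of \<alpha>] by (cases "\<alpha> \<in> A0 r") (simp_all add: K_def)
  have QK: "Q r = (\<Sum>\<alpha>\<in>A. sc (K r \<alpha>) * omon idxs \<alpha>)" if "r \<in> R" for r
    unfolding AK(3)[OF that]
    by (rule sum.mono_neutral_cong_left) (use A that in \<open>auto simp: A_def K_def\<close>)
  have swap: "(\<Sum>r\<in>R. sc (h r) * Q r) = cls (\<lambda>q. \<Sum>\<alpha>\<in>A. scalar (\<Sum>r\<in>R. h r q * K r \<alpha> q) * ordered_monomial \<alpha>)"
    for h :: "'r \<Rightarrow> complex \<Rightarrow> complex"
  proof -
    have sc_sum: "sc (\<lambda>q. \<Sum>r\<in>R. f r q) = (\<Sum>r\<in>R. sc (f r))" for f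
      using R by (induction R rule: finite_induct) (simp_all add: sc_add)
    have "(\<Sum>r\<in>R. sc (h r) * Q r) = (\<Sum>r\<in>R. \<Sum>\<alpha>\<in>A. sc (\<lambda>q. h r q * K r \<alpha> q) * omon idxs \<alpha>)"
      by (intro sum.cong refl) (simp add: QK sum_distrib_left sc_mult mult.assoc)
    also have "\<dots> = (\<Sum>\<alpha>\<in>A. sc (\<lambda>q. \<Sum>r\<in>R. h r q * K r \<alpha> q) * omon idxs \<alpha>)"
      by (subst sum.swap) (simp add: sc_sum sum_distrib_right)
    also have "\<dots> = cls (\<lambda>q. \<Sum>\<alpha>\<in>A. scalar (\<Sum>r\<in>R. h r q * K r \<alpha> q) * ordered_monomial \<alpha>)"
      by (simp only: cls_sum cls_mult cls_scalar cls_ordered_monomial)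
    finally show ?thesis .
  qed
  have "cls (\<lambda>q. ?comm) = zb x ^ m * zb y ^ m - zb y ^ m * zb x ^ m"
    by (simp only: cls_simps)
  then have eq: "eq_in_B q ?comm (\<Sum>\<alpha>\<in>A. scalar (\<Sum>r\<in>R. d r q * K r \<alpha> q) * ordered_monomial \<alpha>)" if "q \<noteq> 0" for q
    using cls_eqD[OF _ that] unfolding comm swap by fast
  define e where "e = (\<lambda>\<alpha>. \<Sum>\<beta>\<in>B. if (\<lambda>x. m * \<beta> x) = \<alpha> then c \<beta> else 0)"
  have "eq_at \<epsilon> (cls (\<lambda>q. \<Sum>\<alpha>\<in>A. scalar (\<Sum>r\<in>R. l r * K r \<alpha> q) * ordered_monomial \<alpha>))
      (\<Sum>\<beta>\<in>B. sc (\<lambda>q. c \<beta>) * omon idxs (\<lambda>x. m * \<beta> x))"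
    using special unfolding swap .
  also have "(\<Sum>\<beta>\<in>B. sc (\<lambda>q. c \<beta>) * omon idxs (\<lambda>x. m * \<beta> x))
      = cls (\<lambda>q. \<Sum>\<beta>\<in>B. scalar (c \<beta>) * ordered_monomial (\<lambda>x. m * \<beta> x))"
    by (simp only: cls_sum cls_mult cls_scalar cls_ordered_monomial)
  finally have "eq_in_B \<epsilon> (\<Sum>\<alpha>\<in>A. scalar (\<Sum>r\<in>R. l r * K r \<alpha> \<epsilon>) * ordered_monomial \<alpha>)
      (\<Sum>\<beta>\<in>B. scalar (c \<beta>) * ordered_monomial (\<lambda>x. m * \<beta> x))"
    unfolding eq_at_cls[OF root(3)] .
  also have "(\<Sum>\<beta>\<in>B. scalar (c \<beta>) * ordered_monomial (\<lambda>x. m * \<beta> x) :: 'n free_alg)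
      = (\<Sum>\<alpha>\<in>A. scalar (e \<alpha>) * ordered_monomial \<alpha>)"
  proof -
    have se: "scalar (e \<alpha>) = (\<Sum>\<beta>\<in>B. if (\<lambda>x. m * \<beta> x) = \<alpha> then scalar (c \<beta>) else 0 :: 'n free_alg)" for \<alpha>
      unfolding e_def using B by (induction B rule: finite_induct) (auto simp: scalar_add)
    have "(\<Sum>\<alpha>\<in>A. scalar (e \<alpha>) * ordered_monomial \<alpha>)
        = (\<Sum>\<beta>\<in>B. \<Sum>\<alpha>\<in>A. if (\<lambda>x. m * \<beta> x) = \<alpha> then scalar (c \<beta>) * ordered_monomial \<alpha> else 0 :: 'n free_alg)"
      unfolding se sum_distrib_right by (subst sum.swap) (intro sum.cong refl, simp)
    also have "\<dots> = (\<Sum>\<beta>\<in>B. scalar (c \<beta>) * ordered_monomial (\<lambda>x. m * \<beta> x))"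
      by (intro sum.cong refl) (use A in \<open>auto simp: A_def mB_def\<close>)
    finally show ?thesis by simp
  qed
  finally have "eq_in_B \<epsilon> ((\<Sum>\<alpha>\<in>A. scalar (\<Sum>r\<in>R. l r * K r \<alpha> \<epsilon>) * ordered_monomial \<alpha>)
      - (\<Sum>\<alpha>\<in>A. scalar (e \<alpha>) * ordered_monomial \<alpha>)) 0"
    by (simp add: eq_in_B_def)
  then have "eq_in_B \<epsilon> (\<Sum>\<alpha>\<in>A. scalar ((\<Sum>r\<in>R. l r * K r \<alpha> \<epsilon>) - e \<alpha>) * ordered_monomial \<alpha>) 0"
    by (simp add: sum_subtractf scalar_diff left_diff_distrib)
  then have val: "(\<Sum>r\<in>R. l r * K r \<alpha> \<epsilon>) = e \<alpha>" if "\<alpha> \<in> A" for \<alpha>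
    using ordered_monomials_independent[OF root(3) A _ that] by fastforce
  fix \<alpha>
  let ?den = "\<lambda>q::complex. of_nat m * (q ^ m - 1)"
  have ev: "\<forall>\<^sub>F q in at \<epsilon> within generic. (if \<alpha> \<in> A then \<Sum>r\<in>R. d r q / ?den q * K r \<alpha> q else 0)
      = Poly_Mapping.lookup (basis_coeffs q ?comm) \<alpha> / ?den q"
  proof (rule eventually_mono[OF eventually_generic[OF odd_m prim]])
    fix q :: complex assume "q \<noteq> 0 \<and> q ^ m \<noteq> 1"
    then show "(if \<alpha> \<in> A then \<Sum>r\<in>R. d r q / ?den q * K r \<alpha> q else 0)
      = Poly_Mapping.lookup (basis_coeffs q ?comm) \<alpha> / ?den q"
      using basis_coeffs_eq[OF _ A eq, of q \<alpha>] by (simp add: sum_divide_distrib)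
  qed
  have "((\<lambda>q. if \<alpha> \<in> A then \<Sum>r\<in>R. d r q / ?den q * K r \<alpha> q else 0) \<longlongrightarrow> e \<alpha>) (at \<epsilon> within generic)"
  proof (cases "\<alpha> \<in> A")
    case True
    have "((\<lambda>q. \<Sum>r\<in>R. d r q / ?den q * K r \<alpha> q) \<longlongrightarrow> (\<Sum>r\<in>R. l r * K r \<alpha> \<epsilon>)) (at \<epsilon> within generic)"
      by (intro tendsto_sum tendsto_mult d tendsto_generic[OF odd_m prim Kc])
    then show ?thesis using True val by simp
  next
    case False
    then have "e \<alpha> = 0" unfolding e_def by (intro sum.neutral) (auto simp: A_def mB_def)
    then show ?thesis using False by simp
  qed
  then have "((\<lambda>q. Poly_Mapping.lookup (basis_coeffs q ?comm) \<alpha> / ?den q) \<longlongrightarrow> e \<alpha>) (at \<epsilon> within generic)"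
    by (rule Lim_transform_eventually[OF _ ev])
  then show "((\<lambda>q. Poly_Mapping.lookup (basis_coeffs q ?comm) \<alpha> / ?den q)
      \<longlongrightarrow> Poly_Mapping.lookup (in_powers m (poly_of B c)) \<alpha>) (at \<epsilon> within generic)"
    using lookup_in_powers_poly_of[OF B root(1)] by (simp add: e_def)
qed


end

lemma prod_list_filter:
  fixes f :: "'i \<Rightarrow> 'a::monoid_mult"
  assumes "\<And>i. \<not> P i \<Longrightarrow> f i = 1" shows "prod_list (map f L) = prod_list (map f (filter P L))"
  by (induction L) (auto simp: assms)

lemma idxs_filter: "filter (\<lambda>k. k = i) idxs = [i]" "i < j \<Longrightarrow> filter (\<lambda>k. k = i \<or> k = j) idxs = [i, j]"
  by (rule sorted_distinct_set_unique; auto simp: sorted_wrt_filter)+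

lemma omon_conjugate_pair:
  "omon idxs (\<lambda>w. if idx w = k then n else 0) = zb (Inl k) ^ n * zb (Inr k) ^ n"
proof -
  have "prod_list (map (\<lambda>i. zb (Inl i) ^ (if i = k then n else 0)) idxs) = zb (Inl k) ^ n"
    by (subst prod_list_filter[where P = "\<lambda>i. i = k"]) (simp_all add: idxs_filter)
  moreover have "prod_list (map (\<lambda>i. zb (Inr i) ^ (if i = k then n else 0)) (rev idxs)) = zb (Inr k) ^ n"
    by (subst prod_list_filter[where P = "\<lambda>i. i = k"]) (simp_all add: idxs_filter flip: rev_filter)
  ultimately show ?thesis by (simp add: omon_def)
qed

fun precedes :: "('n::linorder) gen \<Rightarrow> 'n gen \<Rightarrow> bool" where
  "precedes (Inl i) (Inl j) \<longleftrightarrow> i < j"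
| "precedes (Inr i) (Inr j) \<longleftrightarrow> j < i"
| "precedes (Inl i) (Inr j) \<longleftrightarrow> True"
| "precedes (Inr i) (Inl j) \<longleftrightarrow> False"

lemma omon_pair:
  assumes "precedes x y" "idx x \<noteq> idx y"
  shows "omon idxs (\<lambda>w. if w = x \<or> w = y then n else 0) = zb x ^ n * zb y ^ n"
proof -
  have none: "prod_list (map (\<lambda>i. 1) L) = (1 :: 'a balg)" for L :: "'a list" by (induction L) auto
  have l1: "prod_list (map (\<lambda>k. zb (Inl k) ^ (if k = i then n else 0)) idxs) = zb (Inl i) ^ n" for i :: 'a
    by (subst prod_list_filter[where P = "\<lambda>k. k = i"]) (simp_all add: idxs_filter)
  have r1: "prod_list (map (\<lambda>k. zb (Inr k) ^ (if k = i then n else 0)) (rev idxs)) = zb (Inr i) ^ n" for i :: 'a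
    by (subst prod_list_filter[where P = "\<lambda>k. k = i"]) (simp_all add: idxs_filter flip: rev_filter)
  have l2: "prod_list (map (\<lambda>k. zb (Inl k) ^ (if k = i \<or> k = j then n else 0)) idxs) = zb (Inl i) ^ n * zb (Inl j) ^ n"
    if "i < j" for i j :: 'a
    by (subst prod_list_filter[where P = "\<lambda>k. k = i \<or> k = j"]) (use that in \<open>simp_all add: idxs_filter\<close>)
  have r2: "prod_list (map (\<lambda>k. zb (Inr k) ^ (if k = j \<or> k = i then n else 0)) (rev idxs)) = zb (Inr j) ^ n * zb (Inr i) ^ n"
    if "i < j" for i j :: 'a
    by (subst prod_list_filter[where P = "\<lambda>k. k = i \<or> k = j"])
      (use that in \<open>auto simp: idxs_filter simp flip: rev_filter\<close>)
  show ?thesis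
  proof (cases x; cases y)
    fix i j assume "x = Inl i" "y = Inl j"
    then show ?thesis using assms by (simp add: omon_def l2 none)
  next
    fix i j assume "x = Inl i" "y = Inr j"
    then show ?thesis using assms by (simp add: omon_def l1 r1)
  next
    fix i j assume "x = Inr i" "y = Inl j"
    then show ?thesis using assms by simp
  next
    fix i j assume "x = Inr i" "y = Inr j"
    then show ?thesis using assms r2[of j i] by (simp add: omon_def none)
  qed
qed

context
  fixes \<epsilon> :: complex and m :: nat
  assumes odd_m: "odd m" and prim: "primitive_root_of_unity m \<epsilon>"
begin

lemma minus_diff_divide: "- ((a - b) / c) = (b - a) / (c :: complex)"
  by (simp add: minus_divide_left)

lemma limit_qq:
  "((\<lambda>q. (qq q y ^ (m * m) - 1) / (of_nat m * (q ^ m - 1))) \<longlongrightarrow> - tau y) (at \<epsilon> within generic)"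
  "((\<lambda>q. (1 - inverse (qq q y) ^ (m * m)) / (of_nat m * (q ^ m - 1))) \<longlongrightarrow> - tau y) (at \<epsilon> within generic)"
proof -
  note root = root_facts[OF odd_m prim]
  have 1: "((\<lambda>q. (1 - q ^ (m * m)) / (of_nat m * (q ^ m - 1))) \<longlongrightarrow> - 1) (at \<epsilon> within generic)"
    by (rule limit_commutator_q[OF odd_m prim])
  have "complex_of_nat m / of_nat m = 1" using root by simp
  then have 2: "((\<lambda>q. (1 - inverse q ^ (m * m)) / (of_nat m * (q ^ m - 1))) \<longlongrightarrow> 1) (at \<epsilon> within generic)"
    using limit_inverse_power[OF odd_m prim, of m] by simp
  have m1: "((\<lambda>q. (q ^ (m * m) - 1) / (of_nat m * (q ^ m - 1))) \<longlongrightarrow> 1) (at \<epsilon> within generic)"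
    using tendsto_minus[OF 1] unfolding minus_diff_divide by simp
  have m2: "((\<lambda>q. (inverse q ^ (m * m) - 1) / (of_nat m * (q ^ m - 1))) \<longlongrightarrow> - 1) (at \<epsilon> within generic)"
    using tendsto_minus[OF 2] unfolding minus_diff_divide by simp
  show "((\<lambda>q. (qq q y ^ (m * m) - 1) / (of_nat m * (q ^ m - 1))) \<longlongrightarrow> - tau y) (at \<epsilon> within generic)"
    using m1 m2 by (cases y) simp_all
  show "((\<lambda>q. (1 - inverse (qq q y) ^ (m * m)) / (of_nat m * (q ^ m - 1))) \<longlongrightarrow> - tau y) (at \<epsilon> within generic)"
    using 1 2 by (cases y) simp_all
qed

lemma zb_power_commute:
  fixes x y :: "('n::{finite,linorder}) gen"
  assumes "idx x < idx y"
  shows "zb x ^ m * zb y ^ m = sc (\<lambda>q. qq q y ^ (m * m)) * (zb y ^ m * zb x ^ m)"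
    "zb y ^ m * zb x ^ m = sc (\<lambda>q. inverse (qq q y) ^ (m * m)) * (zb x ^ m * zb y ^ m)"
proof -
  show 1: "zb x ^ m * zb y ^ m = sc (\<lambda>q. qq q y ^ (m * m)) * (zb y ^ m * zb x ^ m)"
    by (rule sc_commute_power[OF zb_commute[OF assms]])
  have "sc (\<lambda>q. inverse (qq q y) ^ (m * m) * qq q y ^ (m * m)) = (sc (\<lambda>q. 1) :: 'n balg)"
    by (rule sc_cong) (simp flip: power_mult_distrib)
  then show "zb y ^ m * zb x ^ m = sc (\<lambda>q. inverse (qq q y) ^ (m * m)) * (zb x ^ m * zb y ^ m)"
    unfolding 1 sc_mult_left by (simp only: sc_1 mult_1_left)
qed

text \<open>The commutator is a scalar multiple of one of the two products, namely the one in normal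
  order. Which of them it is changes the form of the scalar but not its limit.\<close>

lemma coord_bracket_distinct:
  fixes x y :: "('n::{finite,linorder}) gen"
  assumes ne: "idx x \<noteq> idx y"
  shows "eval_poly (coord_bracket \<epsilon> m x y) p = poisson_entry UNIV (\<lambda>x. p $ x) x y"
proof -
  define \<beta> where "\<beta> = (\<lambda>w. if w = x \<or> w = y then 1 else 0 :: nat)"
  define c where "c = (if idx x < idx y then - tau y else tau x)"
  have m\<beta>: "(\<lambda>w. m * \<beta> w) = (\<lambda>w. if w = x \<or> w = y then m else 0)" by (auto simp: \<beta>_def)
  let ?Q = "omon idxs (\<lambda>w. m * \<beta> w)"
  have "precedes x y \<or> precedes y x" using ne by (cases x; cases y) auto
  then have Q: "?Q = zb x ^ m * zb y ^ m \<or> ?Q = zb y ^ m * zb x ^ m"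
  proof
    assume "precedes x y"
    then show ?thesis unfolding m\<beta> using omon_pair[of x y m] ne by simp
  next
    assume "precedes y x"
    then show ?thesis unfolding m\<beta> using omon_pair[of y x m] ne by (simp add: disj_commute)
  qed
  have "\<exists>d. zb x ^ m * zb y ^ m - zb y ^ m * zb x ^ m = sc d * ?Q
      \<and> ((\<lambda>q. d q / (of_nat m * (q ^ m - 1))) \<longlongrightarrow> c) (at \<epsilon> within generic)"
  proof (cases "idx x < idx y")
    case True
    note pc = zb_power_commute[OF True]
    from Q show ?thesis
    proof
      assume Q: "?Q = zb x ^ m * zb y ^ m"
      show ?thesis unfolding Q using limit_qq(2)[of y] True
        by (intro exI[of _ "\<lambda>q. 1 - inverse (qq q y) ^ (m * m)"])
          (simp add: c_def sc_diff left_diff_distrib pc(2)[symmetric])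
    next
      assume Q: "?Q = zb y ^ m * zb x ^ m"
      show ?thesis unfolding Q using limit_qq(1)[of y] True
        by (intro exI[of _ "\<lambda>q. qq q y ^ (m * m) - 1"])
          (simp add: c_def sc_diff left_diff_distrib pc(1)[symmetric])
    qed
  next
    case False
    then have lt: "idx y < idx x" using ne by simp
    note pc = zb_power_commute[OF lt]
    have l: "((\<lambda>q. (1 - qq q x ^ (m * m)) / (of_nat m * (q ^ m - 1))) \<longlongrightarrow> tau x) (at \<epsilon> within generic)"
      "((\<lambda>q. (inverse (qq q x) ^ (m * m) - 1) / (of_nat m * (q ^ m - 1))) \<longlongrightarrow> tau x) (at \<epsilon> within generic)"
      using tendsto_minus[OF limit_qq(1)[of x]] tendsto_minus[OF limit_qq(2)[of x]]
      unfolding minus_diff_divide by simp_all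
    from Q show ?thesis
    proof
      assume Q: "?Q = zb x ^ m * zb y ^ m"
      show ?thesis unfolding Q using l(1) False
        by (intro exI[of _ "\<lambda>q. 1 - qq q x ^ (m * m)"])
          (simp add: c_def sc_diff left_diff_distrib pc(1)[symmetric])
    next
      assume Q: "?Q = zb y ^ m * zb x ^ m"
      show ?thesis unfolding Q using l(2) False
        by (intro exI[of _ "\<lambda>q. inverse (qq q x) ^ (m * m) - 1"])
          (simp add: c_def sc_diff left_diff_distrib pc(2)[symmetric])
    qed
  qed
  then obtain d where d: "zb x ^ m * zb y ^ m - zb y ^ m * zb x ^ m = sc d * ?Q"
    "((\<lambda>q. d q / (of_nat m * (q ^ m - 1))) \<longlongrightarrow> c) (at \<epsilon> within generic)" by blast
  have "coord_bracket \<epsilon> m x y = poly_of {\<beta>} (\<lambda>_. c)"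
    by (rule coord_bracket_limit[OF odd_m prim, where R = "{()}" and d = "\<lambda>_. d" and l = "\<lambda>_. c" and Q = "\<lambda>_. ?Q"])
      (use d expandable_omon in auto)
  then have "eval_poly (coord_bracket \<epsilon> m x y) p = c * (\<Prod>w\<in>UNIV. (p $ w) ^ \<beta> w)"
    by (simp add: eval_poly_of)
  also have "(\<Prod>w\<in>UNIV. (p $ w) ^ \<beta> w) = (\<Prod>w\<in>{x, y}. p $ w)"
    by (rule prod.mono_neutral_cong_right) (auto simp: \<beta>_def)
  also have "\<dots> = p $ x * p $ y"
  proof -
    have "x \<noteq> y" using ne by metis
    then show ?thesis by simp
  qed
  finally show ?thesis using ne by (auto simp: poisson_entry_def c_def)
qed

lemma coord_bracket_conjugate:
  fixes x :: "('n::{finite,linorder}) gen"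
  shows "eval_poly (coord_bracket \<epsilon> m x (star x)) p = poisson_entry UNIV (\<lambda>x. p $ x) x (star x)"
proof -
  note root = root_facts[OF odd_m prim]
  define i where "i = idx x"
  let ?pr = "\<lambda>k w. if idx w = k then 1 else 0 :: nat"
  have mpr: "(\<lambda>w. m * ?pr k w) = (\<lambda>w. if idx w = k then m else 0)" for k :: 'n by auto
  have inj: "inj_on ?pr A" for A :: "'n set"
  proof (rule inj_onI)
    fix k l :: 'n assume "?pr k = ?pr l"
    from fun_cong[OF this, of "Inl k"] show "k = l" by (simp split: if_splits)
  qed
  let ?d = "\<lambda>s q. tau x * ((if s = m then 1 else 0) - zcoeff (pinv q) m s)"
  let ?l = "\<lambda>s. tau x * (if s = 0 \<or> s = m then 2 else 0)"
  have "coord_bracket \<epsilon> m x (star x) = poly_of (?pr ` {i..}) (\<lambda>_. tau x * 2)"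
  proof (rule coord_bracket_limit[OF odd_m prim, where R = "{..m}" and d = ?d and l = ?l and Q = "osc i m"])
    have *: "(\<Sum>s\<le>m. sc (?d s) * osc i m s)
        = sc (\<lambda>q. tau x) * (zb (Inl i) ^ m * zb (Inr i) ^ m - zb (Inr i) ^ m * zb (Inl i) ^ m)"
      unfolding commutator_expansion sum_distrib_left sc_mult_left ..
    have "sc (\<lambda>q. - 1) = (- 1 :: 'n balg)" using sc_minus[of "\<lambda>q. 1"] by simp
    then show "zb x ^ m * zb (star x) ^ m - zb (star x) ^ m * zb x ^ m = (\<Sum>s\<le>m. sc (?d s) * osc i m s)"
      unfolding * by (cases x) (simp_all add: i_def)
    show "((\<lambda>q. ?d s q / (of_nat m * (q ^ m - 1))) \<longlongrightarrow> ?l s) (at \<epsilon> within generic)" if "s \<in> {..m}" for s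
      unfolding times_divide_eq_right[symmetric]
      by (intro tendsto_mult tendsto_const limit_zcoeff[OF odd_m prim]) (use that in simp)
    have "(\<Sum>s\<le>m. sc (\<lambda>q. ?l s) * osc i m s) = (\<Sum>s\<in>{0, m}. sc (\<lambda>q. tau x * 2) * osc i m s)"
      by (rule sum.mono_neutral_cong_right) auto
    also have "\<dots> = sc (\<lambda>q. tau x * 2) * (yb {i<..} ^ m + zb (Inl i) ^ m * zb (Inr i) ^ m)"
      using root by (simp add: osc_def distrib_left)
    also have "eq_at \<epsilon> \<dots> (sc (\<lambda>q. tau x * 2) * (\<Sum>k\<in>{i..}. zb (Inl k) ^ m * zb (Inr k) ^ m))"
      by (intro eq_at_mult eq_at_refl eq_at_trans[OF eq_at_sym[OF yb_power_step[OF odd_m prim]] yb_power[OF odd_m prim]])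
    also have "sc (\<lambda>q. tau x * 2) * (\<Sum>k\<in>{i..}. zb (Inl k) ^ m * zb (Inr k) ^ m)
        = (\<Sum>\<beta>\<in>?pr ` {i..}. sc (\<lambda>q. tau x * 2) * omon idxs (\<lambda>w. m * \<beta> w))"
      by (simp only: sum.reindex[OF inj] comp_def mpr omon_conjugate_pair sum_distrib_left)
    finally show "eq_at \<epsilon> (\<Sum>s\<le>m. sc (\<lambda>q. ?l s) * osc i m s)
      (\<Sum>\<beta>\<in>?pr ` {i..}. sc (\<lambda>q. tau x * 2) * omon idxs (\<lambda>w. m * \<beta> w))" .
  qed (auto simp: expandable_osc)
  then have "eval_poly (coord_bracket \<epsilon> m x (star x)) p
      = (\<Sum>k\<in>{i..}. tau x * 2 * (\<Prod>w\<in>UNIV. (p $ w) ^ ?pr k w))"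
    by (simp only: eval_poly_of finite_imageI finite sum.reindex[OF inj] comp_def)
  also have "\<dots> = (\<Sum>k\<in>{i..}. tau x * 2 * (p $ Inl k * p $ Inr k))"
  proof (intro sum.cong refl)
    fix k
    have "(\<Prod>w\<in>UNIV. (p $ w) ^ ?pr k w) = (\<Prod>w\<in>{Inl k, Inr k}. p $ w)"
    proof (rule prod.mono_neutral_cong_right)
      show "\<forall>w\<in>UNIV - {Inl k, Inr k}. (p $ w) ^ ?pr k w = 1"
      proof
        fix w assume "w \<in> UNIV - {Inl k, Inr k}"
        then have "idx w \<noteq> k" by (cases w) auto
        then show "(p $ w) ^ ?pr k w = 1" by simp
      qed
    qed auto
    then show "tau x * 2 * (\<Prod>w\<in>UNIV. (p $ w) ^ ?pr k w) = tau x * 2 * (p $ Inl k * p $ Inr k)" by simp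
  qed
  also have "\<dots> = poisson_entry UNIV (\<lambda>x. p $ x) x (star x)"
    by (simp add: poisson_entry_def casimir_def i_def sum_distrib_left atLeast_def)
  finally show ?thesis .
qed

lemma coord_bracket_same: "eval_poly (coord_bracket \<epsilon> m x x) p = 0"
proof -
  have "coord_bracket \<epsilon> m x x = poly_of {} (\<lambda>_. 0)"
    by (rule coord_bracket_limit[OF odd_m prim, where R = "{} :: unit set" and Q = "\<lambda>_. 0"]) auto
  then show ?thesis by (simp add: eval_poly_of)
qed

lemma eval_coord_bracket:
  "eval_poly (coord_bracket \<epsilon> m x y) p = poisson_entry UNIV (\<lambda>x. p $ x) x y"
proof (cases "idx x = idx y")
  case True
  then consider "x = y" | "y = star x" using idx_eq_cases[of y x] by auto
  then show ?thesis
  proof cases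
    case 1
    then show ?thesis by (simp add: coord_bracket_same poisson_entry_def)
  qed (simp add: coord_bracket_conjugate)
qed (rule coord_bracket_distinct)

end

section \<open>The dimension of a symplectic leaf\<close>

lemma coordinate_hamiltonian:
  fixes p :: "complex ^ ('n::{finite,linorder} gen)"
  shows "holomorphic_fun UNIV (\<lambda>p. p $ x)"
    and "hamiltonian \<epsilon> m (\<lambda>p. p $ x) p = (\<chi> y. eval_poly (coord_bracket \<epsilon> m x y) p)"
proof -
  have "Vector_Spaces.linear (*s) (*) (\<lambda>p. p $ x)"
    by unfold_locales (auto simp: algebra_simps)
  moreover have "((\<lambda>p. p $ x) has_derivative (\<lambda>p. p $ x)) (at p)" for p :: "complex ^ 'n gen"
    by (rule bounded_linear.has_derivative[OF bounded_linear_vec_nth has_derivative_ident])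
  ultimately show "holomorphic_fun UNIV (\<lambda>p. p $ x)" unfolding holomorphic_fun_def by blast
  have "partial_deriv u (\<lambda>p. p $ x) p = (if u = x then 1 else 0)" for u
    by (auto simp: partial_deriv_def axis_def intro!: DERIV_imp_deriv derivative_eq_intros)
  then show "hamiltonian \<epsilon> m (\<lambda>p. p $ x) p = (\<chi> y. eval_poly (coord_bracket \<epsilon> m x y) p)"
    by (simp add: hamiltonian_def if_distrib[where f = "\<lambda>t. t * _"] cong: if_cong)
qed

text \<open>Every Hamiltonian vector is a combination of those of the coordinates, which are the
  rows of the Poisson matrix. Passing to \<open>bmat\<close> only adds a zero row and column for the
  absent g.\<close>

lemma dim_hamiltonian_distribution:
  fixes p :: "complex ^ ('n::{finite,linorder} gen)"
  assumes "odd m" "primitive_root_of_unity m \<epsilon>"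
  shows "vec.dim (hamiltonian_distribution \<epsilon> m p) = mrank (bmat UNIV False (\<lambda>x. p $ x))"
proof -
  let ?N = "poisson_entry UNIV (\<lambda>x. p $ x)"
  let ?M = "bmat UNIV False (\<lambda>x. p $ x)"
  let ?R = "range (\<lambda>x. \<chi> y. ?N x y)"
  let ?H = "{hamiltonian \<epsilon> m f p | f. holomorphic_fun UNIV f}"
  note ev = eval_coord_bracket[OF assms]
  have "vec.span ?H = vec.span ?R"
  proof (rule antisym; rule vec.span_minimal[OF _ vec.subspace_span]; rule subsetI)
    fix v assume "v \<in> ?H"
    then obtain f where v: "v = hamiltonian \<epsilon> m f p" by blast
    have "v = (\<Sum>x\<in>UNIV. partial_deriv x f p *s (\<chi> y. ?N x y))"
      by (simp add: v hamiltonian_def vec_eq_iff ev)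
    also have "\<dots> \<in> vec.span ?R" by (intro vec.span_sum vec.span_scale vec.span_base) auto
    finally show "v \<in> vec.span ?R" .
  next
    fix v assume "v \<in> ?R"
    then obtain x where "v = (\<chi> y. ?N x y)" by blast
    then have "v = hamiltonian \<epsilon> m (\<lambda>p. p $ x) p" by (simp add: coordinate_hamiltonian(2) ev)
    then have "v \<in> ?H" using coordinate_hamiltonian(1) by blast
    then show "v \<in> vec.span ?H" by (rule vec.span_base)
  qed
  then have "vec.dim ?H = vec.dim ?R" by (rule vec.span_eq_dim)
  then have "vec.dim (hamiltonian_distribution \<epsilon> m p) = mrank ?N"
    unfolding hamiltonian_distribution_def mrank_def vec.dim_span .
  also have "mrank ?N = mrank ?M"
  proof (rule antisym)
    show "mrank ?N \<le> mrank ?M"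
      by (rule mrank_congruence_le[where E = "\<lambda>u x. if x = Some u then 1 else 0"])
        (simp add: if_distrib[where f = "\<lambda>t. t * _"] if_distrib[where f = "(*) _"] sum_option_UNIV cong: if_cong)
    show "mrank ?M \<le> mrank ?N"
    proof (rule mrank_congruence_le[where E = "\<lambda>u x. if u = Some x then 1 else 0"])
      show "?M u v = (\<Sum>x\<in>UNIV. \<Sum>y\<in>UNIV. (if u = Some x then 1 else 0) * (if v = Some y then 1 else 0) * ?N x y)" for u v
        by (cases u; cases v)
          (simp_all add: if_distrib[where f = "\<lambda>t. t * _"] if_distrib[where f = "(*) _"] cong: if_cong)
    qed
  qed
  finally show ?thesis .
qed

lemma holomorphic_map_derivative:
  fixes F :: "complex ^ 'g::finite \<Rightarrow> complex ^ 'g"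
  assumes "holomorphic_map W F" "p \<in> W"
  obtains D where "Vector_Spaces.linear (*s) (*s) D" "(F has_derivative D) (at p)"
proof -
  have "\<forall>x. \<exists>D. Vector_Spaces.linear (*s) (*) D \<and> ((\<lambda>p. F p $ x) has_derivative D) (at p)"
    using assms by (auto simp: holomorphic_map_def holomorphic_fun_def)
  then obtain D where D: "\<And>x. Vector_Spaces.linear (*s) (*) (D x)" "\<And>x. ((\<lambda>p. F p $ x) has_derivative D x) (at p)"
    by metis
  define T where "T = (\<lambda>v. \<chi> x. D x v)"
  have "Vector_Spaces.linear (*s) (*s) T"
  proof -
    have "D x (u + v) = D x u + D x v" "D x (c *s v) = c * D x v" for x u v c
      using D(1)[of x] by (simp_all add: Vector_Spaces.linear_def module_hom_def module_hom_axioms_def)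
    then show ?thesis by unfold_locales (auto simp: T_def vec_eq_iff algebra_simps)
  qed
  moreover have "(F has_derivative T) (at p)"
  proof -
    have bl: "bounded_linear (\<lambda>c::complex. c *s (axis x 1 :: complex ^ 'g))" for x
      by (rule linear_conv_bounded_linear[THEN iffD1], rule linearI)
        (auto simp: vec_eq_iff axis_def algebra_simps)
    have e: "v = (\<Sum>x\<in>UNIV. v $ x *s axis x 1)" for v :: "complex ^ 'g"
      by (auto simp: vec_eq_iff axis_def if_distrib[where f = "(*) _"] cong: if_cong)
    have "((\<lambda>p. \<Sum>x\<in>UNIV. F p $ x *s axis x 1) has_derivative (\<lambda>v. \<Sum>x\<in>UNIV. D x v *s axis x 1)) (at p)"
      by (intro has_derivative_sum bounded_linear.has_derivative[OF bl] D(2))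
    moreover have "(\<lambda>v. \<Sum>x\<in>UNIV. D x v *s axis x 1) = T"
      using e[of "T _"] by (auto simp: T_def)
    ultimately show ?thesis using e[of "F _"] by simp
  qed
  ultimately show ?thesis using that by blast
qed

text \<open>By the chain rule the derivative of the inverse chart is a left inverse of the
  derivative of the chart. The latter is therefore a complex linear automorphism and carries the
  tangent space onto the slice.\<close>

lemma integral_manifold_dim:
  fixes X :: "(complex ^ 'g::finite) topology"
  assumes "integral_manifold k \<Delta> X" "p \<in> topspace X"
  shows "vec.dim (\<Delta> p) = k"
proof -
  obtain W F S where chart: "slice_chart k X p W F S"
    and tan: "{v. frechet_derivative F (at p) v \<in> S} = \<Delta> p"
    using assms by (auto simp: integral_manifold_def)
  have S: "vec.subspace S" "vec.dim S = k" and p: "p \<in> W" and bi: "biholomorphic_on W F"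
    using chart by (auto simp: slice_chart_def)
  obtain G where W: "open W" and F: "holomorphic_map W F" and G: "holomorphic_map (F ` W) G" "\<And>p. p \<in> W \<Longrightarrow> G (F p) = p"
    using bi by (auto simp: biholomorphic_on_def)
  obtain D where D: "Vector_Spaces.linear (*s) (*s) D" "(F has_derivative D) (at p)"
    using holomorphic_map_derivative[OF F p] .
  obtain E where E: "(G has_derivative E) (at (F p))"
    using holomorphic_map_derivative[OF G(1)] p by (metis imageI)
  have "((\<lambda>p. G (F p)) has_derivative (\<lambda>v. E (D v))) (at p)"
    by (rule has_derivative_compose[OF D(2) E])
  then have "((\<lambda>p. p) has_derivative (\<lambda>v. E (D v))) (at p)"
    by (rule has_derivative_transform_within_open[OF _ W p]) (use G in auto)
  then have "(\<lambda>v. E (D v)) = (\<lambda>v. v)"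
    using has_derivative_unique has_derivative_ident by blast
  then have inj: "inj D" by (metis injI)
  then have surj: "surj D" by (rule vec.linear_inj_imp_surj[OF D(1)])
  have "frechet_derivative F (at p) = D" using frechet_derivative_at[OF D(2)] by simp
  then have "D ` \<Delta> p = S" using tan surj by (auto simp: surj_def) (metis imageI mem_Collect_eq)
  moreover have "vec.dim (D ` \<Delta> p) = vec.dim (\<Delta> p)"
    by (rule vec.dim_image_eq[OF D(1) inj_on_subset[OF inj subset_UNIV]])
  ultimately show ?thesis using S by simp
qed

section \<open>Modules over \<open>B\<^sub>\<epsilon>(N)\<close>\<close>

text \<open>Split y_i at the index of \<open>x\<close>. Below it both factors of each product
  commute with \<open>x\<close> up to the same scalar, which is therefore squared; the tail from the
  index of \<open>x\<close> on is covered by \<open>yz\<close> and \<open>z'y\<close>.\<close>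

lemma yb_zb_above:
  assumes "i \<le> idx x"
  shows "yb {i..} * zb x = sc (\<lambda>q. (qq q x)\<^sup>2) * (zb x * yb {i..})"
proof -
  let ?j = "idx x"
  have low: "zb (Inl k) * zb (Inr k) * zb x = sc (\<lambda>q. (qq q x)\<^sup>2) * (zb x * (zb (Inl k) * zb (Inr k)))"
    if "k < ?j" for k
  proof -
    have 1: "zb (Inl k) * zb x = sc (\<lambda>q. qq q x) * (zb x * zb (Inl k))"
      and 2: "zb (Inr k) * zb x = sc (\<lambda>q. qq q x) * (zb x * zb (Inr k))"
      using zb_commute[of "Inl k" x] zb_commute[of "Inr k" x] that by simp_all
    have "zb (Inl k) * zb (Inr k) * zb x = zb (Inl k) * (zb (Inr k) * zb x)" by (simp only: mult.assoc)
    also have "\<dots> = sc (\<lambda>q. qq q x) * (zb (Inl k) * zb x * zb (Inr k))"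
      unfolding 2 by (simp only: sc_left_commute[of "zb (Inl k)"] mult.assoc)
    also have "\<dots> = sc (\<lambda>q. qq q x) * (sc (\<lambda>q. qq q x) * (zb x * (zb (Inl k) * zb (Inr k))))"
      unfolding 1 by (simp only: mult.assoc)
    finally show ?thesis by (simp only: sc_mult_left power2_eq_square)
  qed
  have top: "yb {?j..} * zb x = sc (\<lambda>q. (qq q x)\<^sup>2) * (zb x * yb {?j..})"
  proof (cases x)
    case (Inl j)
    then show ?thesis using yz[of j] by simp
  next
    case (Inr j)
    have "sc (\<lambda>q. q\<^sup>2) * (zb (Inr j) * yb {j..}) = sc (\<lambda>q. q\<^sup>2 * pinv q) * (yb {j..} * zb (Inr j))"
      unfolding z'y sc_mult_left ..
    also have "sc (\<lambda>q. q\<^sup>2 * pinv q) = sc (\<lambda>q. 1)"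
      by (rule sc_cong) (simp flip: power_mult_distrib)
    finally show ?thesis using Inr by simp
  qed
  have "{i..} = {i..<?j} \<union> {?j..}" using assms by auto
  then have y: "yb {i..} = yb {i..<?j} + yb {?j..}"
    unfolding yb_def by (simp only:) (rule sum.union_disjoint; auto)
  have "yb {i..<?j} * zb x = sc (\<lambda>q. (qq q x)\<^sup>2) * (zb x * yb {i..<?j})"
    unfolding yb_def sum_distrib_left sum_distrib_right by (intro sum.cong refl low) simp
  then show ?thesis unfolding y by (simp add: top distrib_left distrib_right)
qed

text \<open>The relations are identities between families in q and are specialised to \<epsilon> by
  \<open>cls_eqI\<close>; only the m-th power of y_i is an identity special to \<epsilon>. Stability
  under the generators gives stability under all words, hence under the whole algebra.\<close>

lemma B_system_of_module:
  fixes \<rho> :: "('n::{finite,linorder}) free_alg \<Rightarrow> 'v::ab_group_add \<Rightarrow> 'v"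
  assumes odd: "odd m" and prim: "primitive_root_of_unity m \<epsilon>"
    and irr: "irreducible_B_module \<epsilon> smul \<rho>"
    and pow: "\<And>x v. \<rho> (gvar x ^ m) v = smul (a x) v"
  shows "B_system smul \<epsilon> m UNIV UNIV (\<lambda>x. \<rho> (gvar x)) {} a"
proof -
  have mod: "B_module \<epsilon> smul \<rho>" and ex: "\<exists>v::'v. v \<noteq> 0"
    and simple: "\<And>W. module.subspace smul W \<Longrightarrow> (\<forall>f. \<rho> f ` W \<subseteq> W) \<Longrightarrow> W = {0} \<or> W = UNIV"
    using irr by (auto simp: irreducible_B_module_def)
  have vs: "vector_space smul" and linear: "\<And>f. Vector_Spaces.linear smul smul (\<rho> f)"
    and add: "\<And>f g v. \<rho> (f + g) v = \<rho> f v + \<rho> g v"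
    and mult: "\<And>f g v. \<rho> (f * g) v = \<rho> f (\<rho> g v)"
    and scal: "\<And>c v. \<rho> (scalar c) v = smul c v"
    and ideal: "\<And>f v. f \<in> B_ideal \<epsilon> \<Longrightarrow> \<rho> f v = 0"
    using mod by (auto simp: B_module_def)
  interpret complex_space smul by (simp add: complex_space_def vs)
  note root = root_facts[OF odd prim]
  let ?w = "\<lambda>x. \<rho> (gvar x)"
  have lin: "lin (\<rho> f)" for f
    using linear[of f] by (simp add: lin_def Vector_Spaces.linear_def module_hom_def module_hom_axioms_def)
  have zero: "\<rho> 0 v = 0" for v using add[of 0 0 v] by simp
  have one: "\<rho> 1 v = v" for v using scal[of 1 v] by simp
  have diff: "\<rho> (f - g) v = \<rho> f v - \<rho> g v" for f g v using add[of "f - g" g v] by simp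
  have sum: "\<rho> (\<Sum>k\<in>A. f k) v = (\<Sum>k\<in>A. \<rho> (f k) v)" for A :: "'n set" and f v
    by (induction A rule: infinite_finite_induct) (auto simp: zero add)
  have power: "\<rho> (f ^ n) = \<rho> f ^^ n" for f n
    by (induction n) (auto simp: one mult fun_eq_iff)
  have eqI: "\<rho> f v = \<rho> g v" if "eq_in_B \<epsilon> f g" for f g v
    using ideal[of "f - g" v] that by (simp add: eq_in_B_def diff)
  have cls_eqI: "\<rho> (f \<epsilon>) v = \<rho> (g \<epsilon>) v" if "cls f = cls g" for f g v
    by (rule eqI[OF cls_eqD[OF that root(3)]])
  have gen: "preserves U (\<rho> f)" if U: "subspace U" and st: "\<And>x. preserves U (?w x)" for U f
  proof (induction f rule: poly_mapping_single_induct)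
    case 1
    then show ?case using subspace_0[OF U] by (simp add: preserves_def zero)
  next
    case (2 u c)
    have "preserves U (\<rho> (Poly_Mapping.single (Word xs) c))" for xs
    proof (induction xs)
      case Nil
      have "Poly_Mapping.single (Word []) c = (scalar c :: 'n free_alg)"
        by (simp add: scalar_def zero_word_def)
      then show ?case using subspace_scale[OF U] by (simp add: preserves_def scal)
    next
      case (Cons x xs)
      have "Poly_Mapping.single (Word (x # xs)) c = gvar x * Poly_Mapping.single (Word xs) c"
        by (simp add: gvar_def mult_single plus_word_def)
      then show ?case using Cons st[of x] by (simp add: preserves_def mult)
    qed
    then show ?case by (metis word.exhaust)
  next
    case (3 f g)
    then show ?case using subspace_add[OF U] by (simp add: preserves_def add)
  qed
  have yop: "yop UNIV ?w i v = \<rho> (\<Sum>k\<in>{i..}. Z k * Zs k) v" for i v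
    by (simp add: yop_def sum mult atLeast_def)
  have cls_y: "cls (\<lambda>q. \<Sum>k\<in>{i..}. Z k * Zs k) = yb {i..}" for i :: 'n
    by (simp only: cls_simps yb_def)
  show ?thesis
  proof unfold_locales
    show "irr UNIV (?w ` {x. idx x \<in> UNIV} \<union> {})"
      unfolding irr_def
    proof (intro conjI allI impI ballI)
      fix U assume U: "subspace U \<and> U \<subseteq> UNIV \<and> (\<forall>A\<in>?w ` {x. idx x \<in> UNIV} \<union> {}. preserves U A)"
      then have "subspace U" "preserves U (?w x)" for x by auto
      then have "preserves U (\<rho> f)" for f by (rule gen)
      then show "U = {0} \<or> U = UNIV" using simple[of U] U by (auto simp: preserves_def)
    qed (use ex lin in \<open>auto simp: preserves_def\<close>)
    show "qcomm UNIV (qq \<epsilon> y) (?w x) (?w y)" if "idx x < idx y" for x y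
    proof -
      have "cls (\<lambda>q. gvar x * gvar y) = cls (\<lambda>q. scalar (qq q y) * (gvar y * gvar x))"
        using zb_commute[OF that] by (simp only: cls_simps)
      from cls_eqI[OF this] show ?thesis by (simp add: qcomm_def mult scal)
    qed
    show "?w (Inr i) (?w (Inl i) v) = ?w (Inl i) (?w (Inr i) v) - smul (1 - (inverse \<epsilon>)\<^sup>2) (yop UNIV ?w i v)" for i v
    proof -
      have "zb (Inr i) * zb (Inl i) = zb (Inl i) * zb (Inr i) - sc (\<lambda>q. 1 - pinv q) * yb {i..}"
        unfolding z'z zz' sc_diff by (simp add: left_diff_distrib)
      then have "cls (\<lambda>q. Zs i * Z i) = cls (\<lambda>q. Z i * Zs i - scalar (1 - pinv q) * (\<Sum>k\<in>{i..}. Z k * Zs k))"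
        by (simp only: cls_diff cls_mult cls_gvar cls_scalar cls_y)
      from cls_eqI[OF this] show ?thesis by (simp add: mult diff scal yop)
    qed
    show "qcomm UNIV ((qq \<epsilon> x)\<^sup>2) (yop UNIV ?w i) (?w x)" if "i \<le> idx x" for i x
    proof -
      have "cls (\<lambda>q. (\<Sum>k\<in>{i..}. Z k * Zs k) * gvar x)
          = cls (\<lambda>q. scalar ((qq q x)\<^sup>2) * (gvar x * (\<Sum>k\<in>{i..}. Z k * Zs k)))"
        using yb_zb_above[OF that] by (simp only: cls_mult cls_gvar cls_scalar cls_y)
      from cls_eqI[OF this] show ?thesis by (simp add: qcomm_def mult scal yop)
    qed
    show "qcomm UNIV 1 (yop UNIV ?w i) (?w x)" if "idx x < i" for i x
    proof -
      have "zb x * yb {i..} = yb {i..} * zb x" by (rule zb_yb_commute) (use that in auto)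
      then have "cls (\<lambda>q. (\<Sum>k\<in>{i..}. Z k * Zs k) * gvar x) = cls (\<lambda>q. gvar x * (\<Sum>k\<in>{i..}. Z k * Zs k))"
        by (simp only: cls_mult cls_gvar cls_y)
      from cls_eqI[OF this] show ?thesis by (simp add: qcomm_def mult yop)
    qed
    show "(?w x ^^ m) v = smul (a x) v" for x v
      using pow by (simp add: power)
    show "(yop UNIV ?w i ^^ m) v = smul (casimir UNIV a i) v" for i v
    proof -
      have "eq_at \<epsilon> (cls (\<lambda>q. (\<Sum>k\<in>{i..}. Z k * Zs k) ^ m)) (cls (\<lambda>q. \<Sum>k\<in>{i..}. Z k ^ m * Zs k ^ m))"
        using yb_power[OF odd prim, of i] by (simp only: cls_power cls_y cls_sum cls_mult cls_gvar)
      then have "\<rho> ((\<Sum>k\<in>{i..}. Z k * Zs k) ^ m) v = \<rho> (\<Sum>k\<in>{i..}. Z k ^ m * Zs k ^ m) v"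
        unfolding eq_at_cls[OF root(3)] by (rule eqI)
      moreover have "yop UNIV ?w i = \<rho> (\<Sum>k\<in>{i..}. Z k * Zs k)" using yop by blast
      ultimately have "(yop UNIV ?w i ^^ m) v = \<rho> (\<Sum>k\<in>{i..}. Z k ^ m * Zs k ^ m) v"
        by (simp only: power)
      also have "\<dots> = (\<Sum>k\<in>{i..}. smul (a (Inl k) * a (Inr k)) v)"
        by (simp add: sum mult pow mult.commute)
      finally show ?thesis by (simp add: casimir_def scale_sum_left atLeast_def)
    qed
  qed (use odd prim lin in auto)
qed

theorem mainTheorem7:
  fixes m k :: nat and \<epsilon> :: complex
    and smul :: "complex \<Rightarrow> 'v::ab_group_add \<Rightarrow> 'v"
    and \<rho> :: "('n::{finite,linorder}) free_alg \<Rightarrow> 'v \<Rightarrow> 'v"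
    and a a' :: "'n \<Rightarrow> complex"
    and Leaf :: "(complex ^ 'n gen) topology"
  assumes "odd m"
    and "primitive_root_of_unity m \<epsilon>"
    and "irreducible_B_module \<epsilon> smul \<rho>"
    and "\<And>i v. \<rho> (Z i ^ m) v = smul (a i) v"
    and "\<And>i v. \<rho> (Zs i ^ m) v = smul (a' i) v"
    and "symplectic_leaf \<epsilon> m k Leaf"
    and "(\<chi> x. case x of Inl i \<Rightarrow> a i | Inr i \<Rightarrow> a' i) \<in> topspace Leaf"
  shows "real (vector_space.dim smul (UNIV :: 'v set)) = real m powr (1/2 * real k)"
proof -
  define p :: "complex ^ 'n gen" where "p = (\<chi> x. case x of Inl i \<Rightarrow> a i | Inr i \<Rightarrow> a' i)"
  have "\<rho> (gvar x ^ m) v = smul (p $ x) v" for x v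
    using assms(4,5) by (cases x) (simp_all add: p_def)
  from B_system_of_module[OF assms(1-3) this]
  interpret B_system smul \<epsilon> m UNIV UNIV "\<lambda>x. \<rho> (gvar x)" "{}" "\<lambda>x. p $ x" .
  obtain e where e: "has_basis_card UNIV (m ^ e)" "mrank (bmat UNIV False (\<lambda>x. p $ x)) = 2 * e"
    using B_system_dim[OF B_system_axioms] by auto
  have "integral_manifold k (hamiltonian_distribution \<epsilon> m) Leaf" "p \<in> topspace Leaf"
    using assms(6,7) unfolding symplectic_leaf_def p_def by blast+
  from integral_manifold_dim[OF this] have "k = 2 * e"
    unfolding dim_hamiltonian_distribution[OF assms(1,2)] e(2) by simp
  moreover have "dim UNIV = m ^ e" by (rule has_basis_card_dim[OF e(1)])
  ultimately show ?thesis using m_pos by (simp add: powr_realpow)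
qed

end
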